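(* Let $X$ be a fractional Wiener--Weierstra\ss\ bridge with parameters $\alpha\in(0,1)$, $b\in\{2,3,\dots\}$ and $H\in(0,1)$, and put $K:=1\wedge(-\log_b\alpha)$. Suppose $H\neq K$ and set $p:=1/(H\wedge K)$. Then, $\mathbb P$-almost surely, $\langle X\rangle^{(q)}_1=\infty$ for every $q<p$ and $\langle X\rangle^{(q)}_1=0$ for every $q>p$. More precisely: (a) If $H>K$, there exists a random variable $V$ with $0<V<\infty$ a.s. such that $\mathbb P$-a.s., for all $t\in[0,1]$, $\langle X\rangle^{(1/K)}_t=V\cdot t$. (b) If $H<K$, then $\mathbb P$-a.s., for all $t\in[0,1]$, $$\langle X\rangle^{(1/H)}_t=\frac{2^{1/(2H)}\,\Gamma\big(\frac{H+1}{2H}\big)}{\sqrt\pi\,(1-\alpha^2b^{2H})^{1/(2H)}}\cdot t .$$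
   Context: Let $W=(W(t))_{t\ge0}$ be a fractional Brownian motion with Hurst parameter $H\in(0,1)$. Let $\kappa:[0,1]\to[0,1]$ be a deterministic function with $\kappa(0)=0$, $\kappa(1)=1$ that is H\"older continuous with some exponent $\tau\in(H,1]$. The fractional Brownian bridge is $B(t):=W(t)-\kappa(t)W(1)$, $t\in[0,1]$. For $x\ge0$, $\{x\}$ denotes the fractional part of $x$. For $\alpha\in(0,1)$, $b\in\{2,3,\dots\}$, the fractional Wiener--Weierstra\ss\ bridge is $X(t):=\sum_{n=0}^\infty\alpha^nB(\{b^nt\})$, $0\le t\le1$. For a function $f:[0,1]\to\mathbb R$ and $p>0$, the $p$-th variation along the $b$-adic partitions is $\langle f\rangle^{(p)}_t:=\lim_{n\to\infty}\sum_{k=0}^{\lfloor tb^n\rfloor-1}|f((k+1)b^{-n})-f(kb^{-n})|^p$, $t\in[0,1]$, provided the limit exists (possibly $+\infty$). *)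

theory Defs
  imports "HOL-Probability.Probability"
begin

definition fbm_cov :: "real \<Rightarrow> real \<Rightarrow> real \<Rightarrow> real" where
  "fbm_cov H s t = ((s powr (2*H)) + (t powr (2*H)) - (\<bar>t - s\<bar> powr (2*H))) / 2"

text \<open>W is a fractional Brownian motion with Hurst parameter H on the probability space M:
  each W t (t \<ge> 0) is a real random variable, the process is centred jointly Gaussian with
  covariance fbm_cov H (expressed through the joint characteristic function of all finite
  families), and almost all sample paths are continuous on [0,\<infinity>).\<close>
definition is_fbm :: "'a measure \<Rightarrow> real \<Rightarrow> (real \<Rightarrow> 'a \<Rightarrow> real) \<Rightarrow> bool" where
  "is_fbm M H W \<longleftrightarrow> prob_space M \<and>
     (\<forall>t\<ge>0. W t \<in> borel_measurable M) \<and>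
     (\<forall>(n::nat) (ts::nat \<Rightarrow> real) (c::nat \<Rightarrow> real). (\<forall>i<n. ts i \<ge> 0) \<longrightarrow>
        (\<integral>\<omega>. cis (\<Sum>i<n. c i * W (ts i) \<omega>) \<partial>M)
          = complex_of_real (exp (- (\<Sum>i<n. \<Sum>j<n. c i * c j * fbm_cov H (ts i) (ts j)) / 2))) \<and>
     (AE \<omega> in M. continuous_on {0..} (\<lambda>t. W t \<omega>))"

definition fbb :: "(real \<Rightarrow> real) \<Rightarrow> (real \<Rightarrow> 'a \<Rightarrow> real) \<Rightarrow> real \<Rightarrow> 'a \<Rightarrow> real" where
  "fbb \<kappa> W t \<omega> = W t \<omega> - \<kappa> t * W 1 \<omega>"

definition fwwb :: "real \<Rightarrow> nat \<Rightarrow> (real \<Rightarrow> real) \<Rightarrow> (real \<Rightarrow> 'a \<Rightarrow> real) \<Rightarrow> real \<Rightarrow> 'a \<Rightarrow> real" where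
  "fwwb \<alpha> b \<kappa> W t \<omega> = (\<Sum>n. \<alpha> ^ n * fbb \<kappa> W (frac (real b ^ n * t)) \<omega>)"

definition pvar_sum :: "(real \<Rightarrow> real) \<Rightarrow> nat \<Rightarrow> real \<Rightarrow> real \<Rightarrow> nat \<Rightarrow> real" where
  "pvar_sum f b p t n =
     (\<Sum>k<nat \<lfloor>t * real b ^ n\<rfloor>. \<bar>f (real (k+1) / real b ^ n) - f (real k / real b ^ n)\<bar> powr p)"

definition has_pvar :: "(real \<Rightarrow> real) \<Rightarrow> nat \<Rightarrow> real \<Rightarrow> real \<Rightarrow> ereal \<Rightarrow> bool" where
  "has_pvar f b p t v \<longleftrightarrow> ((\<lambda>n. ereal (pvar_sum f b p t n)) \<longlongrightarrow> v) sequentially"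

end

theory Submission
  imports Defs
begin

text \<open>
  The increment of \<open>X\<close> over the \<open>k\<close>-th b-adic interval of level \<open>N\<close> is
  \<open>\<Sum>m = 1..N. \<alpha> ^ (N - m) * \<Delta> m (k mod b ^ m)\<close>, where \<open>\<Delta> m j\<close> is the increment of the bridge over
  the \<open>j\<close>-th interval of level \<open>m\<close>.

  If \<open>- log b \<alpha> < H\<close>, then after division by \<open>\<alpha> ^ N\<close> these sums converge geometrically fast, uniformly
  in \<open>k\<close>. They are uniform limits of \<open>b ^ m\<close>-periodic functions of \<open>k\<close>, so their \<open>p\<close>-th powers have averages
  along the partition that converge to a multiple of \<open>t\<close>. The multiple is positive unless the limit for
  \<open>k = 0\<close> vanishes; but the partial sums for \<open>k = 0\<close> are Gaussian with variances bounded away from 0,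
  since their covariance with the second difference of \<open>W\<close> at \<open>1 / b\<close> with step \<open>h\<close> equals
  \<open>- h powr (2 * H) / \<alpha>\<close>, from the term \<open>m = 1\<close>, up to an error of order \<open>h\<^sup>2\<close>.

  If \<open>H < - log b \<alpha>\<close>, then after multiplication by \<open>b powr (H * N)\<close> the sums are, up to a uniformly small
  perturbation caused by \<open>\<kappa>\<close>, a centred Gaussian array with bounded variances whose correlations are
  small on average. Hence the averages of their cosines converge almost surely to the characteristic
  function of a normal distribution; bounded averages of \<open>cosh\<close> upgrade this weak convergence to
  convergence of absolute moments.

  Since the largest increment tends to 0, a finite positive variation at one exponent decides all others.
\<close>

section \<open>Averages along b-adic partitions\<close>

locale badic =
  fixes b :: nat
  assumes base_ge_2: "2 \<le> b"
begin

lemma base_gt_1: "1 < real b"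
  using base_ge_2 by simp

lemma base_gt_Suc_0 [simp]: "Suc 0 < b"
  using base_ge_2 by simp

lemma base_pos [simp]: "0 < b"
  using base_ge_2 by simp

lemma base_nonzero [simp]: "b \<noteq> 0"
  using base_ge_2 by simp

end

definition badic_count :: "nat \<Rightarrow> real \<Rightarrow> nat \<Rightarrow> nat" where
  "badic_count b t N = nat \<lfloor>t * real b ^ N\<rfloor>"

definition badic_average :: "nat \<Rightarrow> real \<Rightarrow> nat \<Rightarrow> (nat \<Rightarrow> real) \<Rightarrow> real" where
  "badic_average b t N g = (\<Sum>k<badic_count b t N. g k) / real b ^ N"

abbreviation badic_mean :: "nat \<Rightarrow> nat \<Rightarrow> (nat \<Rightarrow> real) \<Rightarrow> real" where
  "badic_mean b \<equiv> badic_average b 1"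

lemma badic_count_1 [simp]: "badic_count b 1 N = b ^ N"
  by (simp add: badic_count_def flip: of_nat_power)

lemma badic_count_mono: "s \<le> t \<Longrightarrow> badic_count b s N \<le> badic_count b t N"
  unfolding badic_count_def by (intro nat_mono floor_mono mult_right_mono) auto

lemma badic_count_le_power: "t \<le> 1 \<Longrightarrow> badic_count b t N \<le> b ^ N"
  using badic_count_mono[of t 1] by simp

lemma badic_average_nonneg: "(\<And>k. 0 \<le> g k) \<Longrightarrow> 0 \<le> badic_average b t N g"
  by (simp add: badic_average_def sum_nonneg)

lemma badic_average_mono:
  "(\<And>k. k < badic_count b t N \<Longrightarrow> f k \<le> g k) \<Longrightarrow> badic_average b t N f \<le> badic_average b t N g"
  unfolding badic_average_def by (intro divide_right_mono sum_mono) auto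

lemma badic_average_mono_time:
  assumes "s \<le> t" and "\<And>k. 0 \<le> g k"
  shows "badic_average b s N g \<le> badic_average b t N g"
  unfolding badic_average_def using assms badic_count_mono[of s t b N]
  by (intro divide_right_mono sum_mono2) auto

lemma abs_badic_average_le: "\<bar>badic_average b t N g\<bar> \<le> badic_average b t N (\<lambda>k. \<bar>g k\<bar>)"
  unfolding badic_average_def by (simp add: divide_right_mono)

lemma badic_average_add:
  "badic_average b t N (\<lambda>k. f k + g k) = badic_average b t N f + badic_average b t N g"
  by (simp add: badic_average_def sum.distrib add_divide_distrib)

lemma badic_average_diff:
  "badic_average b t N (\<lambda>k. f k - g k) = badic_average b t N f - badic_average b t N g"
  by (simp add: badic_average_def sum_subtractf diff_divide_distrib)

lemma badic_average_cmult: "badic_average b t N (\<lambda>k. c * g k) = c * badic_average b t N g"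
  by (simp add: badic_average_def sum_distrib_left)

lemma badic_average_sum:
  "badic_average b t N (\<lambda>k. \<Sum>i\<in>A. g i k) = (\<Sum>i\<in>A. badic_average b t N (g i))"
  unfolding badic_average_def sum_divide_distrib by (rule sum.swap)

lemma badic_average_swap:
  "badic_average b s M (\<lambda>k. badic_average b t N (\<lambda>l. g k l))
     = badic_average b t N (\<lambda>l. badic_average b s M (\<lambda>k. g k l))"
  unfolding badic_average_def sum_divide_distrib by (subst sum.swap) (simp add: mult.commute)

lemma (in badic) badic_mean_const [simp]: "badic_mean b N (\<lambda>_. c) = c"
  by (simp add: badic_average_def)

lemma (in badic) badic_average_le_const:
  assumes "t \<le> 1" "0 \<le> c" and "\<And>k. k < b ^ N \<Longrightarrow> g k \<le> c"
  shows "badic_average b t N g \<le> c"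
proof -
  have "badic_average b t N g \<le> badic_average b t N (\<lambda>_. c)"
    using assms badic_count_le_power[of t b N] by (intro badic_average_mono) auto
  also have "\<dots> \<le> badic_mean b N (\<lambda>_. c)"
    using assms by (intro badic_average_mono_time)
  finally show ?thesis by simp
qed

lemma sum_lessThan_mult_blocks:
  fixes F :: "nat \<Rightarrow> 'a::comm_monoid_add"
  shows "(\<Sum>k<n * P. F k) = (\<Sum>c<n. \<Sum>a<P. F (c * P + a))"
proof -
  have "sum F {c * P..<c * P + P} = (\<Sum>a<P. F (c * P + a))" for c
    using sum.shift_bounds_nat_ivl[of F 0 "c * P" P] by (simp add: add.commute lessThan_atLeast0)
  then show ?thesis
    by (simp add: sum.nat_group[symmetric])
qed

lemma (in badic) badic_mean_mod:
  assumes "M \<le> N"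
  shows "badic_mean b N (\<lambda>k. g (k mod b ^ M)) = badic_mean b M g"
proof -
  have split: "b ^ N = b ^ (N - M) * b ^ M" using assms by (simp flip: power_add)
  have "(\<Sum>k<b ^ N. g (k mod b ^ M)) = (\<Sum>c<b ^ (N - M). \<Sum>a<b ^ M. g a)"
    unfolding split sum_lessThan_mult_blocks by (intro sum.cong refl) simp
  also have "\<dots> / real b ^ N = (\<Sum>a<b ^ M. g a) / real b ^ M"
    by (simp add: split flip: of_nat_power)
  finally show ?thesis
    by (simp add: badic_average_def)
qed

lemma (in badic) badic_count_ratio_tendsto:
  assumes "0 \<le> t"
  shows "(\<lambda>N. real (badic_count b t N) / real b ^ N) \<longlonglongrightarrow> t"
proof (rule tendsto_sandwich[OF _ _ _ tendsto_const])
  have "(\<lambda>N. t - 1 / real b ^ N) \<longlonglongrightarrow> t - 0"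
    by (intro tendsto_diff tendsto_const LIMSEQ_divide_realpow_zero base_gt_1)
  then show "(\<lambda>N. t - 1 / real b ^ N) \<longlonglongrightarrow> t" by simp
  have count: "real (badic_count b t N) = of_int \<lfloor>t * real b ^ N\<rfloor>" for N
    using assms by (simp add: badic_count_def)
  have "(t * real b ^ N - 1) / real b ^ N \<le> real (badic_count b t N) / real b ^ N"
    "real (badic_count b t N) / real b ^ N \<le> t * real b ^ N / real b ^ N" for N
    unfolding count by (intro divide_right_mono, linarith, simp)+
  then show "\<forall>\<^sub>F N in sequentially. t - 1 / real b ^ N \<le> real (badic_count b t N) / real b ^ N"
    and "\<forall>\<^sub>F N in sequentially. real (badic_count b t N) / real b ^ N \<le> t"
    by (simp_all add: diff_divide_distrib)
qed

lemma (in badic) badic_average_const_tendsto: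
  "0 \<le> t \<Longrightarrow> (\<lambda>N. badic_average b t N (\<lambda>_. c)) \<longlonglongrightarrow> t * c"
  using tendsto_mult_right[OF badic_count_ratio_tendsto[of t], of c]
  by (simp add: badic_average_def)

lemma sum_periodic_mean_zero:
  fixes f :: "nat \<Rightarrow> 'a::comm_monoid_add"
  assumes periodic: "\<And>k. f (k mod P) = f k" and mean_zero: "(\<Sum>k<P. f k) = 0"
  shows "(\<Sum>k<L. f k) = (\<Sum>k<L mod P. f k)"
proof -
  have shift: "f (c * P + a) = f a" for c a
    using periodic[of "c * P + a"] periodic[of a] by simp
  have "(\<Sum>k<L. f k) = (\<Sum>k<(L div P) * P. f k) + (\<Sum>k\<in>{(L div P) * P..<(L div P) * P + L mod P}. f k)"
    unfolding lessThan_atLeast0 by (subst sum.atLeastLessThan_concat) auto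
  also have "(\<Sum>k<(L div P) * P. f k) = 0"
    by (simp add: sum_lessThan_mult_blocks shift mean_zero)
  also have "(\<Sum>k\<in>{(L div P) * P..<(L div P) * P + L mod P}. f k) = (\<Sum>k<L mod P. f k)"
    using sum.shift_bounds_nat_ivl[of f 0 "(L div P) * P" "L mod P"]
    by (simp only: add.commute[of _ "(L div P) * P"] shift add_0_left add_0_right lessThan_atLeast0)
  finally show ?thesis by simp
qed

lemma (in badic) badic_average_periodic_tendsto:
  assumes periodic: "\<And>k. g (k mod b ^ M) = g k" and t: "0 \<le> t"
  shows "(\<lambda>N. badic_average b t N g) \<longlonglongrightarrow> t * badic_mean b M g"
proof -
  define f where "f k = g k - badic_mean b M g" for k
  have "(\<Sum>k<b ^ M. f k) = 0"
    by (simp add: f_def sum_subtractf badic_average_def)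
  then have "(\<Sum>k<L. f k) = (\<Sum>k<L mod b ^ M. f k)" for L
    by (rule sum_periodic_mean_zero[rotated]) (simp add: f_def periodic)
  moreover have "\<bar>\<Sum>k<L mod b ^ M. f k\<bar> \<le> (\<Sum>k<b ^ M. \<bar>f k\<bar>)" for L
    by (intro order_trans[OF sum_abs] sum_mono2) (auto intro: less_trans)
  ultimately have "\<bar>badic_average b t N f\<bar> \<le> (\<Sum>k<b ^ M. \<bar>f k\<bar>) / real b ^ N" for N
    by (simp add: badic_average_def divide_right_mono)
  then have "(\<lambda>N. badic_average b t N f) \<longlonglongrightarrow> 0"
    by (intro Lim_null_comparison[OF _ LIMSEQ_divide_realpow_zero[OF base_gt_1, of "\<Sum>k<b ^ M. \<bar>f k\<bar>"]]) simp
  from tendsto_add[OF this badic_average_const_tendsto[OF t, of "badic_mean b M g"]]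
  show ?thesis by (simp add: f_def[abs_def] badic_average_diff)
qed

lemma (in badic) abs_badic_mean_diff_le:
  assumes periodic: "\<And>k. f (k mod b ^ M) = f k" and "M \<le> N" and close: "\<And>k. \<bar>g k - f k\<bar> \<le> e"
  shows "\<bar>badic_mean b N g - badic_mean b M f\<bar> \<le> e"
proof -
  have "badic_mean b M f = badic_mean b N f"
    using badic_mean_mod[OF \<open>M \<le> N\<close>, of f] by (simp add: periodic)
  then have "\<bar>badic_mean b N g - badic_mean b M f\<bar> \<le> badic_mean b N (\<lambda>k. \<bar>g k - f k\<bar>)"
    using abs_badic_average_le[of b 1 N "\<lambda>k. g k - f k"] by (simp add: badic_average_diff)
  also have "\<dots> \<le> badic_mean b N (\<lambda>_. e)" by (intro badic_average_mono close)
  finally show ?thesis by simp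
qed

lemma (in badic) badic_mean_uniform_limit:
  assumes periodic: "\<And>N k. g N (k mod b ^ N) = g N k"
    and uniform: "\<And>e. 0 < e \<Longrightarrow> \<exists>M. \<forall>N\<ge>M. \<forall>k. \<bar>g N k - g M k\<bar> \<le> e"
  obtains V where "\<And>e. 0 < e \<Longrightarrow>
    \<exists>M. \<bar>badic_mean b M (g M) - V\<bar> \<le> e \<and> (\<forall>N\<ge>M. \<forall>k. \<bar>g N k - g M k\<bar> \<le> e)"
proof -
  let ?A = "\<lambda>N. badic_mean b N (g N)"
  note close = abs_badic_mean_diff_le[where f = "g M" and M = M for M, OF periodic]
  have "Cauchy ?A"
  proof (rule metric_CauchyI)
    fix e :: real assume "0 < e"
    then obtain M where M: "\<And>N k. M \<le> N \<Longrightarrow> \<bar>g N k - g M k\<bar> \<le> e / 3"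
      using uniform[of "e / 3"] by auto
    have "dist (?A m) (?A n) < e" if "M \<le> m" "M \<le> n" for m n
      using close[OF that(1) M[OF that(1)]] close[OF that(2) M[OF that(2)]] \<open>0 < e\<close>
      unfolding dist_real_def by linarith
    then show "\<exists>M. \<forall>m\<ge>M. \<forall>n\<ge>M. dist (?A m) (?A n) < e" by blast
  qed
  then obtain V where V: "?A \<longlonglongrightarrow> V"
    using Cauchy_convergent convergent_def by blast
  have "\<exists>M. \<bar>?A M - V\<bar> \<le> e \<and> (\<forall>N\<ge>M. \<forall>k. \<bar>g N k - g M k\<bar> \<le> e)" if "0 < e" for e
  proof -
    obtain M where M: "\<And>N k. M \<le> N \<Longrightarrow> \<bar>g N k - g M k\<bar> \<le> e"
      using uniform[OF \<open>0 < e\<close>] by blast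
    have "\<bar>V - ?A M\<bar> \<le> e"
    proof (rule tendsto_upperbound)
      show "(\<lambda>N. \<bar>?A N - ?A M\<bar>) \<longlonglongrightarrow> \<bar>V - ?A M\<bar>" by (intro tendsto_intros V)
      show "\<forall>\<^sub>F N in sequentially. \<bar>?A N - ?A M\<bar> \<le> e"
        using eventually_ge_at_top[of M] by eventually_elim (intro close M)
    qed simp
    then show ?thesis using M by (auto simp: abs_minus_commute)
  qed
  then show thesis by (rule that)
qed

lemma (in badic) badic_average_uniform_limit:
  assumes "\<And>N k. g N (k mod b ^ N) = g N k"
    and "\<And>e. 0 < e \<Longrightarrow> \<exists>M. \<forall>N\<ge>M. \<forall>k. \<bar>g N k - g M k\<bar> \<le> e"
  shows "\<exists>V. \<forall>t\<in>{0..1}. (\<lambda>N. badic_average b t N (g N)) \<longlonglongrightarrow> t * V"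
proof -
  obtain V where V: "\<And>e. 0 < e \<Longrightarrow>
      \<exists>M. \<bar>badic_mean b M (g M) - V\<bar> \<le> e \<and> (\<forall>N\<ge>M. \<forall>k. \<bar>g N k - g M k\<bar> \<le> e)"
    using badic_mean_uniform_limit[OF assms] by metis
  have "(\<lambda>N. badic_average b t N (g N)) \<longlonglongrightarrow> t * V" if t: "t \<in> {0..1}" for t
  proof (rule LIMSEQ_I)
    fix e :: real assume e: "0 < e"
    then obtain M where mean: "\<bar>badic_mean b M (g M) - V\<bar> \<le> e / 3"
      and M: "\<And>N k. M \<le> N \<Longrightarrow> \<bar>g N k - g M k\<bar> \<le> e / 3"
      using V[of "e / 3"] by auto
    have freeze: "\<bar>badic_average b t N (g N) - badic_average b t N (g M)\<bar> \<le> e / 3" if "M \<le> N" for N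
      unfolding badic_average_diff[symmetric] using t e M[OF that]
      by (intro order_trans[OF abs_badic_average_le] badic_average_le_const) auto
    have "\<bar>t * badic_mean b M (g M) - t * V\<bar> \<le> 1 * (e / 3)"
      unfolding right_diff_distrib[symmetric] abs_mult using t mean by (intro mult_mono) auto
    then have mean_close: "\<bar>t * badic_mean b M (g M) - t * V\<bar> \<le> e / 3" by simp
    have "\<forall>\<^sub>F N in sequentially. \<bar>badic_average b t N (g M) - t * badic_mean b M (g M)\<bar> < e / 3"
      using tendstoD[OF badic_average_periodic_tendsto[of "g M" M t], of "e / 3"] assms(1) t e
      by (simp add: dist_real_def)
    then have "\<forall>\<^sub>F N in sequentially. \<bar>badic_average b t N (g N) - t * V\<bar> < e"
      using eventually_ge_at_top[of M]
    proof eventually_elim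
      case (elim N)
      then show ?case using freeze[of N] mean_close by linarith
    qed
    then show "\<exists>N0. \<forall>N\<ge>N0. norm (badic_average b t N (g N) - t * V) < e"
      by (simp add: eventually_sequentially)
  qed
  then show ?thesis by blast
qed

lemma mono_LIMSEQ_of_rational_LIMSEQ:
  fixes S :: "nat \<Rightarrow> real \<Rightarrow> real"
  assumes mono: "\<And>n s t. s \<le> t \<Longrightarrow> S n s \<le> S n t"
    and rational: "\<And>q. q \<in> \<rat> \<inter> {0..1} \<Longrightarrow> (\<lambda>n. S n q) \<longlonglongrightarrow> g q"
    and g: "continuous_on {0..1} g" and t: "t \<in> {0..1}"
  shows "(\<lambda>n. S n t) \<longlonglongrightarrow> g t"
proof -
  consider "t \<in> \<rat>" | "0 < t" "t < 1" using t by force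
  then show ?thesis
  proof cases
    case 1
    then show ?thesis using t by (intro rational) auto
  next
    case 2
    show ?thesis
    proof (rule LIMSEQ_I)
      fix e :: real assume e: "0 < e"
      then obtain d where d: "0 < d" "\<And>s. s \<in> {0..1} \<Longrightarrow> dist s t < d \<Longrightarrow> dist (g s) (g t) < e"
        using g t unfolding continuous_on_iff by metis
      obtain x where x: "x \<in> \<rat>" "max 0 (t - d) < x" "x < t"
        using Rats_dense_in_real[of "max 0 (t - d)" t] 2 d by auto
      obtain y where y: "y \<in> \<rat>" "t < y" "y < min 1 (t + d)"
        using Rats_dense_in_real[of t "min 1 (t + d)"] 2 d by auto
      have "g t - e < g x" "g y < g t + e"
        using d(2)[of x] d(2)[of y] x y 2 by (auto simp: dist_real_def)
      then have "\<forall>\<^sub>F n in sequentially. g t - e < S n x" "\<forall>\<^sub>F n in sequentially. S n y < g t + e"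
        using x y 2 by (auto intro!: order_tendstoD[OF rational])
      then have "\<forall>\<^sub>F n in sequentially. \<bar>S n t - g t\<bar> < e"
      proof eventually_elim
        case (elim n)
        then show ?case using mono[of x t n] mono[of t y n] x y by linarith
      qed
      then show "\<exists>N. \<forall>n\<ge>N. norm (S n t - g t) < e" by (simp add: eventually_sequentially)
    qed
  qed
qed

section \<open>Centred Gaussian random variables\<close>

lemma exp_abs_le_cosh: "exp \<bar>x\<bar> \<le> 2 * cosh (x::real)"
  by (cases "0 \<le> x") (auto simp: cosh_def)

lemma abs_powr_le_cosh:
  fixes x p :: real
  assumes p: "0 < p"
  shows "\<bar>x\<bar> powr p \<le> 2 * p powr p * cosh x"
proof -
  have "\<bar>x\<bar> / p \<le> exp (\<bar>x\<bar> / p)"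
    using exp_ge_add_one_self[of "\<bar>x\<bar> / p"] by linarith
  then have "(p * (\<bar>x\<bar> / p)) powr p \<le> (p * exp (\<bar>x\<bar> / p)) powr p"
    using p by (intro powr_mono2 mult_left_mono) auto
  also have "\<dots> = p powr p * exp \<bar>x\<bar>"
    using p by (simp add: powr_mult powr_def[of "exp _"])
  also have "\<dots> \<le> p powr p * (2 * cosh x)"
    by (intro mult_left_mono exp_abs_le_cosh) auto
  finally show ?thesis using p by simp
qed

lemma cosh_le_exp_abs_diff: "cosh (y::real) \<le> exp \<bar>y - x\<bar> * cosh x"
proof -
  have "exp y \<le> exp \<bar>y - x\<bar> * exp x" "exp (- y) \<le> exp \<bar>y - x\<bar> * exp (- x)"
    by (simp_all flip: exp_add)
  then have "(exp y + exp (- y)) / 2 \<le> exp \<bar>y - x\<bar> * ((exp x + exp (- x)) / 2)"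
    by (simp add: distrib_left)
  then show ?thesis by (simp add: cosh_def)
qed

lemma abs_cos_diff_le: "\<bar>cos x - cos y\<bar> \<le> \<bar>x - y\<bar>" for x y :: real
proof -
  have "\<bar>cos x - cos y\<bar> = 2 * \<bar>sin ((x + y) / 2)\<bar> * \<bar>sin ((y - x) / 2)\<bar>"
    by (simp add: cos_diff_cos abs_mult)
  also have "\<dots> \<le> 2 * 1 * \<bar>(y - x) / 2\<bar>"
    by (intro mult_mono abs_sin_x_le_abs_x) auto
  finally show ?thesis by simp
qed

lemma abs_exp_diff_le:
  fixes x y c :: real
  assumes "x \<le> c" "y \<le> c"
  shows "\<bar>exp x - exp y\<bar> \<le> exp c * \<bar>x - y\<bar>"
  using assms
proof (induction x y rule: linorder_wlog)
  case (le x y)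
  have "1 - exp (x - y) \<le> y - x"
    using exp_ge_add_one_self[of "x - y"] by linarith
  then have "exp y * (1 - exp (x - y)) \<le> exp c * (y - x)"
    using le by (intro mult_mono) auto
  moreover have "exp y * (1 - exp (x - y)) = exp y - exp x"
    by (simp add: algebra_simps flip: exp_add)
  ultimately have "exp y - exp x \<le> exp c * (y - x)" by simp
  then show ?case using le by simp
next
  case (sym x y)
  then show ?case by (simp add: abs_minus_commute)
qed

definition std_normal_abs_moment :: "real \<Rightarrow> real" where
  "std_normal_abs_moment p = 2 powr (p / 2) * Gamma ((p + 1) / 2) / sqrt pi"

lemma Gamma_has_integral_half_square:
  fixes s :: real
  assumes s: "0 < s"
  shows "has_bochner_integral lborel
    (\<lambda>x. indicator {0<..} x *\<^sub>R (\<bar>x\<bar> * ((x\<^sup>2 / 2) powr (s - 1) / exp (x\<^sup>2 / 2)))) (Gamma s)"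
proof -
  let ?f = "\<lambda>t::real. t powr (s - 1) / exp t"
  have image: "(\<lambda>x::real. x\<^sup>2 / 2) ` {0<..} = {0<..}"
  proof (intro equalityI subsetI)
    fix y :: real assume "y \<in> {0<..}"
    then show "y \<in> (\<lambda>x::real. x\<^sup>2 / 2) ` {0<..}"
      by (intro image_eqI[of _ _ "sqrt (2 * y)"]) auto
  qed auto
  have "(?f has_integral Gamma s) {0..}"
    using s by (intro Gamma_integral_real) auto
  then have "(?f has_integral Gamma s) {0<..}"
    by (subst has_integral_spike_set_eq[of _ "{0..}"]) (auto intro: negligible_subset[of "{0}"])
  then have "?f absolutely_integrable_on {0<..} \<and> integral {0<..} ?f = Gamma s"
    by (auto intro!: nonnegative_absolutely_integrable_1 simp: has_integral_iff)
  then have "(\<lambda>x. \<bar>x\<bar> * ?f (x\<^sup>2 / 2)) absolutely_integrable_on {0<..}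
      \<and> integral {0<..} (\<lambda>x. \<bar>x\<bar> * ?f (x\<^sup>2 / 2)) = Gamma s"
    by (subst has_absolute_integral_change_of_variables_1'[where g = "\<lambda>x. x\<^sup>2 / 2"])
       (auto simp: image inj_on_def power2_eq_iff intro!: derivative_eq_intros)
  then have "has_bochner_integral lebesgue
      (\<lambda>x. indicator {0<..} x *\<^sub>R (\<bar>x\<bar> * ?f (x\<^sup>2 / 2))) (Gamma s)"
    using set_lebesgue_integral_eq_integral(2)[of "{0<..}" "\<lambda>x. \<bar>x\<bar> * ?f (x\<^sup>2 / 2)"]
    unfolding has_bochner_integral_iff set_integrable_def set_lebesgue_integral_def by metis
  then show ?thesis
    by (simp add: has_bochner_integral_iff integrable_completion integral_completion)
qed

lemma abs_powr_mult_exp_has_half_line_integral: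
  fixes p :: real
  assumes p: "0 < p"
  shows "has_bochner_integral lborel (\<lambda>x. indicator {0..} x *\<^sub>R (\<bar>x\<bar> powr p * exp (- x\<^sup>2 / 2)))
           (2 powr ((p - 1) / 2) * Gamma ((p + 1) / 2))"
proof -
  have exponent: "(p + 1) / 2 - 1 = (p - 1) / 2" by (simp add: field_simps)
  have "2 powr ((p - 1) / 2)
      * (indicator {0<..} x *\<^sub>R (\<bar>x\<bar> * ((x\<^sup>2 / 2) powr ((p - 1) / 2) / exp (x\<^sup>2 / 2))))
      = indicator {0..} x *\<^sub>R (\<bar>x\<bar> powr p * exp (- x\<^sup>2 / 2))" for x :: real
  proof (cases "0 < x")
    case True
    have "(x\<^sup>2) powr ((p - 1) / 2) = (x powr 2) powr ((p - 1) / 2)" using True by simp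
    also have "\<dots> = x powr (p - 1)" unfolding powr_powr by (rule arg_cong) (simp add: field_simps)
    finally show ?thesis
      using True by (simp add: powr_divide powr_diff exp_minus field_simps)
  next
    case False
    then show ?thesis by (cases "x = 0") (auto simp: indicator_def)
  qed
  then show ?thesis
    using p has_bochner_integral_mult_right[of "2 powr ((p - 1) / 2)",
      OF Gamma_has_integral_half_square[of "(p + 1) / 2"]]
    by (simp add: exponent)
qed

lemma std_normal_has_abs_moment:
  assumes p: "0 < p"
  shows "has_bochner_integral lborel
      (\<lambda>x. std_normal_density x * \<bar>x\<bar> powr p) (std_normal_abs_moment p)"
proof -
  have "has_bochner_integral lborel (\<lambda>x::real. \<bar>x\<bar> powr p * exp (- x\<^sup>2 / 2))
      (2 *\<^sub>R (2 powr ((p - 1) / 2) * Gamma ((p + 1) / 2)))"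
    by (rule has_bochner_integral_even_function[OF abs_powr_mult_exp_has_half_line_integral[OF p]]) simp
  then have "has_bochner_integral lborel
      (\<lambda>x::real. 1 / sqrt (2 * pi) * (\<bar>x\<bar> powr p * exp (- x\<^sup>2 / 2)))
      (1 / sqrt (2 * pi) * (2 *\<^sub>R (2 powr ((p - 1) / 2) * Gamma ((p + 1) / 2))))"
    by (rule has_bochner_integral_mult_right)
  moreover have "1 / sqrt (2 * pi) * (2 *\<^sub>R (2 powr ((p - 1) / 2) * Gamma ((p + 1) / 2)))
      = std_normal_abs_moment p"
  proof -
    have "2 powr (p / 2) = 2 powr (1 / 2) * (2 powr ((p - 1) / 2) :: real)"
      by (simp flip: powr_add add: field_simps)
    then show ?thesis
      by (simp add: std_normal_abs_moment_def powr_half_sqrt real_sqrt_mult field_simps)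
  qed
  ultimately show ?thesis
    by (simp add: std_normal_density_def mult_ac)
qed

lemma std_normal_density_le_1: "std_normal_density x \<le> 1"
proof -
  have "1 \<le> sqrt (2 * pi)" using pi_gt3 by simp
  then show ?thesis
    unfolding std_normal_density_def by (intro mult_le_one) (auto simp: field_simps)
qed

lemma std_normal_has_cosh_moment:
  "has_bochner_integral lborel (\<lambda>x. std_normal_density x * cosh (s * x)) (exp (s\<^sup>2 / 2))"
proof -
  have "std_normal_density x * exp (s * x) = exp (s\<^sup>2 / 2) * normal_density s 1 x" for x s :: real
    unfolding normal_density_def
    by (simp add: field_simps power2_eq_square flip: exp_add)
  moreover have "has_bochner_integral lborel
      (\<lambda>x. exp (s\<^sup>2 / 2) * normal_density s 1 x) (exp (s\<^sup>2 / 2) * 1)" for s :: real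
    by (intro has_bochner_integral_mult_right) (simp add: has_bochner_integral_iff)
  ultimately have exp: "has_bochner_integral lborel
      (\<lambda>x. std_normal_density x * exp (s * x)) (exp (s\<^sup>2 / 2))" for s :: real
    by simp
  have "has_bochner_integral lborel
     (\<lambda>x. (std_normal_density x * exp (s * x) + std_normal_density x * exp ((- s) * x)) / 2)
     ((exp (s\<^sup>2 / 2) + exp ((- s)\<^sup>2 / 2)) / 2)"
    by (intro has_bochner_integral_divide_zero has_bochner_integral_add exp)
  then show ?thesis
    by (simp add: cosh_def add_divide_distrib algebra_simps)
qed

definition centred_normal :: "real \<Rightarrow> real measure" where
  "centred_normal v = distr std_normal_distribution borel (\<lambda>x. sqrt v * x)"

lemma real_distribution_centred_normal: "real_distribution (centred_normal v)"
proof -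
  interpret real_distribution std_normal_distribution by (rule real_dist_normal_dist)
  show ?thesis unfolding centred_normal_def by (rule real_distribution_distr) simp
qed

lemma char_centred_normal:
  assumes "0 \<le> v"
  shows "char (centred_normal v) u = complex_of_real (exp (- (u\<^sup>2 * v) / 2))"
proof -
  have "char (centred_normal v) u = char std_normal_distribution (u * sqrt v)"
    unfolding char_def centred_normal_def by (subst integral_distr) (auto simp: mult.assoc)
  then show ?thesis
    using assms by (simp add: char_std_normal_distribution power_mult_distrib)
qed

lemma has_bochner_integral_centred_normal:
  fixes f :: "real \<Rightarrow> real"
  assumes f: "f \<in> borel_measurable borel"
    and integral: "has_bochner_integral lborel (\<lambda>x. std_normal_density x * f (sqrt v * x)) c"
  shows "has_bochner_integral (centred_normal v) f c"
proof -
  have "has_bochner_integral std_normal_distribution (\<lambda>x. f (sqrt v * x)) c"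
    using f integral by (subst has_bochner_integral_density) auto
  then show ?thesis
    unfolding centred_normal_def using f by (subst has_bochner_integral_distr) auto
qed

lemma borel_measurable_cosh [measurable]: "(cosh :: real \<Rightarrow> real) \<in> borel_measurable borel"
  unfolding cosh_def by measurable

lemma centred_normal_has_cosh_moment:
  assumes "0 \<le> v"
  shows "has_bochner_integral (centred_normal v) cosh (exp (v / 2))"
  using std_normal_has_cosh_moment[of "sqrt v"] assms
  by (intro has_bochner_integral_centred_normal) auto

lemma centred_normal_has_abs_moment:
  assumes p: "0 < p" and v: "0 \<le> v"
  shows "has_bochner_integral (centred_normal v) (\<lambda>x. \<bar>x\<bar> powr p)
      (v powr (p / 2) * std_normal_abs_moment p)"
proof (rule has_bochner_integral_centred_normal)
  have "sqrt v powr p = v powr (p / 2)"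
    unfolding powr_half_sqrt[OF v, symmetric] powr_powr by simp
  then have "\<bar>sqrt v * x\<bar> powr p = v powr (p / 2) * \<bar>x\<bar> powr p" for x
    using v by (simp add: abs_mult powr_mult)
  then show "has_bochner_integral lborel (\<lambda>x. std_normal_density x * \<bar>sqrt v * x\<bar> powr p)
      (v powr (p / 2) * std_normal_abs_moment p)"
    using has_bochner_integral_mult_right[OF std_normal_has_abs_moment[OF p], of "v powr (p / 2)"]
    by (simp add: mult_ac)
qed simp

(* Characteristic functions, rather than densities, so that the degenerate case v = 0 is included. *)
definition centred_gaussian :: "'a measure \<Rightarrow> ('a \<Rightarrow> real) \<Rightarrow> real \<Rightarrow> bool" where
  "centred_gaussian M X v \<longleftrightarrow> X \<in> borel_measurable M \<and>
     (\<forall>u. (\<integral>\<omega>. cis (u * X \<omega>) \<partial>M) = complex_of_real (exp (- (u\<^sup>2 * v) / 2)))"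

lemma centred_gaussianD:
  assumes "centred_gaussian M X v"
  shows "X \<in> borel_measurable M"
    and "(\<integral>\<omega>. cis (u * X \<omega>) \<partial>M) = complex_of_real (exp (- (u\<^sup>2 * v) / 2))"
  using assms by (auto simp: centred_gaussian_def)

context prob_space
begin

lemma centred_gaussian_variance_nonneg:
  assumes "centred_gaussian M X v"
  shows "0 \<le> v"
proof -
  have "exp (- v / 2) = norm (\<integral>\<omega>. cis (1 * X \<omega>) \<partial>M)"
    unfolding centred_gaussianD(2)[OF assms] norm_of_real by simp
  also have "\<dots> \<le> (\<integral>\<omega>. norm (cis (1 * X \<omega>)) \<partial>M)" by (rule integral_norm_bound)
  also have "\<dots> = 1" by (simp add: prob_space)
  finally show ?thesis by simp
qed

lemma centred_gaussian_distr:
  assumes X: "centred_gaussian M X v"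
  shows "distr M borel X = centred_normal v"
proof (rule Levy_uniqueness[OF _ real_distribution_centred_normal])
  note [measurable] = centred_gaussianD(1)[OF X]
  show "real_distribution (distr M borel X)"
    by (rule real_distribution_distr) simp
  have "char (distr M borel X) u = (\<integral>\<omega>. cis (u * X \<omega>) \<partial>M)" for u
    unfolding char_def by (subst integral_distr) (auto simp: cis_conv_exp)
  then show "char (distr M borel X) = char (centred_normal v)"
    by (simp add: fun_eq_iff centred_gaussianD(2)[OF X]
      char_centred_normal centred_gaussian_variance_nonneg[OF X])
qed

lemma centred_gaussian_has_cos_moment:
  assumes X: "centred_gaussian M X v"
  shows "has_bochner_integral M (\<lambda>\<omega>. cos (u * X \<omega>)) (exp (- (u\<^sup>2 * v) / 2))"
proof -
  note [measurable] = centred_gaussianD(1)[OF X]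
  have "integrable M (\<lambda>\<omega>. cis (u * X \<omega>))"
    by (rule integrable_const_bound[where B = 1]) (auto simp: cis_conv_exp)
  then have "has_bochner_integral M (\<lambda>\<omega>. Re (cis (u * X \<omega>))) (Re (\<integral>\<omega>. cis (u * X \<omega>) \<partial>M))"
    by (intro has_bochner_integral_Re has_bochner_integral_integrable)
  then show ?thesis
    unfolding centred_gaussianD(2)[OF X] by simp
qed

lemma centred_gaussian_has_cosh_moment:
  assumes X: "centred_gaussian M X v"
  shows "has_bochner_integral M (\<lambda>\<omega>. cosh (X \<omega>)) (exp (v / 2))"
proof -
  note [measurable] = centred_gaussianD(1)[OF X]
  show ?thesis
    using centred_normal_has_cosh_moment[OF centred_gaussian_variance_nonneg[OF X]]
    unfolding centred_gaussian_distr[OF X, symmetric]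
    by (simp add: has_bochner_integral_iff integrable_distr_eq integral_distr)
qed

lemma centred_gaussian_small_ball:
  assumes X: "centred_gaussian M X v" and v: "0 < v" and e: "0 \<le> e"
  shows "prob {\<omega>\<in>space M. \<bar>X \<omega>\<bar> \<le> e} \<le> 2 * e / sqrt v"
proof -
  note [measurable] = centred_gaussianD(1)[OF X]
  let ?I = "{- e / sqrt v..e / sqrt v}"
  have "emeasure M {\<omega>\<in>space M. \<bar>X \<omega>\<bar> \<le> e} = emeasure (distr M borel X) {-e..e}"
    by (subst emeasure_distr) (auto intro!: arg_cong[where f = "emeasure M"])
  also have "\<dots> = emeasure std_normal_distribution ((\<lambda>x. sqrt v * x) -` {-e..e})"
    unfolding centred_gaussian_distr[OF X] centred_normal_def by (subst emeasure_distr) auto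
  also have "(\<lambda>x. sqrt v * x) -` {-e..e} = ?I"
    using v by (auto simp: field_simps)
  also have "emeasure std_normal_distribution ?I
      = (\<integral>\<^sup>+x. ennreal (std_normal_density x) * indicator ?I x \<partial>lborel)"
    by (subst emeasure_density) auto
  also have "\<dots> \<le> (\<integral>\<^sup>+x. indicator ?I x \<partial>lborel)"
    by (intro nn_integral_mono) (auto simp: indicator_def std_normal_density_le_1)
  also have "\<dots> = ennreal (2 * e / sqrt v)"
    using v e by (simp add: divide_right_mono)
  finally show ?thesis
    using v e by (simp add: emeasure_eq_measure)
qed

end

lemma AE_tendsto_zero_of_summable_integrals:
  fixes f :: "nat \<Rightarrow> 'a \<Rightarrow> real"
  assumes integrable: "\<And>n. integrable M (f n)" and nonneg: "\<And>n \<omega>. 0 \<le> f n \<omega>"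
    and summable: "summable (\<lambda>n. integral\<^sup>L M (f n))"
  shows "AE \<omega> in M. (\<lambda>n. f n \<omega>) \<longlonglongrightarrow> 0"
proof -
  note [measurable] = borel_measurable_integrable[OF integrable]
  have "(\<integral>\<^sup>+\<omega>. (\<Sum>n. ennreal (f n \<omega>)) \<partial>M) = (\<Sum>n. ennreal (integral\<^sup>L M (f n)))"
    using integrable nonneg by (simp add: nn_integral_suminf nn_integral_eq_integral)
  also have "\<dots> = ennreal (\<Sum>n. integral\<^sup>L M (f n))"
    using summable nonneg by (intro suminf_ennreal_eq) (auto simp: summable_sums)
  also have "\<dots> < \<infinity>" by simp
  finally have "AE \<omega> in M. (\<Sum>n. ennreal (f n \<omega>)) \<noteq> \<infinity>"
    by (intro nn_integral_noteq_infinite) auto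
  then show ?thesis
  proof eventually_elim
    case (elim \<omega>)
    then have "summable (\<lambda>n. f n \<omega>)"
      using nonneg by (intro summable_suminf_not_top) auto
    then show ?case by (rule summable_LIMSEQ_zero)
  qed
qed

lemma (in prob_space) prob_LIMSEQ_zero_le:
  fixes X :: "nat \<Rightarrow> 'a \<Rightarrow> real"
  assumes X [measurable]: "\<And>n. X n \<in> borel_measurable M" and S [measurable]: "S \<in> sets M"
    and limit: "\<And>\<omega>. \<omega> \<in> S \<Longrightarrow> (\<lambda>n. X n \<omega>) \<longlonglongrightarrow> 0"
    and e: "0 < e" and small_ball: "\<And>n. prob {\<omega>\<in>space M. \<bar>X n \<omega>\<bar> \<le> e} \<le> c"
  shows "prob S \<le> c"
proof -
  let ?\<phi> = "\<lambda>x. max 0 (1 - \<bar>x\<bar> / e) :: real"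
  have "(\<lambda>n. \<integral>\<omega>. indicator S \<omega> * ?\<phi> (X n \<omega>) \<partial>M) \<longlonglongrightarrow> (\<integral>\<omega>. indicator S \<omega> \<partial>M)"
  proof (rule integral_dominated_convergence[where w = "\<lambda>_. 1"])
    have "(\<lambda>n. indicator S \<omega> * ?\<phi> (X n \<omega>)) \<longlonglongrightarrow> indicator S \<omega> * ?\<phi> 0" if "\<omega> \<in> S" for \<omega>
      using limit[OF that] e by (intro tendsto_intros) auto
    then have "(\<lambda>n. indicator S \<omega> * ?\<phi> (X n \<omega>)) \<longlonglongrightarrow> indicator S \<omega>" for \<omega>
      by (cases "\<omega> \<in> S") auto
    then show "AE \<omega> in M. (\<lambda>n. indicator S \<omega> * ?\<phi> (X n \<omega>)) \<longlonglongrightarrow> indicator S \<omega>" by simp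
  qed (use e in \<open>auto simp: indicator_def\<close>)
  moreover have "(\<integral>\<omega>. indicator S \<omega> * ?\<phi> (X n \<omega>) \<partial>M) \<le> c" for n
  proof -
    have "(\<integral>\<omega>. indicator S \<omega> * ?\<phi> (X n \<omega>) \<partial>M) \<le> (\<integral>\<omega>. indicator {\<omega>\<in>space M. \<bar>X n \<omega>\<bar> \<le> e} \<omega> \<partial>M)"
    proof (rule integral_mono)
      show "integrable M (\<lambda>\<omega>. indicator S \<omega> * ?\<phi> (X n \<omega>))"
        using e by (intro integrable_const_bound[where B = 1]) (auto simp: indicator_def)
      show "integrable M (\<lambda>\<omega>. indicator {\<omega>\<in>space M. \<bar>X n \<omega>\<bar> \<le> e} \<omega> :: real)"
        by (intro integrable_real_indicator) (auto simp: less_top[symmetric])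
    qed (use e in \<open>auto simp: indicator_def\<close>)
    then show ?thesis using small_ball[of n] by simp
  qed
  ultimately have "(\<integral>\<omega>. indicator S \<omega> \<partial>M) \<le> c"
    by (intro LIMSEQ_le_const2) auto
  then show ?thesis by simp
qed

lemma (in prob_space) AE_not_tendsto_zero:
  fixes X :: "nat \<Rightarrow> 'a \<Rightarrow> real"
  assumes X [measurable]: "\<And>n. X n \<in> borel_measurable M"
    and small_ball: "\<And>n e. 0 < e \<Longrightarrow> prob {\<omega>\<in>space M. \<bar>X n \<omega>\<bar> \<le> e} \<le> K * e"
  shows "AE \<omega> in M. \<not> (\<lambda>n. X n \<omega>) \<longlonglongrightarrow> 0"
proof -
  define S where "S = {\<omega>\<in>space M. Cauchy (\<lambda>n. X n \<omega>) \<and> lim (\<lambda>n. X n \<omega>) = 0}"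
  have S_iff: "\<omega> \<in> S \<longleftrightarrow> \<omega> \<in> space M \<and> (\<lambda>n. X n \<omega>) \<longlonglongrightarrow> 0" for \<omega>
    by (auto simp: S_def limI LIMSEQ_imp_Cauchy
      convergent_LIMSEQ_iff Cauchy_convergent_iff convergentI)
  have [measurable]: "S \<in> sets M"
    unfolding S_def by measurable
  have "prob S \<le> K * e" if "0 < e" for e
    using S_iff by (intro prob_LIMSEQ_zero_le[OF X _ _ that small_ball[OF that]]) auto
  then have "\<forall>\<^sub>F e in at_right 0. prob S \<le> K * e"
    by (auto simp: eventually_at_right_less intro: eventually_mono[OF eventually_at_right_less])
  moreover have "((\<lambda>e. K * e) \<longlongrightarrow> K * 0) (at_right 0)" by (intro tendsto_intros)
  ultimately have "prob S \<le> 0"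
    by (intro tendsto_lowerbound) auto
  then have "S \<in> null_sets M"
    by (auto simp: null_setsI emeasure_eq_measure measure_le_0_iff)
  then show ?thesis
    by (rule AE_I') (auto simp: S_iff)
qed

section \<open>Convergence of absolute moments\<close>

lemma diff_min_le_square_divide:
  fixes y A :: real
  assumes "0 < A" "0 \<le> y"
  shows "0 \<le> y - min y A" "y - min y A \<le> y\<^sup>2 / A"
proof -
  have "(y - A) * A \<le> y\<^sup>2" if "A \<le> y"
    using assms that unfolding power2_eq_square by (intro mult_mono) auto
  then show "0 \<le> y - min y A" "y - min y A \<le> y\<^sup>2 / A"
    using assms by (auto simp: min_def le_divide_eq)
qed

lemma integral_diff_integral_min_le:
  fixes f :: "'a \<Rightarrow> real"
  assumes "finite_measure M" and f: "f \<in> borel_measurable M" "\<And>x. 0 \<le> f x"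
    and square: "integrable M (\<lambda>x. (f x)\<^sup>2)" and A: "0 < A"
  shows "\<bar>(\<integral>x. f x \<partial>M) - (\<integral>x. min (f x) A \<partial>M)\<bar> \<le> (\<integral>x. (f x)\<^sup>2 \<partial>M) / A"
proof -
  interpret finite_measure M by fact
  have f_integrable: "integrable M f" by (rule square_integrable_imp_integrable[OF f(1) square])
  have min_integrable: "integrable M (\<lambda>x. min (f x) A)"
    using f A by (intro integrable_const_bound[where B = A]) (auto simp: abs_of_nonneg)
  have diff: "(\<integral>x. f x \<partial>M) - (\<integral>x. min (f x) A \<partial>M) = (\<integral>x. f x - min (f x) A \<partial>M)"
    by (rule Bochner_Integration.integral_diff[OF f_integrable min_integrable, symmetric])
  have "(\<integral>x. f x - min (f x) A \<partial>M) \<le> (\<integral>x. (f x)\<^sup>2 / A \<partial>M)"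
    using f_integrable min_integrable square diff_min_le_square_divide[OF A f(2)]
    by (intro integral_mono) auto
  moreover have "0 \<le> (\<integral>x. f x - min (f x) A \<partial>M)"
    using diff_min_le_square_divide[OF A f(2)] by (intro integral_nonneg_AE) auto
  ultimately show ?thesis unfolding diff by simp
qed

lemma integral_min_of_nat_tendsto:
  fixes f :: "'a \<Rightarrow> real"
  assumes f: "integrable M f" "\<And>x. 0 \<le> f x"
  shows "(\<lambda>A. \<integral>x. min (f x) (real (Suc A)) \<partial>M) \<longlonglongrightarrow> (\<integral>x. f x \<partial>M)"
proof (rule integral_dominated_convergence[where w = f])
  have "(\<lambda>A. min (f x) (real (Suc A))) \<longlonglongrightarrow> f x" for x
  proof (rule tendsto_eventually)
    show "\<forall>\<^sub>F A in sequentially. min (f x) (real (Suc A)) = f x"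
      using eventually_ge_at_top[of "nat \<lceil>f x\<rceil>"] by eventually_elim linarith
  qed
  then show "AE x in M. (\<lambda>A. min (f x) (real (Suc A))) \<longlonglongrightarrow> f x" by simp
qed (use f in auto)

lemma weak_conv_imp_integral_conv_of_bounded_squares:
  fixes f :: "real \<Rightarrow> real"
  assumes \<mu>: "\<And>n. real_distribution (\<mu> n)" and \<nu>: "real_distribution \<nu>" and weak: "weak_conv_m \<mu> \<nu>"
    and f: "continuous_on UNIV f" "\<And>x. 0 \<le> f x"
    and squares: "\<And>n. integrable (\<mu> n) (\<lambda>x. (f x)\<^sup>2)" "\<And>n. (\<integral>x. (f x)\<^sup>2 \<partial>\<mu> n) \<le> K"
    and limit: "integrable \<nu> f"
  shows "(\<lambda>n. \<integral>x. f x \<partial>\<mu> n) \<longlonglongrightarrow> (\<integral>x. f x \<partial>\<nu>)"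
proof (rule swap_uniform_limit')
  let ?T = "\<lambda>A::nat. \<lambda>x. min (f x) (real (Suc A))"
  show "(\<lambda>A. \<integral>x. ?T A x \<partial>\<nu>) \<longlonglongrightarrow> (\<integral>x. f x \<partial>\<nu>)"
    by (rule integral_min_of_nat_tendsto[OF limit f(2)])
  show "\<forall>\<^sub>F A in sequentially. (\<lambda>n. \<integral>x. ?T A x \<partial>\<mu> n) \<longlonglongrightarrow> (\<integral>x. ?T A x \<partial>\<nu>)"
  proof (intro always_eventually allI weak_conv_imp_integral_bdd_continuous_conv[OF \<mu> \<nu> weak])
    show "isCont (?T A) x" for A x
      using f(1) by (intro continuous_intros) (simp add: continuous_on_eq_continuous_at)
    show "norm (?T A x) \<le> real (Suc A)" for A x using f(2)[of x] by simp
  qed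
  have truncation_error: "dist (\<integral>x. ?T A x \<partial>\<mu> n) (\<integral>x. f x \<partial>\<mu> n) \<le> K / real (Suc A)" for n A
  proof -
    interpret real_distribution "\<mu> n" by (rule \<mu>)
    have "f \<in> borel_measurable (\<mu> n)"
      using borel_measurable_continuous_onI[OF f(1)] by simp
    then have "\<bar>(\<integral>x. f x \<partial>\<mu> n) - (\<integral>x. ?T A x \<partial>\<mu> n)\<bar> \<le> (\<integral>x. (f x)\<^sup>2 \<partial>\<mu> n) / real (Suc A)"
      using squares(1)[of n] f(2)
      by (intro integral_diff_integral_min_le) (auto intro: finite_measure_axioms)
    also have "\<dots> \<le> K / real (Suc A)" using squares(2) by (intro divide_right_mono) auto
    finally show ?thesis by (simp add: dist_real_def abs_minus_commute)
  qed
  show "uniform_limit UNIV (\<lambda>A n. \<integral>x. ?T A x \<partial>\<mu> n) (\<lambda>n. \<integral>x. f x \<partial>\<mu> n) sequentially"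
  proof (rule uniform_limitI)
    fix e :: real assume "0 < e"
    have "(\<lambda>A. K / real (Suc A)) \<longlonglongrightarrow> 0"
      using LIMSEQ_Suc[OF lim_const_over_n[of K]] .
    then have "\<forall>\<^sub>F A in sequentially. K / real (Suc A) < e"
      using \<open>0 < e\<close> by (intro order_tendstoD) auto
    then show "\<forall>\<^sub>F A in sequentially. \<forall>n\<in>UNIV. dist (\<integral>x. ?T A x \<partial>\<mu> n) (\<integral>x. f x \<partial>\<mu> n) < e"
      by eventually_elim (blast intro: le_less_trans[OF truncation_error])
  qed
qed auto

(* Symmetrising makes the characteristic function real, so that averages of cosines control it. *)
definition symmetrised_empirical :: "nat \<Rightarrow> (nat \<Rightarrow> real) \<Rightarrow> real measure" where
  "symmetrised_empirical L x
      = distr (uniform_count_measure ({..<L} \<times> {1, - 1})) borel (\<lambda>(k, s). s * x k)"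

lemma measurable_uniform_count_measure [measurable, simp]:
  "f \<in> borel_measurable (uniform_count_measure A)"
  by (auto simp: measurable_def uniform_count_measure_def space_point_measure sets_point_measure)

lemma real_distribution_symmetrised_empirical:
  assumes "0 < L"
  shows "real_distribution (symmetrised_empirical L x)"
proof -
  interpret prob_space "uniform_count_measure ({..<L} \<times> {1, - 1 :: real})"
    using assms by (intro prob_space_uniform_count_measure) auto
  show ?thesis
    unfolding symmetrised_empirical_def by (rule real_distribution_distr) simp
qed

lemma integral_symmetrised_empirical:
  fixes f :: "real \<Rightarrow> 'b::{banach, second_countable_topology}"
  assumes "f \<in> borel_measurable borel"
  shows "integrable (symmetrised_empirical L x) f"
    and "(\<integral>y. f y \<partial>symmetrised_empirical L x) = (\<Sum>k<L. f (x k) + f (- x k)) /\<^sub>R real (2 * L)"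
proof -
  let ?A = "{..<L} \<times> {1, - 1 :: real}"
  show "integrable (symmetrised_empirical L x) f"
    unfolding symmetrised_empirical_def using assms
    by (subst integrable_distr_eq)
      (auto simp: uniform_count_measure_def integrable_point_measure_finite)
  have "(\<integral>y. f y \<partial>symmetrised_empirical L x)
      = (\<integral>z. f (snd z * x (fst z)) \<partial>uniform_count_measure ?A)"
    unfolding symmetrised_empirical_def using assms
    by (subst integral_distr) (auto simp: case_prod_unfold)
  also have "\<dots> = (\<Sum>z\<in>?A. f (snd z * x (fst z))) /\<^sub>R real (card ?A)"
    unfolding uniform_count_measure_def
    by (subst lebesgue_integral_point_measure_finite)
      (simp_all add: scaleR_sum_right inverse_eq_divide)
  also have "(\<Sum>z\<in>?A. f (snd z * x (fst z))) = (\<Sum>k<L. f (x k) + f (- x k))"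
    by (simp add: sum.cartesian_product')
  also have "card ?A = 2 * L" by (simp add: card_cartesian_product)
  finally show "(\<integral>y. f y \<partial>symmetrised_empirical L x)
      = (\<Sum>k<L. f (x k) + f (- x k)) /\<^sub>R real (2 * L)" .
qed

lemma integral_symmetrised_empirical_even:
  fixes f :: "real \<Rightarrow> real"
  assumes "f \<in> borel_measurable borel" and "\<And>y. f (- y) = f y"
  shows "(\<integral>y. f y \<partial>symmetrised_empirical L x) = (\<Sum>k<L. f (x k)) / real L"
proof -
  have "(\<Sum>k<L. f (x k) + f (- x k)) = 2 * (\<Sum>k<L. f (x k))"
    by (simp add: assms(2) sum_distrib_left)
  then show ?thesis
    unfolding integral_symmetrised_empirical(2)[OF assms(1)] by (simp add: inverse_eq_divide)
qed

lemma char_symmetrised_empirical: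
  "char (symmetrised_empirical L x) u = complex_of_real ((\<Sum>k<L. cos (u * x k)) / real L)"
proof -
  have [measurable]: "(\<lambda>y. cis (u * y)) \<in> borel_measurable borel"
    unfolding cis_conv_exp by measurable
  have "cis (u * y) + cis (u * - y) = complex_of_real (2 * cos (u * y))" for y
    by (simp add: complex_eq_iff)
  then have "(\<Sum>k<L. cis (u * x k) + cis (u * - x k)) = complex_of_real (2 * (\<Sum>k<L. cos (u * x k)))"
    by (simp add: sum_distrib_left)
  moreover have "complex_of_real (2 * S) /\<^sub>R real (2 * L) = complex_of_real (S / real L)" for S
    by (simp add: complex_eq_iff) (simp add: divide_inverse)
  ultimately show ?thesis
    unfolding char_def cis_conv_exp[symmetric]
    by (subst integral_symmetrised_empirical(2)) (measurable, simp only:)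
qed

lemma average_abs_powr_tendsto:
  fixes x :: "nat \<Rightarrow> nat \<Rightarrow> real" and L :: "nat \<Rightarrow> nat"
  assumes L: "\<And>n. 0 < L n" and p: "0 < p" and v: "0 \<le> v"
    and cos: "\<And>u. (\<lambda>n. (\<Sum>k<L n. cos (u * x n k)) / real (L n)) \<longlonglongrightarrow> exp (- (u\<^sup>2 * v) / 2)"
    and cosh: "\<And>n. (\<Sum>k<L n. cosh (x n k)) / real (L n) \<le> K"
  shows "(\<lambda>n. (\<Sum>k<L n. \<bar>x n k\<bar> powr p) / real (L n)) \<longlonglongrightarrow> v powr (p / 2) * std_normal_abs_moment p"
proof -
  let ?\<mu> = "\<lambda>n. symmetrised_empirical (L n) (x n)"
  have \<mu>: "real_distribution (?\<mu> n)" for n by (rule real_distribution_symmetrised_empirical[OF L])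
  note \<nu> = real_distribution_centred_normal[of v]
  have weak: "weak_conv_m ?\<mu> (centred_normal v)"
    by (rule levy_continuity[OF \<mu> \<nu>])
      (unfold char_symmetrised_empirical char_centred_normal[OF v], intro tendsto_of_real cos)
  let ?C = "2 * (2 * p) powr (2 * p)"
  have "(\<lambda>n. \<integral>y. \<bar>y\<bar> powr p \<partial>?\<mu> n) \<longlonglongrightarrow> (\<integral>y. \<bar>y\<bar> powr p \<partial>centred_normal v)"
  proof (rule weak_conv_imp_integral_conv_of_bounded_squares[OF \<mu> \<nu> weak, where K = "?C * K"])
    show "continuous_on UNIV (\<lambda>y::real. \<bar>y\<bar> powr p)"
      using p by (intro continuous_on_powr' continuous_intros) auto
    show "integrable (?\<mu> n) (\<lambda>y. (\<bar>y\<bar> powr p)\<^sup>2)" for n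
      by (rule integral_symmetrised_empirical) simp
    show "integrable (centred_normal v) (\<lambda>y. \<bar>y\<bar> powr p)"
      using centred_normal_has_abs_moment[OF p v] by (simp add: has_bochner_integral_iff)
    fix n
    have square: "(\<bar>y\<bar> powr p)\<^sup>2 \<le> ?C * cosh y" for y :: real
      using abs_powr_le_cosh[of "2 * p" y] p by (simp add: power2_eq_square flip: powr_add)
    have "(\<integral>y. (\<bar>y\<bar> powr p)\<^sup>2 \<partial>?\<mu> n) = (\<Sum>k<L n. (\<bar>x n k\<bar> powr p)\<^sup>2) / real (L n)"
      by (rule integral_symmetrised_empirical_even) auto
    also have "\<dots> \<le> (\<Sum>k<L n. ?C * cosh (x n k)) / real (L n)"
      by (intro divide_right_mono sum_mono square) auto
    also have "\<dots> \<le> ?C * K"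
      using mult_left_mono[OF cosh[of n], of ?C] by (simp flip: sum_distrib_left)
    finally show "(\<integral>y. (\<bar>y\<bar> powr p)\<^sup>2 \<partial>?\<mu> n) \<le> ?C * K" .
  qed simp
  moreover have "(\<integral>y. \<bar>y\<bar> powr p \<partial>?\<mu> n) = (\<Sum>k<L n. \<bar>x n k\<bar> powr p) / real (L n)" for n
    by (rule integral_symmetrised_empirical_even) auto
  ultimately show ?thesis
    using centred_normal_has_abs_moment[OF p v] by (simp add: has_bochner_integral_iff)
qed

lemma average_abs_powr_tendsto_eventually:
  fixes x :: "nat \<Rightarrow> nat \<Rightarrow> real" and L :: "nat \<Rightarrow> nat"
  assumes p: "0 < p" and v: "0 \<le> v"
    and cos: "\<And>u. (\<lambda>n. (\<Sum>k<L n. cos (u * x n k)) / real (L n)) \<longlonglongrightarrow> exp (- (u\<^sup>2 * v) / 2)"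
    and cosh: "\<forall>\<^sub>F n in sequentially. 0 < L n \<and> (\<Sum>k<L n. cosh (x n k)) / real (L n) \<le> K"
  shows "(\<lambda>n. (\<Sum>k<L n. \<bar>x n k\<bar> powr p) / real (L n)) \<longlonglongrightarrow> v powr (p / 2) * std_normal_abs_moment p"
proof -
  obtain N where "\<And>n. N \<le> n \<Longrightarrow> 0 < L n \<and> (\<Sum>k<L n. cosh (x n k)) / real (L n) \<le> K"
    using cosh unfolding eventually_sequentially by blast
  then have "0 < L (n + N)" "(\<Sum>k<L (n + N). cosh (x (n + N) k)) / real (L (n + N)) \<le> K" for n
    by simp_all
  from average_abs_powr_tendsto[OF this(1) p v LIMSEQ_ignore_initial_segment[OF cos] this(2)]
  show ?thesis by (rule LIMSEQ_offset)
qed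

lemma (in badic) badic_average_abs_powr_tendsto:
  assumes t: "0 < t" and p: "0 < p" and v: "0 \<le> v"
    and cos: "\<And>u. (\<lambda>N. badic_average b t N (\<lambda>k. cos (u * x N k))) \<longlonglongrightarrow> t * exp (- (u\<^sup>2 * v) / 2)"
    and cosh: "\<And>N. badic_average b t N (\<lambda>k. cosh (x N k)) \<le> K"
  shows "(\<lambda>N. badic_average b t N (\<lambda>k. \<bar>x N k\<bar> powr p))
      \<longlonglongrightarrow> t * (v powr (p / 2) * std_normal_abs_moment p)"
proof -
  let ?L = "badic_count b t" and ?ratio = "\<lambda>N. real (badic_count b t N) / real b ^ N"
  have ratio: "?ratio \<longlonglongrightarrow> t" using t by (intro badic_count_ratio_tendsto) simp
  have average: "(\<Sum>k<?L N. g k) / real (?L N) = badic_average b t N g / ?ratio N" for g N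
    by (simp add: badic_average_def)
  have "(\<lambda>N. (\<Sum>k<?L N. \<bar>x N k\<bar> powr p) / real (?L N)) \<longlonglongrightarrow> v powr (p / 2) * std_normal_abs_moment p"
  proof (rule average_abs_powr_tendsto_eventually[OF p v])
    show "(\<lambda>N. (\<Sum>k<?L N. cos (u * x N k)) / real (?L N)) \<longlonglongrightarrow> exp (- (u\<^sup>2 * v) / 2)" for u
      unfolding average using tendsto_divide[OF cos ratio, of u] t by simp
    have "0 \<le> K"
      using cosh[of 0] badic_average_nonneg[of "\<lambda>k. cosh (x 0 k)" b t 0]
      by (simp add: less_imp_le cosh_real_pos)
    moreover have "\<forall>\<^sub>F N in sequentially. t / 2 < ?ratio N"
      using ratio t by (intro order_tendstoD) auto
    ultimately show "\<forall>\<^sub>F N in sequentially.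
        0 < ?L N \<and> (\<Sum>k<?L N. cosh (x N k)) / real (?L N) \<le> K / (t / 2)"
    proof (elim eventually_mono)
      fix N assume N: "t / 2 < ?ratio N"
      then have "0 < ?ratio N" using t by linarith
      moreover have "badic_average b t N (\<lambda>k. cosh (x N k)) / ?ratio N \<le> K / (t / 2)"
        using t by (intro frac_le[OF \<open>0 \<le> K\<close> cosh _ less_imp_le[OF N]]) simp
      ultimately show "0 < ?L N \<and> (\<Sum>k<?L N. cosh (x N k)) / real (?L N) \<le> K / (t / 2)"
        unfolding average by (simp add: zero_less_divide_iff)
    qed
  qed
  moreover have "?ratio N * ((\<Sum>k<?L N. g k) / real (?L N)) = badic_average b t N g" for g N
    by (cases "?L N = 0") (simp_all add: badic_average_def)
  ultimately show ?thesis
    using tendsto_mult[OF ratio] by fastforce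
qed

lemma LIMSEQ_of_rational_LIMSEQ_Lipschitz:
  fixes f :: "nat \<Rightarrow> real \<Rightarrow> 'a::metric_space"
  assumes Lipschitz: "\<And>n u v. dist (f n u) (f n v) \<le> K * \<bar>u - v\<bar>"
    and g: "continuous_on UNIV g" and rational: "\<And>q. q \<in> \<rat> \<Longrightarrow> (\<lambda>n. f n q) \<longlonglongrightarrow> g q"
  shows "(\<lambda>n. f n u) \<longlonglongrightarrow> g u"
proof (rule tendstoI)
  fix e :: real assume e: "0 < e"
  have "((\<lambda>v. K * \<bar>u - v\<bar> + dist (g v) (g u)) \<longlongrightarrow> K * \<bar>u - u\<bar> + dist (g u) (g u)) (at u)"
    using g by (intro tendsto_intros) (simp add: continuous_on_def)
  then have "\<forall>\<^sub>F v in at u. K * \<bar>u - v\<bar> + dist (g v) (g u) < e / 2"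
    using e by (intro order_tendstoD) auto
  then obtain d where d: "0 < d" "\<And>v. v \<noteq> u \<Longrightarrow> dist v u < d \<Longrightarrow> K * \<bar>u - v\<bar> + dist (g v) (g u) < e / 2"
    by (auto simp: eventually_at)
  obtain v where v: "v \<in> \<rat>" "u < v" "v < u + d"
    using Rats_dense_in_real[of u "u + d"] d(1) by auto
  have "\<forall>\<^sub>F n in sequentially. dist (f n v) (g v) < e / 2"
    using e by (intro tendstoD rational v) auto
  then show "\<forall>\<^sub>F n in sequentially. dist (f n u) (g u) < e"
  proof eventually_elim
    case (elim n)
    have "dist (f n u) (g u) \<le> dist (f n u) (f n v) + (dist (f n v) (g v) + dist (g v) (g u))"
      by (intro order_trans[OF dist_triangle[of _ _ "f n v"]] add_left_mono dist_triangle)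
    then show ?case
      using Lipschitz[of n u v] elim d(2)[of v] v by (simp add: dist_real_def)
  qed
qed

lemma cosh_le_of_abs_diff_le:
  fixes x y E :: real
  assumes "\<bar>y - x\<bar> \<le> E"
  shows "cosh y \<le> exp E * cosh x"
proof -
  have "exp \<bar>y - x\<bar> * cosh x \<le> exp E * cosh x"
    using assms by (intro mult_right_mono) (auto simp: less_imp_le cosh_real_pos)
  then show ?thesis using cosh_le_exp_abs_diff[of y x] by linarith
qed

lemma (in badic) badic_average_cosh_perturbed:
  assumes t: "t \<le> 1" and cosh: "\<And>N. badic_mean b N (\<lambda>k. cosh (x N k)) \<le> K"
    and close: "\<epsilon> \<longlonglongrightarrow> 0" "\<And>N k. k < b ^ N \<Longrightarrow> \<bar>y N k - x N k\<bar> \<le> \<epsilon> N"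
  obtains K' where "\<And>N. badic_average b t N (\<lambda>k. cosh (y N k)) \<le> K'"
proof -
  have "Bseq \<epsilon>" using close(1) by (intro convergent_imp_Bseq convergentI)
  then obtain E where E: "\<And>N. \<bar>\<epsilon> N\<bar> \<le> E" unfolding Bseq_def real_norm_def by blast
  have "badic_average b t N (\<lambda>k. cosh (y N k)) \<le> exp E * K" for N
  proof -
    have "badic_average b t N (\<lambda>k. cosh (y N k)) \<le> badic_mean b N (\<lambda>k. cosh (y N k))"
      using t by (intro badic_average_mono_time) (auto simp: less_imp_le cosh_real_pos)
    also have "\<dots> \<le> badic_mean b N (\<lambda>k. exp E * cosh (x N k))"
    proof (intro badic_average_mono cosh_le_of_abs_diff_le)
      fix k assume "k < badic_count b 1 N"
      then show "\<bar>y N k - x N k\<bar> \<le> E" using close(2)[of k N] E[of N] by simp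
    qed
    also have "\<dots> \<le> exp E * K"
      unfolding badic_average_cmult by (intro mult_left_mono cosh) simp
    finally show ?thesis .
  qed
  then show thesis by (rule that)
qed

lemma (in badic) badic_average_cos_perturbed:
  assumes t: "t \<le> 1" and cos: "(\<lambda>N. badic_average b t N (\<lambda>k. cos (u * x N k))) \<longlonglongrightarrow> c"
    and close: "\<epsilon> \<longlonglongrightarrow> 0" "\<And>N k. k < b ^ N \<Longrightarrow> \<bar>y N k - x N k\<bar> \<le> \<epsilon> N"
  shows "(\<lambda>N. badic_average b t N (\<lambda>k. cos (u * y N k))) \<longlonglongrightarrow> c"
proof -
  have "\<bar>badic_average b t N (\<lambda>k. cos (u * y N k)) - badic_average b t N (\<lambda>k. cos (u * x N k))\<bar>
      \<le> \<bar>u\<bar> * \<epsilon> N" for N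
    unfolding badic_average_diff[symmetric]
  proof (intro order_trans[OF abs_badic_average_le] badic_average_le_const t)
    show "0 \<le> \<bar>u\<bar> * \<epsilon> N" using close(2)[of 0 N] by simp
    fix k assume "k < b ^ N"
    then have "\<bar>u\<bar> * \<bar>y N k - x N k\<bar> \<le> \<bar>u\<bar> * \<epsilon> N" by (intro mult_left_mono close(2)) auto
    then show "\<bar>cos (u * y N k) - cos (u * x N k)\<bar> \<le> \<bar>u\<bar> * \<epsilon> N"
      using abs_cos_diff_le[of "u * y N k" "u * x N k"]
      by (simp add: abs_mult flip: right_diff_distrib)
  qed
  then have "(\<lambda>N. badic_average b t N (\<lambda>k. cos (u * y N k))
      - badic_average b t N (\<lambda>k. cos (u * x N k))) \<longlonglongrightarrow> 0"
    by (intro Lim_null_comparison[OF _ tendsto_mult_right_zero[OF close(1), of "\<bar>u\<bar>"]]) simp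
  from tendsto_add[OF this cos] show ?thesis by simp
qed

lemma badic_average_cos_Lipschitz:
  assumes "badic_average b t N (\<lambda>k. cosh (y k)) \<le> K"
  shows "dist (badic_average b t N (\<lambda>k. cos (u * y k))) (badic_average b t N (\<lambda>k. cos (w * y k)))
    \<le> 2 * K * \<bar>u - w\<bar>"
proof -
  have "\<bar>cos (u * z) - cos (w * z)\<bar> \<le> (2 * \<bar>u - w\<bar>) * cosh z" for z
  proof -
    have "\<bar>cos (u * z) - cos (w * z)\<bar> \<le> \<bar>u - w\<bar> * \<bar>z\<bar>"
      using abs_cos_diff_le[of "u * z" "w * z"] by (simp add: abs_mult flip: left_diff_distrib)
    also have "\<dots> \<le> \<bar>u - w\<bar> * (2 * cosh z)"
      using abs_powr_le_cosh[of 1 z] by (intro mult_left_mono) auto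
    finally show ?thesis by simp
  qed
  then have "dist (badic_average b t N (\<lambda>k. cos (u * y k)))
      (badic_average b t N (\<lambda>k. cos (w * y k)))
      \<le> (2 * \<bar>u - w\<bar>) * badic_average b t N (\<lambda>k. cosh (y k))"
    unfolding dist_real_def badic_average_diff[symmetric] badic_average_cmult[symmetric]
    by (intro order_trans[OF abs_badic_average_le] badic_average_mono)
  also have "\<dots> \<le> (2 * \<bar>u - w\<bar>) * K" by (intro mult_left_mono assms) simp
  finally show ?thesis by (simp add: mult_ac)
qed

lemma (in badic) badic_average_abs_powr_tendsto_perturbed:
  assumes t: "0 < t" "t \<le> 1" and p: "0 < p" and v: "0 \<le> v"
    and cos: "\<And>u. u \<in> \<rat> \<Longrightarrow>
      (\<lambda>N. badic_average b t N (\<lambda>k. cos (u * x N k))) \<longlonglongrightarrow> t * exp (- (u\<^sup>2 * v) / 2)"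
    and cosh: "\<And>N. badic_mean b N (\<lambda>k. cosh (x N k)) \<le> K"
    and close: "\<epsilon> \<longlonglongrightarrow> 0" "\<And>N k. k < b ^ N \<Longrightarrow> \<bar>y N k - x N k\<bar> \<le> \<epsilon> N"
  shows "(\<lambda>N. badic_average b t N (\<lambda>k. \<bar>y N k\<bar> powr p))
      \<longlonglongrightarrow> t * (v powr (p / 2) * std_normal_abs_moment p)"
proof -
  obtain K' where K': "\<And>N. badic_average b t N (\<lambda>k. cosh (y N k)) \<le> K'"
    using badic_average_cosh_perturbed[where x = x and y = y, OF t(2) cosh close] by blast
  have "(\<lambda>N. badic_average b t N (\<lambda>k. cos (u * y N k))) \<longlonglongrightarrow> t * exp (- (u\<^sup>2 * v) / 2)" for u
  proof (rule LIMSEQ_of_rational_LIMSEQ_Lipschitz[where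
        f = "\<lambda>N u. badic_average b t N (\<lambda>k. cos (u * y N k))" and g = "\<lambda>u. t * exp (- (u\<^sup>2 * v) / 2)"])
    show "dist (badic_average b t N (\<lambda>k. cos (u * y N k)))
        (badic_average b t N (\<lambda>k. cos (w * y N k)))
        \<le> 2 * K' * \<bar>u - w\<bar>" for N u w
      by (rule badic_average_cos_Lipschitz[OF K'])
    show "continuous_on UNIV (\<lambda>u. t * exp (- (u\<^sup>2 * v) / 2))"
      by (intro continuous_intros) auto
    show "(\<lambda>N. badic_average b t N (\<lambda>k. cos (q * y N k))) \<longlonglongrightarrow> t * exp (- (q\<^sup>2 * v) / 2)"
      if "q \<in> \<rat>" for q
      by (rule badic_average_cos_perturbed[OF t(2) cos[OF that] close])
  qed
  then show ?thesis
    by (rule badic_average_abs_powr_tendsto[where x = y, OF t(1) p v _ K'])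
qed

section \<open>Gaussian families and triangular arrays\<close>

locale gaussian_family = prob_space M for M :: "'a measure" +
  fixes I :: "'i set" and \<xi> :: "'i \<Rightarrow> 'a \<Rightarrow> real" and \<Gamma> :: "'i \<Rightarrow> 'i \<Rightarrow> real"
  assumes covariance_sym: "\<And>i j. i \<in> I \<Longrightarrow> j \<in> I \<Longrightarrow> \<Gamma> i j = \<Gamma> j i"
    and gaussian_sum_lessThan: "\<And>(n::nat) h c. (\<And>k. k < n \<Longrightarrow> h k \<in> I) \<Longrightarrow>
      centred_gaussian M (\<lambda>\<omega>. \<Sum>k<n. c k * \<xi> (h k) \<omega>) (\<Sum>k<n. \<Sum>l<n. c k * c l * \<Gamma> (h k) (h l))"
begin

lemma gaussian_sum:
  assumes A: "finite A" and h: "\<And>x. x \<in> A \<Longrightarrow> h x \<in> I"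
  shows "centred_gaussian M (\<lambda>\<omega>. \<Sum>x\<in>A. c x * \<xi> (h x) \<omega>) (\<Sum>x\<in>A. \<Sum>y\<in>A. c x * c y * \<Gamma> (h x) (h y))"
proof -
  obtain e where e: "bij_betw e {..<card A} A"
    using ex_bij_betw_nat_finite[OF A] by (auto simp: atLeast0LessThan)
  have reindex: "(\<Sum>x\<in>A. f x) = (\<Sum>k<card A. f (e k))" for f :: "_ \<Rightarrow> real"
    using sum.reindex_bij_betw[OF e, of f] by simp
  have "h (e k) \<in> I" if "k < card A" for k
    using that e h by (auto simp: bij_betw_def)
  then show ?thesis
    unfolding reindex by (rule gaussian_sum_lessThan)
qed

lemma gaussian_component: "i \<in> I \<Longrightarrow> centred_gaussian M (\<xi> i) (\<Gamma> i i)"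
  using gaussian_sum[of "{()}" "\<lambda>_. i" "\<lambda>_. 1"] by simp

lemma variance_nonneg: "i \<in> I \<Longrightarrow> 0 \<le> \<Gamma> i i"
  by (rule centred_gaussian_variance_nonneg[OF gaussian_component])

lemma gaussian_add:
  assumes "i \<in> I" "j \<in> I"
  shows "centred_gaussian M (\<lambda>\<omega>. \<xi> i \<omega> + \<xi> j \<omega>) (\<Gamma> i i + 2 * \<Gamma> i j + \<Gamma> j j)"
    and "centred_gaussian M (\<lambda>\<omega>. \<xi> i \<omega> - \<xi> j \<omega>) (\<Gamma> i i - 2 * \<Gamma> i j + \<Gamma> j j)"
  using gaussian_sum[of UNIV "\<lambda>s. if s then i else j" "\<lambda>_. 1"]
    gaussian_sum[of UNIV "\<lambda>s. if s then i else j" "\<lambda>s. if s then 1 else - 1"]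
    assms covariance_sym[OF assms] by (simp_all add: UNIV_bool algebra_simps)

lemma abs_covariance_le:
  assumes "i \<in> I" "j \<in> I"
  shows "2 * \<bar>\<Gamma> i j\<bar> \<le> \<Gamma> i i + \<Gamma> j j"
  using gaussian_add[OF assms, THEN centred_gaussian_variance_nonneg] by linarith

lemma covariance_sum_square_le:
  assumes A: "finite A" "A \<subseteq> I" and j: "j \<in> I"
  shows "(\<Sum>i\<in>A. c i * \<Gamma> i j)\<^sup>2 \<le> (\<Sum>i\<in>A. \<Sum>k\<in>A. c i * c k * \<Gamma> i k) * \<Gamma> j j"
proof -
  let ?Q = "\<Sum>i\<in>A. \<Sum>k\<in>A. c i * c k * \<Gamma> i k" and ?L = "\<Sum>i\<in>A. c i * \<Gamma> i j"
  have quadratic: "0 \<le> ?Q + 2 * z * ?L + z\<^sup>2 * \<Gamma> j j" for z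
  proof -
    let ?h = "case_option j id" and ?c = "case_option z c"
    have option_sum: "(\<Sum>x\<in>insert None (Some ` A). f x) = f None + (\<Sum>i\<in>A. f (Some i))"
      for f :: "_ \<Rightarrow> real"
      using A by (simp add: sum.reindex)
    have sym: "\<Gamma> j i = \<Gamma> i j" if "i \<in> A" for i
      using covariance_sym[OF j, of i] that A by auto
    have "0 \<le> (\<Sum>x\<in>insert None (Some ` A). \<Sum>y\<in>insert None (Some ` A). ?c x * ?c y * \<Gamma> (?h x) (?h y))"
      by (rule centred_gaussian_variance_nonneg[OF gaussian_sum]) (use A j in auto)
    also have "\<dots> = z * z * \<Gamma> j j + (\<Sum>i\<in>A. z * c i * \<Gamma> j i) + (\<Sum>i\<in>A. c i * z * \<Gamma> i j) + ?Q"
      unfolding option_sum by (simp add: sum.distrib)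
    also have "(\<Sum>i\<in>A. z * c i * \<Gamma> j i) = z * ?L"
      by (simp add: sum_distrib_left mult.assoc sym cong: sum.cong)
    also have "(\<Sum>i\<in>A. c i * z * \<Gamma> i j) = z * ?L"
      by (simp add: sum_distrib_left mult_ac)
    finally show ?thesis by (simp add: power2_eq_square algebra_simps)
  qed
  show ?thesis
  proof (cases "\<Gamma> j j = 0")
    case True
    have "?L = 0"
    proof (rule ccontr)
      assume "?L \<noteq> 0"
      then show False using quadratic[of "- (?Q + 1) / (2 * ?L)"] True by (simp add: field_simps)
    qed
    then show ?thesis by (simp add: True)
  next
    case False
    then have "0 < \<Gamma> j j" using variance_nonneg[OF j] by simp
    moreover have "0 \<le> ?Q - ?L\<^sup>2 / \<Gamma> j j"
      using quadratic[of "- ?L / \<Gamma> j j"] False by (simp add: power2_eq_square)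
    ultimately show ?thesis by (simp add: divide_le_eq)
  qed
qed

lemma linear_combinations:
  assumes T: "finite T" and h: "\<And>j m. j \<in> J \<Longrightarrow> m \<in> T \<Longrightarrow> h j m \<in> I"
  shows "gaussian_family M J (\<lambda>j \<omega>. \<Sum>m\<in>T. c j m * \<xi> (h j m) \<omega>)
     (\<lambda>i j. \<Sum>m\<in>T. \<Sum>n\<in>T. c i m * c j n * \<Gamma> (h i m) (h j n))"
proof unfold_locales
  fix i j assume "i \<in> J" "j \<in> J"
  then have "c i m * c j n * \<Gamma> (h i m) (h j n) = c j n * c i m * \<Gamma> (h j n) (h i m)"
    if "m \<in> T" "n \<in> T" for m n
    using covariance_sym[of "h i m" "h j n"] h that by simp
  then show "(\<Sum>m\<in>T. \<Sum>n\<in>T. c i m * c j n * \<Gamma> (h i m) (h j n))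
      = (\<Sum>m\<in>T. \<Sum>n\<in>T. c j m * c i n * \<Gamma> (h j m) (h i n))"
    by (subst sum.swap) (intro sum.cong refl, simp)
next
  fix n :: nat and e :: "nat \<Rightarrow> 'c" and d assume e: "\<And>k. k < n \<Longrightarrow> e k \<in> J"
  let ?A = "{..<n} \<times> T"
  let ?c = "\<lambda>(k, m). d k * c (e k) m" and ?h = "\<lambda>(k, m). h (e k) m"
  have "centred_gaussian M (\<lambda>\<omega>. \<Sum>x\<in>?A. ?c x * \<xi> (?h x) \<omega>)
      (\<Sum>x\<in>?A. \<Sum>y\<in>?A. ?c x * ?c y * \<Gamma> (?h x) (?h y))"
    using T e h by (intro gaussian_sum) auto
  moreover have "(\<Sum>x\<in>?A. ?c x * \<xi> (?h x) \<omega>)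
      = (\<Sum>k<n. d k * (\<Sum>m\<in>T. c (e k) m * \<xi> (h (e k) m) \<omega>))" for \<omega>
    by (simp add: sum.cartesian_product' sum_distrib_left mult.assoc)
  moreover have "(\<Sum>x\<in>?A. \<Sum>y\<in>?A. ?c x * ?c y * \<Gamma> (?h x) (?h y))
      = (\<Sum>k<n. \<Sum>l<n. d k * d l * (\<Sum>m\<in>T. \<Sum>n\<in>T. c (e k) m * c (e l) n * \<Gamma> (h (e k) m) (h (e l) n)))"
  proof -
    have "(\<Sum>x\<in>?A. \<Sum>y\<in>?A. ?c x * ?c y * \<Gamma> (?h x) (?h y))
        = (\<Sum>k<n. \<Sum>m\<in>T. \<Sum>l<n. \<Sum>n\<in>T. ?c (k, m) * ?c (l, n) * \<Gamma> (?h (k, m)) (?h (l, n)))"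
      by (simp add: sum.cartesian_product')
    also have "\<dots> = (\<Sum>k<n. \<Sum>l<n. \<Sum>m\<in>T. \<Sum>n\<in>T. ?c (k, m) * ?c (l, n) * \<Gamma> (?h (k, m)) (?h (l, n)))"
      by (intro sum.cong refl sum.swap)
    finally show ?thesis by (simp add: sum_distrib_left mult_ac)
  qed
  ultimately show "centred_gaussian M (\<lambda>\<omega>. \<Sum>k<n. d k * (\<Sum>m\<in>T. c (e k) m * \<xi> (h (e k) m) \<omega>))
      (\<Sum>k<n. \<Sum>l<n. d k * d l * (\<Sum>m\<in>T. \<Sum>n\<in>T. c (e k) m * c (e l) n * \<Gamma> (h (e k) m) (h (e l) n)))"
    by simp
qed

end

context prob_space
begin

(* The common features of cos and cosh that make second moments of sums of Gaussian functionals explicit. *)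
definition cosine_like :: "(real \<Rightarrow> real) \<Rightarrow> real \<Rightarrow> bool" where
  "cosine_like g \<sigma> \<longleftrightarrow> (\<forall>x y. g x * g y = (g (x + y) + g (x - y)) / 2) \<and>
     (\<forall>X v. centred_gaussian M X v \<longrightarrow> has_bochner_integral M (\<lambda>\<omega>. g (X \<omega>)) (exp (\<sigma> * v / 2)))"

lemma cosine_likeD:
  assumes "cosine_like g \<sigma>"
  shows "g x * g y = (g (x + y) + g (x - y)) / 2"
    and "centred_gaussian M X v \<Longrightarrow> has_bochner_integral M (\<lambda>\<omega>. g (X \<omega>)) (exp (\<sigma> * v / 2))"
  using assms by (auto simp: cosine_like_def)

lemma cosine_like_cos: "cosine_like (\<lambda>x. cos (u * x)) (- u\<^sup>2)"
  using centred_gaussian_has_cos_moment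
  by (auto simp: cosine_like_def distrib_left right_diff_distrib cos_add cos_diff)

lemma cosine_like_cosh: "cosine_like cosh 1"
  using centred_gaussian_has_cosh_moment by (auto simp: cosine_like_def cosh_add cosh_diff)

end

context gaussian_family
begin

lemma exp_covariance_le:
  assumes I: "i \<in> I" "j \<in> I" and w: "\<Gamma> i i \<le> w" "\<Gamma> j j \<le> w"
    and exponent: "\<And>v. 0 \<le> v \<Longrightarrow> v \<le> 4 * w \<Longrightarrow> \<sigma> * v / 2 \<le> c"
  shows "(exp (\<sigma> * (\<Gamma> i i + 2 * \<Gamma> i j + \<Gamma> j j) / 2) + exp (\<sigma> * (\<Gamma> i i - 2 * \<Gamma> i j + \<Gamma> j j) / 2)) / 2
      - exp (\<sigma> * \<Gamma> i i / 2) * exp (\<sigma> * \<Gamma> j j / 2) \<le> exp c * \<bar>\<sigma>\<bar> * \<bar>\<Gamma> i j\<bar>"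
proof -
  let ?A = "\<Gamma> i i + \<Gamma> j j"
  have close: "exp (\<sigma> * (?A + 2 * z) / 2)
      \<le> exp (\<sigma> * ?A / 2) + exp c * \<bar>\<sigma>\<bar> * \<bar>\<Gamma> i j\<bar>" if z: "\<bar>z\<bar> = \<bar>\<Gamma> i j\<bar>" for z
  proof -
    have "0 \<le> ?A + 2 * z" "?A + 2 * z \<le> 4 * w" "0 \<le> ?A" "?A \<le> 4 * w"
      using abs_covariance_le[OF I] variance_nonneg[OF I(1)] variance_nonneg[OF I(2)] w z
      by linarith+
    from abs_exp_diff_le[OF exponent[OF this(1,2)] exponent[OF this(3,4)]]
    have "exp (\<sigma> * (?A + 2 * z) / 2)
        \<le> exp (\<sigma> * ?A / 2) + exp c * \<bar>\<sigma> * (?A + 2 * z) / 2 - \<sigma> * ?A / 2\<bar>"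
      by linarith
    also have "\<bar>\<sigma> * (?A + 2 * z) / 2 - \<sigma> * ?A / 2\<bar> = \<bar>\<sigma>\<bar> * \<bar>\<Gamma> i j\<bar>"
      unfolding z[symmetric] abs_mult[symmetric] by (simp add: field_simps)
    finally show ?thesis by simp
  qed
  have "exp (\<sigma> * ?A / 2) = exp (\<sigma> * \<Gamma> i i / 2) * exp (\<sigma> * \<Gamma> j j / 2)"
    by (simp add: field_simps flip: exp_add)
  then show ?thesis
    using close[of "\<Gamma> i j"] close[of "- \<Gamma> i j"] by (simp add: algebra_simps)
qed

lemma second_moment_deviation:
  fixes g :: "real \<Rightarrow> real" and \<sigma> :: real and A :: "'i set"
  defines "D \<equiv> \<lambda>\<omega>. \<Sum>i\<in>A. g (\<xi> i \<omega>) - exp (\<sigma> * \<Gamma> i i / 2)"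
  assumes g: "cosine_like g \<sigma>" and A: "A \<subseteq> I" and w: "\<And>i. i \<in> A \<Longrightarrow> \<Gamma> i i \<le> w"
    and exponent: "\<And>v. 0 \<le> v \<Longrightarrow> v \<le> 4 * w \<Longrightarrow> \<sigma> * v / 2 \<le> c"
  shows "integrable M (\<lambda>\<omega>. (D \<omega>)\<^sup>2)"
    and "(\<integral>\<omega>. (D \<omega>)\<^sup>2 \<partial>M) \<le> exp c * \<bar>\<sigma>\<bar> * (\<Sum>i\<in>A. \<Sum>j\<in>A. \<bar>\<Gamma> i j\<bar>)"
proof -
  let ?m = "\<lambda>i. exp (\<sigma> * \<Gamma> i i / 2)"
  let ?v = "\<lambda>i j. (exp (\<sigma> * (\<Gamma> i i + 2 * \<Gamma> i j + \<Gamma> j j) / 2)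
      + exp (\<sigma> * (\<Gamma> i i - 2 * \<Gamma> i j + \<Gamma> j j) / 2)) / 2"
  have expand: "(D \<omega>)\<^sup>2 = (\<Sum>i\<in>A. \<Sum>j\<in>A. (g (\<xi> i \<omega> + \<xi> j \<omega>) + g (\<xi> i \<omega> - \<xi> j \<omega>)) / 2
      - ?m i * g (\<xi> j \<omega>) - ?m j * g (\<xi> i \<omega>) + ?m i * ?m j)" for \<omega>
    unfolding D_def power2_eq_square sum_product
    unfolding cosine_likeD(1)[OF g, symmetric] by (intro sum.cong refl) (simp add: algebra_simps)
  have pair_integral: "has_bochner_integral M (\<lambda>\<omega>. (g (\<xi> i \<omega> + \<xi> j \<omega>) + g (\<xi> i \<omega> - \<xi> j \<omega>)) / 2
      - ?m i * g (\<xi> j \<omega>) - ?m j * g (\<xi> i \<omega>) + ?m i * ?m j)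
      (?v i j - ?m i * ?m j - ?m j * ?m i + ?m i * ?m j)" if "i \<in> A" "j \<in> A" for i j
  proof -
    have I: "i \<in> I" "j \<in> I" using that A by auto
    have "has_bochner_integral M (\<lambda>_. a) a" for a :: real
      by (simp add: has_bochner_integral_iff prob_space)
    then show ?thesis
      by (intro has_bochner_integral_add has_bochner_integral_diff has_bochner_integral_mult_right
          has_bochner_integral_divide_zero gaussian_add[OF I, THEN cosine_likeD(2)[OF g]]
          I[THEN gaussian_component, THEN cosine_likeD(2)[OF g]])
  qed
  have "has_bochner_integral M (\<lambda>\<omega>. (D \<omega>)\<^sup>2)
      (\<Sum>i\<in>A. \<Sum>j\<in>A. ?v i j - ?m i * ?m j - ?m j * ?m i + ?m i * ?m j)"
    unfolding expand by (intro has_bochner_integral_sum pair_integral)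
  then have integral: "has_bochner_integral M (\<lambda>\<omega>. (D \<omega>)\<^sup>2) (\<Sum>i\<in>A. \<Sum>j\<in>A. ?v i j - ?m i * ?m j)"
    by (simp add: mult.commute)
  then show "integrable M (\<lambda>\<omega>. (D \<omega>)\<^sup>2)" by (simp add: has_bochner_integral_iff)
  have "(\<Sum>i\<in>A. \<Sum>j\<in>A. ?v i j - ?m i * ?m j) \<le> (\<Sum>i\<in>A. \<Sum>j\<in>A. exp c * \<bar>\<sigma>\<bar> * \<bar>\<Gamma> i j\<bar>)"
    using A w by (intro sum_mono exp_covariance_le exponent) auto
  then show "(\<integral>\<omega>. (D \<omega>)\<^sup>2 \<partial>M) \<le> exp c * \<bar>\<sigma>\<bar> * (\<Sum>i\<in>A. \<Sum>j\<in>A. \<bar>\<Gamma> i j\<bar>)"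
    using integral by (simp add: has_bochner_integral_iff sum_distrib_left)
qed

end

locale gaussian_array = badic b + prob_space M for b :: nat and M :: "'a measure" +
  fixes U :: "nat \<Rightarrow> nat \<Rightarrow> 'a \<Rightarrow> real" and \<Gamma> :: "nat \<Rightarrow> nat \<Rightarrow> nat \<Rightarrow> real" and v w :: real
  assumes family: "\<And>N. gaussian_family M UNIV (U N) (\<Gamma> N)"
    and summable_covariance: "summable (\<lambda>N. badic_mean b N (\<lambda>k. badic_mean b N (\<lambda>l. \<bar>\<Gamma> N k l\<bar>)))"
    and variance_le: "\<And>N k. \<Gamma> N k k \<le> w"
    and limit_variance_nonneg: "0 \<le> v"
    and limit_variance: "(\<lambda>N. badic_mean b N (\<lambda>k. \<bar>\<Gamma> N k k - v\<bar>)) \<longlonglongrightarrow> 0"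
begin

lemma AE_deviation_tendsto_zero:
  assumes g: "cosine_like g \<sigma>" and t: "t \<le> 1"
    and exponent: "\<And>s. 0 \<le> s \<Longrightarrow> s \<le> 4 * w \<Longrightarrow> \<sigma> * s / 2 \<le> c"
  shows "AE \<omega> in M. (\<lambda>N. badic_average b t N (\<lambda>k. g (U N k \<omega>) - exp (\<sigma> * \<Gamma> N k k / 2))) \<longlonglongrightarrow> 0"
proof -
  let ?D = "\<lambda>N \<omega>. badic_average b t N (\<lambda>k. g (U N k \<omega>) - exp (\<sigma> * \<Gamma> N k k / 2))"
  let ?S = "\<lambda>N. badic_mean b N (\<lambda>k. badic_mean b N (\<lambda>l. \<bar>\<Gamma> N k l\<bar>))"
  note deviation =
    gaussian_family.second_moment_deviation[OF family g subset_UNIV variance_le exponent]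
  have square: "(?D N \<omega>)\<^sup>2
      = (\<Sum>k<badic_count b t N. g (U N k \<omega>) - exp (\<sigma> * \<Gamma> N k k / 2))\<^sup>2 / (real b ^ N)\<^sup>2" for N \<omega>
    by (simp add: badic_average_def power_divide)
  have integrable: "integrable M (\<lambda>\<omega>. (?D N \<omega>)\<^sup>2)" for N
    unfolding square by (intro integrable_divide_zero deviation(1))
  have "(\<integral>\<omega>. (?D N \<omega>)\<^sup>2 \<partial>M) \<le> exp c * \<bar>\<sigma>\<bar> * ?S N" for N
  proof -
    have "(\<integral>\<omega>. (?D N \<omega>)\<^sup>2 \<partial>M)
        \<le> exp c * \<bar>\<sigma>\<bar> * (\<Sum>k<badic_count b t N. \<Sum>l<badic_count b t N. \<bar>\<Gamma> N k l\<bar>) / (real b ^ N)\<^sup>2"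
      unfolding square integral_divide_zero by (intro divide_right_mono deviation(2)) simp_all
    also have "\<dots> = exp c * \<bar>\<sigma>\<bar> * badic_average b t N (\<lambda>k. badic_average b t N (\<lambda>l. \<bar>\<Gamma> N k l\<bar>))"
      by (simp add: badic_average_def power2_eq_square flip: sum_divide_distrib)
    also have "badic_average b t N (\<lambda>k. badic_average b t N (\<lambda>l. \<bar>\<Gamma> N k l\<bar>))
        \<le> badic_average b t N (\<lambda>k. badic_mean b N (\<lambda>l. \<bar>\<Gamma> N k l\<bar>))"
      using t by (intro badic_average_mono badic_average_mono_time) auto
    also have "\<dots> \<le> ?S N"
      using t by (intro badic_average_mono_time badic_average_nonneg) auto
    finally show ?thesis by (simp add: mult_left_mono)
  qed
  then have "summable (\<lambda>N. \<integral>\<omega>. (?D N \<omega>)\<^sup>2 \<partial>M)"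
    by (intro summable_comparison_test'[of _ 0, OF
        summable_mult[OF summable_covariance, of "exp c * \<bar>\<sigma>\<bar>"]])
      (simp add: abs_of_nonneg integral_nonneg_AE)
  from AE_tendsto_zero_of_summable_integrals[OF integrable _ this]
  have "AE \<omega> in M. (\<lambda>N. (?D N \<omega>)\<^sup>2) \<longlonglongrightarrow> 0" by simp
  then show ?thesis
    by eventually_elim (auto dest: tendsto_real_sqrt simp: tendsto_rabs_zero_iff)
qed

lemma AE_cos_average_tendsto:
  assumes t: "t \<in> {0..1}"
  shows "AE \<omega> in M. (\<lambda>N. badic_average b t N (\<lambda>k. cos (u * U N k \<omega>))) \<longlonglongrightarrow> t * exp (- (u\<^sup>2 * v) / 2)"
proof -
  let ?m = "\<lambda>s. exp (- u\<^sup>2 * s / 2)"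
  have "\<bar>badic_average b t N (\<lambda>k. ?m (\<Gamma> N k k) - ?m v)\<bar>
      \<le> u\<^sup>2 / 2 * badic_mean b N (\<lambda>k. \<bar>\<Gamma> N k k - v\<bar>)" for N
  proof -
    have "\<bar>?m (\<Gamma> N k k) - ?m v\<bar> \<le> u\<^sup>2 / 2 * \<bar>\<Gamma> N k k - v\<bar>" for k
    proof -
      have "\<bar>?m (\<Gamma> N k k) - ?m v\<bar> \<le> exp 0 * \<bar>- u\<^sup>2 * \<Gamma> N k k / 2 - - u\<^sup>2 * v / 2\<bar>"
        using gaussian_family.variance_nonneg[OF family] limit_variance_nonneg
        by (intro abs_exp_diff_le) auto
      also have "- u\<^sup>2 * \<Gamma> N k k / 2 - - u\<^sup>2 * v / 2 = - (u\<^sup>2 / 2) * (\<Gamma> N k k - v)"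
        by (simp add: field_simps)
      finally show ?thesis by (simp only: abs_mult) simp
    qed
    then have "\<bar>badic_average b t N (\<lambda>k. ?m (\<Gamma> N k k) - ?m v)\<bar>
        \<le> u\<^sup>2 / 2 * badic_average b t N (\<lambda>k. \<bar>\<Gamma> N k k - v\<bar>)"
      unfolding badic_average_cmult[symmetric]
      by (intro order_trans[OF abs_badic_average_le] badic_average_mono)
    also have "\<dots> \<le> u\<^sup>2 / 2 * badic_mean b N (\<lambda>k. \<bar>\<Gamma> N k k - v\<bar>)"
      using t by (intro mult_left_mono badic_average_mono_time) auto
    finally show ?thesis .
  qed
  then have "(\<lambda>N. badic_average b t N (\<lambda>k. ?m (\<Gamma> N k k) - ?m v)) \<longlonglongrightarrow> 0"
    by (intro Lim_null_comparison[OF _ tendsto_mult_right_zero[OF limit_variance, of "u\<^sup>2 / 2"]]) simp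
  from tendsto_add[OF this badic_average_const_tendsto[of t "?m v"]] t
  have means: "(\<lambda>N. badic_average b t N (\<lambda>k. ?m (\<Gamma> N k k))) \<longlonglongrightarrow> t * ?m v"
    by (simp add: badic_average_diff)
  have "AE \<omega> in M. (\<lambda>N. badic_average b t N (\<lambda>k. cos (u * U N k \<omega>) - ?m (\<Gamma> N k k))) \<longlonglongrightarrow> 0"
    using t by (intro AE_deviation_tendsto_zero[OF cosine_like_cos, where c = 0]) auto
  then show ?thesis
  proof eventually_elim
    case (elim \<omega>)
    from tendsto_add[OF this means] show ?case by (simp add: badic_average_diff)
  qed
qed

lemma AE_cosh_mean_bounded: "AE \<omega> in M. \<exists>K. \<forall>N. badic_mean b N (\<lambda>k. cosh (U N k \<omega>)) \<le> K"
proof -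
  let ?m = "\<lambda>N k. exp (1 * \<Gamma> N k k / 2)"
  have "AE \<omega> in M. (\<lambda>N. badic_mean b N (\<lambda>k. cosh (U N k \<omega>) - ?m N k)) \<longlonglongrightarrow> 0"
    by (rule AE_deviation_tendsto_zero[OF cosine_like_cosh, where c = "2 * w"]) auto
  then show ?thesis
  proof eventually_elim
    case (elim \<omega>)
    then have "Bseq (\<lambda>N. badic_mean b N (\<lambda>k. cosh (U N k \<omega>) - ?m N k))"
      by (intro convergent_imp_Bseq convergentI)
    then obtain K where K: "\<And>N. \<bar>badic_mean b N (\<lambda>k. cosh (U N k \<omega>) - ?m N k)\<bar> \<le> K"
      unfolding Bseq_def real_norm_def by blast
    have "badic_mean b N (\<lambda>k. cosh (U N k \<omega>)) \<le> K + exp (w / 2)" for N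
    proof -
      have "badic_mean b N (?m N) \<le> exp (w / 2)"
        using variance_le by (intro badic_average_le_const) auto
      then show ?thesis using K[of N] by (simp add: badic_average_diff)
    qed
    then show ?case by blast
  qed
qed

theorem AE_abs_powr_average_tendsto:
  assumes p: "0 < p"
  shows "AE \<omega> in M. \<forall>y \<epsilon>. \<epsilon> \<longlonglongrightarrow> 0 \<longrightarrow> (\<forall>N k. k < b ^ N \<longrightarrow> \<bar>y N k - U N k \<omega>\<bar> \<le> \<epsilon> N) \<longrightarrow>
    (\<forall>t\<in>{0..1}. (\<lambda>N. badic_average b t N (\<lambda>k. \<bar>y N k\<bar> powr p))
        \<longlonglongrightarrow> t * (v powr (p / 2) * std_normal_abs_moment p))"
proof -
  have "AE \<omega> in M. \<forall>t\<in>\<rat> \<inter> {0..1}. \<forall>u\<in>\<rat>.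
      (\<lambda>N. badic_average b t N (\<lambda>k. cos (u * U N k \<omega>))) \<longlonglongrightarrow> t * exp (- (u\<^sup>2 * v) / 2)"
    by (intro AE_ball_countable' AE_cos_average_tendsto countable_rat countable_Int1) auto
  with AE_cosh_mean_bounded show ?thesis
  proof eventually_elim
    case (elim \<omega>)
    then obtain K where K: "\<And>N. badic_mean b N (\<lambda>k. cosh (U N k \<omega>)) \<le> K" by blast
    show ?case
    proof (intro allI impI ballI)
      fix y \<epsilon> and t :: real
      assume "\<epsilon> \<longlonglongrightarrow> 0" "\<forall>N k. k < b ^ N \<longrightarrow> \<bar>y N k - U N k \<omega>\<bar> \<le> \<epsilon> N" and t: "t \<in> {0..1}"
      then have close: "\<epsilon> \<longlonglongrightarrow> 0" "\<And>N k. k < b ^ N \<Longrightarrow> \<bar>y N k - U N k \<omega>\<bar> \<le> \<epsilon> N" by auto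
      let ?c = "v powr (p / 2) * std_normal_abs_moment p"
      have rational: "(\<lambda>N. badic_average b q N (\<lambda>k. \<bar>y N k\<bar> powr p))
          \<longlonglongrightarrow> q * ?c" if q: "q \<in> \<rat> \<inter> {0..1}" for q
      proof (cases "q = 0")
        case True
        then show ?thesis by (simp add: badic_average_def badic_count_def)
      next
        case False
        have cos: "(\<lambda>N. badic_average b q N (\<lambda>k. cos (u * U N k \<omega>))) \<longlonglongrightarrow> q * exp (- (u\<^sup>2 * v) / 2)"
          if "u \<in> \<rat>" for u
          using elim(2) q that by blast
        show ?thesis
          using q False p limit_variance_nonneg
          by (intro badic_average_abs_powr_tendsto_perturbed[where x = "\<lambda>N k. U N k \<omega>", OF _ _ _ _ cos K close]) auto
      qed
      show "(\<lambda>N. badic_average b t N (\<lambda>k. \<bar>y N k\<bar> powr p)) \<longlonglongrightarrow> t * ?c"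
        by (rule mono_LIMSEQ_of_rational_LIMSEQ[OF badic_average_mono_time rational _ t])
          (auto intro!: continuous_intros)
    qed
  qed
qed

end

section \<open>Second differences of powers\<close>

definition second_difference :: "(real \<Rightarrow> real) \<Rightarrow> real \<Rightarrow> real \<Rightarrow> real" where
  "second_difference f h y = f (y + h) + f (y - h) - 2 * f y"

lemma second_difference_uminus:
  "(\<And>y. f (- y) = f y) \<Longrightarrow> second_difference f h (- y) = second_difference f h y"
  unfolding second_difference_def
  by (metis add.commute minus_add_distrib minus_diff_eq uminus_add_conv_diff)

lemma second_difference_bound:
  assumes h: "0 < h"
    and f': "\<And>z. \<bar>z - y\<bar> \<le> h \<Longrightarrow> (f has_real_derivative f' z) (at z)"
    and f'': "\<And>z. \<bar>z - y\<bar> \<le> h \<Longrightarrow> (f' has_real_derivative f'' z) (at z)"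
    and bound: "\<And>z. \<bar>z - y\<bar> \<le> h \<Longrightarrow> \<bar>f'' z\<bar> \<le> B"
  shows "\<bar>second_difference f h y\<bar> \<le> 2 * h\<^sup>2 * B"
proof -
  have shifted: "((\<lambda>w. f (y + w)) has_real_derivative f' (y + w)) (at w)"
    "((\<lambda>w. f (y - w)) has_real_derivative - f' (y - w)) (at w)" if "0 \<le> w" "w \<le> h" for w
  proof -
    have "((\<lambda>w. f (y + w)) has_real_derivative f' (y + w) * 1) (at w)"
      using that by (intro DERIV_chain2[OF f']) (auto intro!: derivative_eq_intros)
    then show "((\<lambda>w. f (y + w)) has_real_derivative f' (y + w)) (at w)" by simp
    have "((\<lambda>w. f (y - w)) has_real_derivative f' (y - w) * (- 1)) (at w)"
      using that by (intro DERIV_chain2[OF f']) (auto intro!: derivative_eq_intros)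
    then show "((\<lambda>w. f (y - w)) has_real_derivative - f' (y - w)) (at w)" by simp
  qed
  have "\<exists>w>0. w < h \<and> (f (y + h) + f (y - h)) - (f (y + 0) + f (y - 0))
      = (h - 0) * (f' (y + w) + - f' (y - w))"
    by (intro MVT2 DERIV_add shifted h)
  then obtain w where w: "0 < w" "w < h"
      and first: "second_difference f h y = h * (f' (y + w) - f' (y - w))"
    by (auto simp: second_difference_def)
  have "\<exists>z>y - w. z < y + w \<and> f' (y + w) - f' (y - w) = ((y + w) - (y - w)) * f'' z"
    using w by (intro MVT2 f'') auto
  then obtain z where z: "y - w < z" "z < y + w"
      and second: "f' (y + w) - f' (y - w) = 2 * w * f'' z"
    by auto
  have "\<bar>second_difference f h y\<bar> = 2 * h * w * \<bar>f'' z\<bar>"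
    unfolding first second using h w by (simp add: abs_mult)
  also have "\<dots> \<le> 2 * h * h * B"
    using h w z by (intro mult_mono bound) auto
  finally show ?thesis by (simp add: power2_eq_square)
qed

lemma second_difference_powr_le:
  assumes a: "a \<le> 2" and A: "0 < A" "A \<le> y" and h: "0 < h" "h \<le> A / 2"
  shows "\<bar>second_difference (\<lambda>x. x powr a) h y\<bar> \<le> 2 * h\<^sup>2 * (\<bar>a * (a - 1)\<bar> * (A / 2) powr (a - 2))"
proof (rule second_difference_bound[OF h(1)])
  fix z assume "\<bar>z - y\<bar> \<le> h"
  then have z: "A / 2 \<le> z" "0 < z" using A h by linarith+
  show "((\<lambda>x. x powr a) has_real_derivative a * z powr (a - 1)) (at z)"
    "((\<lambda>x. a * x powr (a - 1)) has_real_derivative a * (a - 1) * z powr (a - 2)) (at z)"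
    using z by (auto intro!: derivative_eq_intros simp: diff_diff_eq)
  have "z powr (a - 2) \<le> (A / 2) powr (a - 2)"
    using z A a by (intro powr_mono2') auto
  then show "\<bar>a * (a - 1) * z powr (a - 2)\<bar> \<le> \<bar>a * (a - 1)\<bar> * (A / 2) powr (a - 2)"
    by (simp add: abs_mult mult_left_mono)
qed

lemma second_difference_powr_Lipschitz:
  assumes a: "a \<le> 3" and A: "0 < A" "A \<le> z" "z \<le> y" and h: "0 < h" "h \<le> A / 2"
  shows "\<bar>second_difference (\<lambda>x. x powr a) h y - second_difference (\<lambda>x. x powr a) h z\<bar>
    \<le> \<bar>a\<bar> * (2 * h\<^sup>2 * (\<bar>(a - 1) * (a - 2)\<bar> * (A / 2) powr (a - 3))) * (y - z)"
proof (cases "z = y")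
  case False
  let ?D = "\<lambda>a. second_difference (\<lambda>x. x powr a) h"
  have "(?D a has_real_derivative a * ?D (a - 1) w) (at w)" if "z \<le> w" for w
    unfolding second_difference_def using that A h
    by (auto intro!: derivative_eq_intros simp: algebra_simps)
  then have "\<exists>w>z. w < y \<and> ?D a y - ?D a z = (y - z) * (a * ?D (a - 1) w)"
    using A False by (intro MVT2) auto
  then obtain w where w: "z < w" "?D a y - ?D a z = (y - z) * (a * ?D (a - 1) w)" by blast
  have "\<bar>?D (a - 1) w\<bar> \<le> 2 * h\<^sup>2 * (\<bar>(a - 1) * (a - 2)\<bar> * (A / 2) powr (a - 3))"
    using second_difference_powr_le[of "a - 1" A w h] a A h w by simp
  then have "(y - z) * (\<bar>a\<bar> * \<bar>?D (a - 1) w\<bar>)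
      \<le> (y - z) * (\<bar>a\<bar> * (2 * h\<^sup>2 * (\<bar>(a - 1) * (a - 2)\<bar> * (A / 2) powr (a - 3))))"
    using A by (intro mult_left_mono) auto
  then show ?thesis
    unfolding w(2) abs_mult using A by (simp add: mult_ac)
qed simp

lemma second_difference_abs_powr:
  "0 < h \<Longrightarrow> h \<le> y \<Longrightarrow> second_difference (\<lambda>x. \<bar>x\<bar> powr a) h y = second_difference (\<lambda>x. x powr a) h y"
  by (simp add: second_difference_def)

section \<open>Covariances of the increments of fractional Brownian motion\<close>

definition increment_cov :: "real \<Rightarrow> real \<Rightarrow> real \<Rightarrow> real \<Rightarrow> real \<Rightarrow> real" where
  "increment_cov H s t u v = (\<bar>t - u\<bar> powr (2*H) + \<bar>s - v\<bar> powr (2*H)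
     - \<bar>t - v\<bar> powr (2*H) - \<bar>s - u\<bar> powr (2*H)) / 2"

lemma increment_cov_eq:
  "increment_cov H s t u v = fbm_cov H t v - fbm_cov H t u - fbm_cov H s v + fbm_cov H s u"
  by (simp add: increment_cov_def fbm_cov_def abs_minus_commute field_simps)

lemma increment_cov_commute: "increment_cov H s t u v = increment_cov H u v s t"
  by (simp add: increment_cov_def abs_minus_commute)

lemma increment_cov_scale:
  assumes "0 \<le> c"
  shows "increment_cov H (c * s) (c * t) (c * u) (c * v) = c powr (2*H) * increment_cov H s t u v"
proof -
  have "\<bar>c * x - c * y\<bar> powr (2*H) = c powr (2*H) * \<bar>x - y\<bar> powr (2*H)" for x y
    using assms by (simp add: abs_mult powr_mult flip: right_diff_distrib)
  note scale = this
  show ?thesis unfolding increment_cov_def scale by (simp add: field_simps)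
qed

lemma sum_increment_cov:
  assumes "0 < n"
  shows "(\<Sum>a<n. increment_cov H (real a / real n) (real (a + 1) / real n) u v)
      = increment_cov H 0 1 u v"
proof -
  let ?F = "\<lambda>a. (\<bar>real a / real n - u\<bar> powr (2*H) - \<bar>real a / real n - v\<bar> powr (2*H)) / 2"
  have "(\<Sum>a<n. increment_cov H (real a / real n) (real (a + 1) / real n) u v)
      = (\<Sum>a<n. ?F (Suc a) - ?F a)"
    by (intro sum.cong refl) (simp add: increment_cov_def field_simps)
  also have "\<dots> = ?F n - ?F 0" by (rule sum_lessThan_telescope)
  finally show ?thesis using assms by (simp add: increment_cov_def field_simps)
qed

lemma powr_increment_mono:
  fixes a x y d :: real
  assumes a: "0 < a" and x: "0 \<le> x" "x \<le> y" and d: "0 \<le> d"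
  shows "1 \<le> a \<Longrightarrow> (x + d) powr a - x powr a \<le> (y + d) powr a - y powr a"
    and "a \<le> 1 \<Longrightarrow> (y + d) powr a - y powr a \<le> (x + d) powr a - x powr a"
proof -
  let ?f = "\<lambda>z. (z + d) powr a - z powr a"
      and ?f' = "\<lambda>z. a * ((z + d) powr (a - 1) - z powr (a - 1))"
  have deriv: "(?f has_real_derivative ?f' z) (at z)" if "x < z" for z
    using that x d by (auto intro!: derivative_eq_intros simp: algebra_simps)
  have cont: "continuous_on {x..y} ?f"
    using x d a by (intro continuous_on_diff continuous_on_powr' continuous_intros) auto
  show "?f x \<le> ?f y" if "1 \<le> a"
  proof (rule DERIV_nonneg_imp_increasing_open[OF x(2) _ cont])
    fix z assume z: "x < z" "z < y"
    have "z powr (a - 1) \<le> (z + d) powr (a - 1)"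
      using z x d that by (intro powr_mono2) auto
    then show "\<exists>w. (?f has_real_derivative w) (at z) \<and> 0 \<le> w"
      using deriv[OF z(1)] a by (intro exI[of _ "?f' z"]) auto
  qed
  show "?f y \<le> ?f x" if "a \<le> 1"
  proof (rule DERIV_nonpos_imp_decreasing_open[OF x(2) _ cont])
    fix z assume z: "x < z" "z < y"
    have "(z + d) powr (a - 1) \<le> z powr (a - 1)"
      using z x d that by (intro powr_mono2') auto
    then have "?f' z \<le> 0" using a by (intro mult_nonneg_nonpos) auto
    then show "\<exists>w. (?f has_real_derivative w) (at z) \<and> w \<le> 0"
      using deriv[OF z(1)] by (intro exI[of _ "?f' z"]) auto
  qed
qed

lemma increment_cov_nested:
  assumes H: "0 < H" and nested: "u \<le> s" "s \<le> t" "t \<le> v"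
  shows "0 \<le> increment_cov H s t u v"
    and "H \<le> 1/2 \<Longrightarrow> increment_cov H s t u v \<le> (t - s) powr (2*H)"
proof -
  have cov: "increment_cov H s t u v = ((t - u) powr (2*H) + (v - s) powr (2*H)
     - (v - t) powr (2*H) - (s - u) powr (2*H)) / 2"
    using nested
    by (simp add: increment_cov_def abs_minus_commute[of s v] abs_minus_commute[of t v])
  have "(s - u) powr (2*H) \<le> (t - u) powr (2*H)" "(v - t) powr (2*H) \<le> (v - s) powr (2*H)"
    using assms by (auto intro!: powr_mono2)
  then show "0 \<le> increment_cov H s t u v"
    by (simp add: cov)
  assume "H \<le> 1/2"
  then have "(t - u) powr (2*H) - (s - u) powr (2*H) \<le> (t - s) powr (2*H)"
    "(v - s) powr (2*H) - (v - t) powr (2*H) \<le> (t - s) powr (2*H)"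
    using powr_increment_mono(2)[of "2*H" 0 "s - u" "t - s"]
      powr_increment_mono(2)[of "2*H" 0 "v - t" "t - s"] H nested by simp_all
  then show "increment_cov H s t u v \<le> (t - s) powr (2*H)"
    by (simp add: cov)
qed

lemma increment_cov_disjoint:
  assumes H: "0 < H" and disjoint: "s \<le> t" "t \<le> u" "u \<le> v"
  shows "1/2 \<le> H \<Longrightarrow> 0 \<le> increment_cov H s t u v"
    and "H \<le> 1/2 \<Longrightarrow> increment_cov H s t u v \<le> 0"
  using powr_increment_mono[of "2*H" "u - t" "u - s" "v - u"] H disjoint
  by (auto simp: increment_cov_def abs_minus_commute[of s] abs_minus_commute[of t])

definition fgn_cov :: "real \<Rightarrow> int \<Rightarrow> real" where
  "fgn_cov H x = second_difference (\<lambda>y. \<bar>y\<bar> powr (2*H)) 1 (real_of_int x) / 2"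

lemma fgn_cov_vanishes:
  assumes H: "0 < H" "H < 1" and e: "0 < e"
  shows "\<exists>D. \<forall>x. D < \<bar>x\<bar> \<longrightarrow> \<bar>fgn_cov H x\<bar> \<le> e"
proof -
  let ?c = "\<bar>2*H * (2*H - 1)\<bar>"
  have "filterlim (\<lambda>y::real. 1 / 2 * y) at_top at_top"
    by (rule filterlim_tendsto_pos_mult_at_top[OF tendsto_const _ filterlim_ident]) simp
  then have "((\<lambda>y. ?c * (1 / 2 * y) powr (2*H - 2)) \<longlongrightarrow> ?c * 0) at_top"
    using H by (intro tendsto_mult tendsto_const tendsto_neg_powr) auto
  then have "\<forall>\<^sub>F y in at_top. ?c * (y / 2) powr (2*H - 2) < e"
    using e by (intro order_tendstoD) auto
  then obtain R where R: "\<And>y. R \<le> y \<Longrightarrow> ?c * (y / 2) powr (2*H - 2) < e"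
    by (auto simp: eventually_at_top_linorder)
  have "\<bar>fgn_cov H x\<bar> \<le> e" if x: "max 2 \<lceil>R\<rceil> < \<bar>x\<bar>" for x
  proof -
    let ?y = "\<bar>real_of_int x\<bar>"
    have y: "2 \<le> ?y" "R \<le> ?y" using x by linarith+
    have "second_difference (\<lambda>y. \<bar>y\<bar> powr (2*H)) 1 (real_of_int x)
        = second_difference (\<lambda>y. \<bar>y\<bar> powr (2*H)) 1 ?y"
      by (simp add: abs_if second_difference_uminus)
    also have "\<dots> = second_difference (\<lambda>y. y powr (2*H)) 1 ?y"
      using y by (intro second_difference_abs_powr) auto
    also have "\<bar>\<dots>\<bar> \<le> 2 * 1\<^sup>2 * (?c * (?y / 2) powr (2*H - 2))"
      using y H by (intro second_difference_powr_le) auto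
    finally show ?thesis using R[OF y(2)] by (simp add: fgn_cov_def)
  qed
  then show ?thesis by blast
qed

lemma sum_abs_inj_le_of_vanishing:
  fixes f :: "int \<Rightarrow> real"
  assumes vanishing: "\<forall>x. D < \<bar>x\<bar> \<longrightarrow> \<bar>f x\<bar> \<le> e" and inj: "inj_on \<iota> {..<n::nat}"
  shows "(\<Sum>a<n. \<bar>f (\<iota> a)\<bar>) \<le> real n * e + (\<Sum>x\<in>{-D..D}. \<bar>f x\<bar>)"
proof -
  let ?S = "{a\<in>{..<n}. \<bar>\<iota> a\<bar> \<le> D}"
  have e: "0 \<le> e"
    using order_trans[OF abs_ge_zero vanishing[rule_format, of "\<bar>D\<bar> + 1"]] by simp
  have "(\<Sum>a<n. \<bar>f (\<iota> a)\<bar>) \<le> (\<Sum>a<n. e + (if \<bar>\<iota> a\<bar> \<le> D then \<bar>f (\<iota> a)\<bar> else 0))"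
    using e vanishing by (intro sum_mono) (auto simp: not_le)
  also have "\<dots> = real n * e + (\<Sum>a\<in>?S. \<bar>f (\<iota> a)\<bar>)"
    by (subst sum.inter_filter) (auto simp: sum.distrib)
  also have "(\<Sum>a\<in>?S. \<bar>f (\<iota> a)\<bar>) = (\<Sum>x\<in>\<iota> ` ?S. \<bar>f x\<bar>)"
    using inj by (subst sum.reindex) (auto simp: inj_on_def)
  also have "\<dots> \<le> (\<Sum>x\<in>{-D..D}. \<bar>f x\<bar>)" by (intro sum_mono2) auto
  finally show ?thesis by simp
qed

definition badic_cov :: "real \<Rightarrow> nat \<Rightarrow> nat \<Rightarrow> nat \<Rightarrow> nat \<Rightarrow> nat \<Rightarrow> real" where
  "badic_cov H b m a n c = increment_cov H (real a / real b ^ m) (real (a + 1) / real b ^ m)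
     (real c / real b ^ n) (real (c + 1) / real b ^ n)"

definition badic_corr :: "real \<Rightarrow> nat \<Rightarrow> nat \<Rightarrow> nat \<Rightarrow> nat \<Rightarrow> nat \<Rightarrow> real" where
  "badic_corr H b m a n c = (real b powr H) ^ m * (real b powr H) ^ n * badic_cov H b m a n c"

lemma badic_cov_eq:
  "badic_cov H b m a n c = increment_cov H (real c / real b ^ n) (real (c + 1) / real b ^ n)
     (real a / real b ^ m) (real (a + 1) / real b ^ m)"
  unfolding badic_cov_def by (rule increment_cov_commute)

lemma badic_corr_commute: "badic_corr H b m a n c = badic_corr H b n c m a"
  unfolding badic_corr_def badic_cov_eq[of H b m a n c] by (simp add: badic_cov_def)

context badic
begin

lemma badic_le_iff:
  assumes "m \<le> n"
  shows "real x / real b ^ m \<le> real y / real b ^ n \<longleftrightarrow> x * b ^ (n - m) \<le> y"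
    and "real y / real b ^ n \<le> real x / real b ^ m \<longleftrightarrow> y \<le> x * b ^ (n - m)"
proof -
  have "real b ^ n = real b ^ m * real b ^ (n - m)" using assms by (simp flip: power_add)
  then have "real x / real b ^ m = real (x * b ^ (n - m)) / real b ^ n" by simp
  then show "real x / real b ^ m \<le> real y / real b ^ n \<longleftrightarrow> x * b ^ (n - m) \<le> y"
    "real y / real b ^ n \<le> real x / real b ^ m \<longleftrightarrow> y \<le> x * b ^ (n - m)"
    by (simp_all add: divide_le_cancel not_less del: of_nat_mult of_nat_power)
qed

lemma badic_interval_nested:
  assumes "m \<le> n"
  shows "real (c div b ^ (n - m)) / real b ^ m \<le> real c / real b ^ n"
    and "real (c + 1) / real b ^ n \<le> real (c div b ^ (n - m) + 1) / real b ^ m"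
  unfolding badic_le_iff[OF assms]
  using dividend_less_div_times[of "b ^ (n - m)" c] by (simp_all add: Suc_le_eq)

lemma badic_interval_before:
  assumes "m \<le> n" and "a < c div b ^ (n - m)"
  shows "real (a + 1) / real b ^ m \<le> real c / real b ^ n"
proof -
  have "(a + 1) * b ^ (n - m) \<le> (c div b ^ (n - m)) * b ^ (n - m)"
    using assms(2) by (intro mult_le_mono1) simp
  then show ?thesis
    unfolding badic_le_iff[OF assms(1)] using div_times_less_eq_dividend le_trans by blast
qed

lemma badic_interval_after:
  assumes "m \<le> n" and "c div b ^ (n - m) < a"
  shows "real (c + 1) / real b ^ n \<le> real a / real b ^ m"
proof -
  have "(c div b ^ (n - m) + 1) * b ^ (n - m) \<le> a * b ^ (n - m)"
    using assms(2) by (intro mult_le_mono1) simp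
  then show ?thesis
    unfolding badic_le_iff[OF assms(1)] using dividend_less_div_times[of "b ^ (n - m)" c] by simp
qed

lemma sum_badic_cov:
  "(\<Sum>a<b ^ m. badic_cov H b m a n c)
      = increment_cov H 0 1 (real c / real b ^ n) (real (c + 1) / real b ^ n)"
  unfolding badic_cov_def using sum_increment_cov[of "b ^ m"] by simp

end

locale badic_hurst = badic b for b :: nat +
  fixes H :: real
  assumes hurst_pos: "0 < H" and hurst_less_1: "H < 1"
begin

abbreviation \<beta> :: real where
  "\<beta> \<equiv> real b powr H"

lemma base_powr_gt_1: "1 < \<beta>"
  by (intro gr_one_powr base_gt_1 hurst_pos)

lemma base_powr_less_base: "\<beta> < real b"
  using powr_less_mono[of H 1 "real b"] hurst_less_1 by simp

lemma mesh_powr: "(1 / real b ^ n) powr (2*H) = 1 / (\<beta> ^ n * \<beta> ^ n)"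
proof -
  have "(real b ^ n) powr (2*H) = \<beta> powr real n * \<beta> powr real n"
    by (simp add: powr_powr mult_ac flip: powr_realpow powr_add)
  then show ?thesis by (simp add: powr_divide powr_realpow)
qed

lemma badic_corr_self [simp]: "badic_corr H b m a m a = 1"
proof -
  have "badic_cov H b m a m a = (1 / real b ^ m) powr (2*H)"
    by (simp add: badic_cov_def increment_cov_def abs_minus_commute flip: diff_divide_distrib)
  then show ?thesis
    by (simp add: badic_corr_def mesh_powr)
qed

lemma badic_cov_nested:
  assumes "m \<le> n"
  shows "0 \<le> badic_cov H b m (c div b ^ (n - m)) n c"
    and "H \<le> 1/2 \<Longrightarrow> badic_cov H b m (c div b ^ (n - m)) n c \<le> 1 / (\<beta> ^ n * \<beta> ^ n)"
  using increment_cov_nested[OF hurst_pos badic_interval_nested(1)[OF assms]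
    _ badic_interval_nested(2)[OF assms], of c c]
  unfolding badic_cov_eq by (simp_all add: divide_right_mono mesh_powr flip: diff_divide_distrib)

lemma badic_cov_disjoint:
  assumes mn: "m \<le> n" and a: "a \<noteq> c div b ^ (n - m)"
  shows "1/2 \<le> H \<Longrightarrow> 0 \<le> badic_cov H b m a n c" and "H \<le> 1/2 \<Longrightarrow> badic_cov H b m a n c \<le> 0"
proof -
  have mesh: "real x / real b ^ k \<le> real (x + 1) / real b ^ k" for x k
    by (simp add: divide_right_mono)
  consider "a < c div b ^ (n - m)" | "c div b ^ (n - m) < a" using a by linarith
  then have "(1/2 \<le> H \<longrightarrow> 0 \<le> badic_cov H b m a n c) \<and> (H \<le> 1/2 \<longrightarrow> badic_cov H b m a n c \<le> 0)"
  proof cases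
    case 1
    show ?thesis
      using increment_cov_disjoint[OF hurst_pos mesh badic_interval_before[OF mn 1] mesh]
      by (auto simp: badic_cov_def)
  next
    case 2
    show ?thesis
      using increment_cov_disjoint[OF hurst_pos mesh badic_interval_after[OF mn 2] mesh]
      by (auto simp: badic_cov_eq)
  qed
  then show "1/2 \<le> H \<Longrightarrow> 0 \<le> badic_cov H b m a n c" "H \<le> 1/2 \<Longrightarrow> badic_cov H b m a n c \<le> 0" by auto
qed

lemma sum_abs_badic_cov_le_persistent:
  assumes mn: "m \<le> n" and H: "1/2 \<le> H"
  shows "(\<Sum>a<b ^ m. \<Sum>c<b ^ n. \<bar>badic_cov H b m a n c\<bar>) \<le> 1"
proof -
  have "0 \<le> badic_cov H b m a n c" for a c
    using badic_cov_nested(1)[OF mn, of c] badic_cov_disjoint(1)[OF mn _ H, of a c]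
    by (cases "a = c div b ^ (n - m)") auto
  then have "(\<Sum>a<b ^ m. \<Sum>c<b ^ n. \<bar>badic_cov H b m a n c\<bar>)
      = (\<Sum>c<b ^ n. \<Sum>a<b ^ m. badic_cov H b m a n c)"
    by (subst sum.swap) simp
  also have "\<dots> = (\<Sum>c<b ^ n. increment_cov H (real c / real b ^ n) (real (c + 1) / real b ^ n) 0 1)"
    unfolding sum_badic_cov by (intro sum.cong refl increment_cov_commute)
  also have "\<dots> = 1"
    using sum_increment_cov[of "b ^ n" H 0 1] by (simp add: increment_cov_def)
  finally show ?thesis by simp
qed

lemma sum_abs_badic_cov_le_antipersistent:
  assumes mn: "m \<le> n" and H: "H \<le> 1/2"
  shows "(\<Sum>a<b ^ m. \<Sum>c<b ^ n. \<bar>badic_cov H b m a n c\<bar>) \<le> 2 * real b ^ n / (\<beta> ^ n * \<beta> ^ n)"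
proof -
  have "(\<Sum>a<b ^ m. \<bar>badic_cov H b m a n c\<bar>) \<le> 2 / (\<beta> ^ n * \<beta> ^ n)" if c: "c < b ^ n" for c
  proof -
    let ?a = "c div b ^ (n - m)"
    have "b ^ n = b ^ m * b ^ (n - m)" using mn by (simp flip: power_add)
    then have a: "?a < b ^ m" using c by (simp add: less_mult_imp_div_less)
    have "\<bar>badic_cov H b m a n c\<bar>
        = (if a = ?a then 2 * badic_cov H b m ?a n c else 0) - badic_cov H b m a n c" for a
      using badic_cov_nested(1)[OF mn, of c] badic_cov_disjoint(2)[OF mn _ H, of a c] by auto
    then have "(\<Sum>a<b ^ m. \<bar>badic_cov H b m a n c\<bar>)
        = 2 * badic_cov H b m ?a n c - (\<Sum>a<b ^ m. badic_cov H b m a n c)"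
      using a by (simp add: sum_subtractf)
    also have "\<dots> \<le> 2 * badic_cov H b m ?a n c"
    proof -
      have "real (c + 1) \<le> real b ^ n" using c by (simp add: Suc_le_eq flip: of_nat_power)
      then have "0 \<le> increment_cov H (real c / real b ^ n) (real (c + 1) / real b ^ n) 0 1"
        by (intro increment_cov_nested hurst_pos) (auto simp: divide_right_mono divide_le_eq)
      then show ?thesis unfolding sum_badic_cov by (simp add: increment_cov_commute[of H 0 1])
    qed
    finally show ?thesis using badic_cov_nested(2)[OF mn H, of c] by simp
  qed
  then have "(\<Sum>c<b ^ n. \<Sum>a<b ^ m. \<bar>badic_cov H b m a n c\<bar>) \<le> (\<Sum>c<b ^ n. 2 / (\<beta> ^ n * \<beta> ^ n))"
    by (intro sum_mono) auto
  then show ?thesis by (subst sum.swap) (simp add: mult_ac)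
qed

definition decay :: real where
  "decay = max (\<beta> / real b) (1 / \<beta>)"

lemma decay_bounds: "0 < decay" "decay < 1"
  using base_powr_gt_1 base_powr_less_base by (auto simp: decay_def less_max_iff_disj)

lemma badic_mean_abs_corr_le:
  "badic_mean b m (\<lambda>a. badic_mean b n (\<lambda>c. \<bar>badic_corr H b m a n c\<bar>)) \<le> 2 * decay ^ m * decay ^ n"
proof (induction m n rule: linorder_wlog)
  case (le m n)
  let ?S = "\<Sum>a<b ^ m. \<Sum>c<b ^ n. \<bar>badic_cov H b m a n c\<bar>"
  have mean: "badic_mean b m (\<lambda>a. badic_mean b n (\<lambda>c. \<bar>badic_corr H b m a n c\<bar>))
      = (\<beta> / real b) ^ m * (\<beta> / real b) ^ n * ?S"
    by (simp add: badic_average_def badic_corr_def abs_mult power_divide mult_ac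
        flip: sum_divide_distrib sum_distrib_left)
  have q: "(\<beta> / real b) ^ k \<le> decay ^ k" "(1 / \<beta>) ^ k \<le> decay ^ k" for k
    by (auto intro!: power_mono simp: decay_def)
  show ?case
  proof (cases "1/2 \<le> H")
    case True
    have "(\<beta> / real b) ^ m * (\<beta> / real b) ^ n * ?S \<le> decay ^ m * decay ^ n * 1"
      using sum_abs_badic_cov_le_persistent[OF le True] decay_bounds
      by (intro mult_mono q) (auto intro: sum_nonneg)
    also have "\<dots> \<le> 2 * decay ^ m * decay ^ n"
      using decay_bounds by simp
    finally show ?thesis unfolding mean .
  next
    case False
    have "(\<beta> / real b) ^ m * (\<beta> / real b) ^ n * ?S
        \<le> (\<beta> / real b) ^ m * (\<beta> / real b) ^ n * (2 * real b ^ n / (\<beta> ^ n * \<beta> ^ n))"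
      using sum_abs_badic_cov_le_antipersistent[OF le] False by (intro mult_left_mono) auto
    also have "\<dots> = 2 * ((\<beta> / real b) ^ m * (1 / \<beta>) ^ n)"
      using base_powr_gt_1 by (simp add: power_divide)
    also have "\<dots> \<le> 2 * (decay ^ m * decay ^ n)"
      using decay_bounds by (intro mult_left_mono mult_mono q) auto
    finally show ?thesis unfolding mean by simp
  qed
next
  case (sym m n)
  then show ?case
    by (subst badic_average_swap) (simp add: badic_corr_commute[of H b n] mult_ac)
qed

lemma increment_cov_unit_eq_sum_fgn_cov:
  "increment_cov H (real k) (real (k + 1)) (real x) (real (x + n))
      = (\<Sum>e<n. fgn_cov H (int k - int x - int e))"
proof (induction n)
  case 0
  show ?case by (simp add: increment_cov_def)
next
  case (Suc n)
  define y where "y = real k - real (x + n)"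
  have y: "real (k + 1) - real (x + Suc n) = y" "real_of_int (int k - int x - int n) = y"
    "real (k + 1) - real (x + n) = y + 1" "real k - real (x + Suc n) = y - 1"
    "real k - real (x + n) = y"
    by (simp_all add: y_def)
  have "increment_cov H (real k) (real (k + 1)) (real x) (real (x + Suc n))
    = increment_cov H (real k) (real (k + 1)) (real x) (real (x + n))
      + fgn_cov H (int k - int x - int n)"
    unfolding increment_cov_def fgn_cov_def second_difference_def y by (simp add: field_simps)
  with Suc show ?case by simp
qed

lemma abs_badic_corr_le_sum_fgn_cov:
  "\<bar>badic_corr H b (m + d) k m a\<bar> \<le> (\<Sum>e<b ^ d. \<bar>fgn_cov H (int k - int (b ^ d * a) - int e)\<bar>)"
proof -
  let ?c = "1 / real b ^ (m + d)" and ?S = "\<Sum>e<b ^ d. fgn_cov H (int k - int (b ^ d * a) - int e)"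
  have scale_nonneg: "0 \<le> ?c" by simp
  have ends: "real a / real b ^ m = ?c * real (b ^ d * a)"
      "real (a + 1) / real b ^ m = ?c * real (b ^ d * a + b ^ d)"
    by (simp_all add: power_add field_simps)
  have "badic_cov H b (m + d) k m a
      = increment_cov H (?c * real k) (?c * real (k + 1))
          (?c * real (b ^ d * a)) (?c * real (b ^ d * a + b ^ d))"
    unfolding badic_cov_def ends by simp
  also have "\<dots> = ?c powr (2*H) * ?S"
    unfolding increment_cov_scale[OF scale_nonneg] increment_cov_unit_eq_sum_fgn_cov ..
  finally have "badic_corr H b (m + d) k m a = (1 / \<beta>) ^ d * ?S"
    using base_powr_gt_1 unfolding badic_corr_def mesh_powr by (simp add: power_add power_divide)
  also have "\<bar>\<dots>\<bar> \<le> 1 * (\<Sum>e<b ^ d. \<bar>fgn_cov H (int k - int (b ^ d * a) - int e)\<bar>)"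
    unfolding abs_mult using base_powr_gt_1 by (intro mult_mono sum_abs) (auto intro!: power_le_one)
  finally show ?thesis by simp
qed

(* For a fixed gap d, the lag between the fine interval k and the coarse interval k mod b^m runs injectively
   through the integers as k runs through a block of length b^m. *)
lemma badic_mean_abs_corr_mod_le:
  assumes d: "1 \<le> d" and vanishing: "\<forall>x. D < \<bar>x\<bar> \<longrightarrow> \<bar>fgn_cov H x\<bar> \<le> e"
  shows "badic_mean b (m + d) (\<lambda>k. \<bar>badic_corr H b (m + d) k m (k mod b ^ m)\<bar>)
    \<le> real b ^ d * (e + (\<Sum>x\<in>{-D..D}. \<bar>fgn_cov H x\<bar>) / real b ^ m)"
proof -
  let ?R = "real (b ^ m) * e + (\<Sum>x\<in>{-D..D}. \<bar>fgn_cov H x\<bar>)"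
  let ?g = "\<lambda>k e. \<bar>fgn_cov H (int k - int (b ^ d * (k mod b ^ m)) - int e)\<bar>"
  have block: "(\<Sum>a<b ^ m. ?g (c * b ^ m + a) e') \<le> ?R" for c e'
  proof -
    let ?\<iota> = "\<lambda>a. int (c * b ^ m + a) - int (b ^ d * a) - int e'"
    have "int (b ^ d) \<noteq> 1" using self_le_power[of b d] base_ge_2 d by linarith
    then have "inj_on ?\<iota> {..<b ^ m}"
    proof (intro inj_onI)
      fix x y assume "?\<iota> x = ?\<iota> y"
      then have "(int (b ^ d) - 1) * (int x - int y) = 0" by (simp add: algebra_simps)
      then show "x = y" using \<open>int (b ^ d) \<noteq> 1\<close> by simp
    qed
    then have "(\<Sum>a<b ^ m. \<bar>fgn_cov H (?\<iota> a)\<bar>) \<le> ?R"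
      by (rule sum_abs_inj_le_of_vanishing[OF vanishing])
    then show ?thesis by simp
  qed
  have "(\<Sum>k<b ^ (m + d). \<bar>badic_corr H b (m + d) k m (k mod b ^ m)\<bar>)
      \<le> (\<Sum>k<b ^ (m + d). \<Sum>e'<b ^ d. ?g k e')"
    by (intro sum_mono abs_badic_corr_le_sum_fgn_cov)
  also have "\<dots> = (\<Sum>c<b ^ d. \<Sum>a<b ^ m. \<Sum>e'<b ^ d. ?g (c * b ^ m + a) e')"
    unfolding power_add mult.commute[of "b ^ m"] by (rule sum_lessThan_mult_blocks)
  also have "\<dots> = (\<Sum>c<b ^ d. \<Sum>e'<b ^ d. \<Sum>a<b ^ m. ?g (c * b ^ m + a) e')"
    by (intro sum.cong refl sum.swap)
  also have "\<dots> \<le> (\<Sum>c<b ^ d. \<Sum>e'<b ^ d. ?R)" by (intro sum_mono block)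
  finally have "badic_mean b (m + d) (\<lambda>k. \<bar>badic_corr H b (m + d) k m (k mod b ^ m)\<bar>)
      \<le> (\<Sum>c<b ^ d. \<Sum>e'<b ^ d. ?R) / real b ^ (m + d)"
    unfolding badic_average_def badic_count_1 by (rule divide_right_mono) simp
  also have "\<dots> = real b ^ d * (e + (\<Sum>x\<in>{-D..D}. \<bar>fgn_cov H x\<bar>) / real b ^ m)"
    by (simp add: power_add field_simps)
  finally show ?thesis .
qed

lemma badic_mean_abs_corr_mod_tendsto:
  assumes d: "1 \<le> d"
  shows "(\<lambda>m. badic_mean b (m + d) (\<lambda>k. \<bar>badic_corr H b (m + d) k m (k mod b ^ m)\<bar>)) \<longlonglongrightarrow> 0"
    (is "?f \<longlonglongrightarrow> 0")
proof (rule LIMSEQ_I)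
  fix r :: real assume r: "0 < r"
  define e where "e = r / (2 * real b ^ d)"
  have "0 < e" using r by (simp add: e_def)
  then obtain D where D: "\<forall>x. D < \<bar>x\<bar> \<longrightarrow> \<bar>fgn_cov H x\<bar> \<le> e"
    using fgn_cov_vanishes hurst_pos hurst_less_1 by blast
  let ?S = "\<Sum>x\<in>{-D..D}. \<bar>fgn_cov H x\<bar>"
  have "(\<lambda>m. real b ^ d * (e + ?S / real b ^ m)) \<longlonglongrightarrow> real b ^ d * (e + 0)"
    by (intro tendsto_intros LIMSEQ_divide_realpow_zero) simp
  moreover have "real b ^ d * (e + 0) < r" using r by (simp add: e_def)
  ultimately have "\<forall>\<^sub>F m in sequentially. real b ^ d * (e + ?S / real b ^ m) < r"
    by (rule order_tendstoD)
  then have "\<forall>\<^sub>F m in sequentially. ?f m < r"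
    by eventually_elim (rule le_less_trans[OF badic_mean_abs_corr_mod_le[OF d D]])
  moreover have "0 \<le> ?f m" for m by (intro badic_average_nonneg) simp
  ultimately show "\<exists>N. \<forall>m\<ge>N. norm (?f m - 0) < r"
    by (simp add: eventually_sequentially)
qed

end

section \<open>Multilevel sums\<close>

lemma sum_atLeast1_atMost_rev:
  fixes f :: "nat \<Rightarrow> 'a::comm_monoid_add"
  shows "(\<Sum>m\<in>{1..N}. f m) = (\<Sum>i<N. f (N - i))"
  by (rule sum.reindex_bij_witness[where i = "\<lambda>i. N - i" and j = "\<lambda>m. N - m"]) auto

lemma sum_power_le_geometric:
  fixes q :: real
  assumes "0 \<le> q" "q < 1" "finite A"
  shows "(\<Sum>i\<in>A. q ^ i) \<le> 1 / (1 - q)"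
  using assms sum_le_suminf[of "\<lambda>i. q ^ i" A] by (simp add: summable_geometric suminf_geometric)

lemma geometric_convolution_bound:
  fixes r s :: real
  assumes "0 \<le> r" "r < 1" "0 \<le> s" "s < 1"
  obtains C q where "0 \<le> C" "0 < q" "q < 1" "\<And>N. (\<Sum>m\<in>{1..N}. r ^ (N - m) * s ^ m) \<le> C * q ^ N"
proof -
  define q where "q = max (1/4) (max r s)"
  have q: "0 < q" "q < 1" "r \<le> q" "s \<le> q" using assms by (auto simp: q_def)
  have "(\<lambda>n. real n * sqrt q ^ n) \<longlonglongrightarrow> 0"
    using q by (intro powser_times_n_limit_0) auto
  then have "Bseq (\<lambda>n. real n * sqrt q ^ n)" by (intro convergent_imp_Bseq convergentI)
  then obtain C where C: "\<And>n. \<bar>real n * sqrt q ^ n\<bar> \<le> C"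
    unfolding Bseq_def real_norm_def by blast
  have "(\<Sum>m\<in>{1..N}. r ^ (N - m) * s ^ m) \<le> C * sqrt q ^ N" for N
  proof -
    have "(\<Sum>m\<in>{1..N}. r ^ (N - m) * s ^ m) \<le> (\<Sum>m\<in>{1..N}. q ^ (N - m) * q ^ m)"
      using assms q by (intro sum_mono mult_mono power_mono) auto
    also have "\<dots> = real N * q ^ N" by (simp flip: power_add)
    also have "\<dots> = (real N * sqrt q ^ N) * sqrt q ^ N"
      using q by (simp flip: power_mult_distrib)
    also have "\<dots> \<le> C * sqrt q ^ N" using C[of N] q by (intro mult_right_mono) auto
    finally show ?thesis .
  qed
  moreover have "0 \<le> C" using C[of 0] by simp
  ultimately show thesis using q by (intro that[of C "sqrt q"]) auto
qed

lemma geometric_weighted_sum_tendsto_zero: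
  fixes g :: "nat \<Rightarrow> nat \<Rightarrow> real"
  assumes r: "0 \<le> r" "r < 1" and bounded: "\<And>N i. \<bar>g N i\<bar> \<le> C" and limit: "\<And>i. (\<lambda>N. g N i) \<longlonglongrightarrow> 0"
  shows "(\<lambda>N. \<Sum>i<N. r ^ i * g N i) \<longlonglongrightarrow> 0"
proof -
  let ?a = "\<lambda>i N. if i < N then r ^ i * g N i else 0"
  have "eventually (\<lambda>N. summable (\<lambda>i. norm (?a i N))) sequentially \<and> summable (\<lambda>i. norm (0::real))
    \<and> ((\<lambda>N. \<Sum>i. ?a i N) \<longlongrightarrow> (\<Sum>i. 0)) sequentially"
  proof (rule tannerys_theorem[where M = "\<lambda>i. r ^ i * C"])
    show "(\<lambda>N. ?a i N) \<longlonglongrightarrow> 0" for i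
    proof (rule Lim_transform_eventually[OF tendsto_mult_right_zero[OF limit]])
      show "\<forall>\<^sub>F N in sequentially. r ^ i * g N i = ?a i N"
        using eventually_gt_at_top[of i] by eventually_elim simp
    qed
    show "summable (\<lambda>i. r ^ i * C)" using r by (intro summable_mult2 summable_geometric) auto
    have "norm (?a i N) \<le> r ^ i * C" for i N
      using r bounded[of N i] order_trans[OF abs_ge_zero bounded]
      by (auto simp: abs_mult intro!: mult_left_mono)
    then show "\<forall>\<^sub>F (i, N) in at_top \<times>\<^sub>F sequentially. norm (?a i N) \<le> r ^ i * C"
      by (intro always_eventually) auto
  qed simp
  moreover have "(\<Sum>i. ?a i N) = (\<Sum>i<N. r ^ i * g N i)" for N
    by (subst suminf_finite[of "{..<N}"]) auto
  ultimately show ?thesis by simp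
qed

definition multilevel_sum :: "real \<Rightarrow> nat \<Rightarrow> (nat \<Rightarrow> nat \<Rightarrow> real) \<Rightarrow> nat \<Rightarrow> nat \<Rightarrow> real" where
  "multilevel_sum r b x N k = (\<Sum>m\<in>{1..N}. r ^ (N - m) * x m (k mod b ^ m))"

lemma multilevel_sum_mod: "multilevel_sum r b x N (k mod b ^ N) = multilevel_sum r b x N k"
  unfolding multilevel_sum_def by (intro sum.cong refl) (simp add: mod_mod_cancel le_imp_power_dvd)

lemma multilevel_sum_diff:
  "multilevel_sum r b x N k - multilevel_sum r b y N k
      = multilevel_sum r b (\<lambda>m j. x m j - y m j) N k"
  by (simp add: multilevel_sum_def right_diff_distrib sum_subtractf)

lemma multilevel_sum_scale:
  "c ^ N * multilevel_sum r b x N k = multilevel_sum (c * r) b (\<lambda>m j. c ^ m * x m j) N k"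
proof -
  have "c ^ N * (r ^ (N - m) * y) = (c * r) ^ (N - m) * (c ^ m * y)" if "m \<le> N" for m y
    using that power_add[of c "N - m" m] by (simp add: power_mult_distrib mult_ac)
  then show ?thesis
    unfolding multilevel_sum_def sum_distrib_left by (intro sum.cong refl) simp
qed

lemma (in badic) abs_multilevel_sum_le:
  assumes r: "0 \<le> r" and x: "\<And>m j. j < b ^ m \<Longrightarrow> \<bar>x m j\<bar> \<le> D * s ^ m"
  shows "\<bar>multilevel_sum r b x N k\<bar> \<le> D * (\<Sum>m\<in>{1..N}. r ^ (N - m) * s ^ m)"
proof -
  have "\<bar>multilevel_sum r b x N k\<bar> \<le> (\<Sum>m\<in>{1..N}. r ^ (N - m) * (D * s ^ m))"
    unfolding multilevel_sum_def
    using r x by (intro order_trans[OF sum_abs] sum_mono) (simp add: abs_mult mult_left_mono)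
  then show ?thesis by (simp add: sum_distrib_left mult_ac)
qed

lemma (in badic) multilevel_sum_tendsto_zero_uniformly:
  assumes r: "0 \<le> r" "r < 1" and s: "0 \<le> s" "s < 1" and x: "\<And>m j. j < b ^ m \<Longrightarrow> \<bar>x m j\<bar> \<le> D * s ^ m"
  shows "\<exists>\<epsilon>. \<epsilon> \<longlonglongrightarrow> 0 \<and> (\<forall>N k. \<bar>multilevel_sum r b x N k\<bar> \<le> \<epsilon> N)"
proof -
  obtain C q where C: "0 \<le> C" "0 < q" "q < 1" "\<And>N. (\<Sum>m\<in>{1..N}. r ^ (N - m) * s ^ m) \<le> C * q ^ N"
    using geometric_convolution_bound[OF r s] by blast
  have D: "0 \<le> D" using order_trans[OF abs_ge_zero x[of 0 0]] by simp
  have "\<bar>multilevel_sum r b x N k\<bar> \<le> (D * C) * q ^ N" for N k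
    using abs_multilevel_sum_le[of r x D s N k] r x mult_left_mono[OF C(4)[of N] D]
    by (simp add: mult.assoc)
  moreover have "(\<lambda>N. (D * C) * q ^ N) \<longlonglongrightarrow> 0"
    using C by (intro tendsto_mult_right_zero LIMSEQ_power_zero) auto
  ultimately show ?thesis by blast
qed

definition multilevel_cov :: "real \<Rightarrow> nat \<Rightarrow> real \<Rightarrow> nat \<Rightarrow> nat \<Rightarrow> nat \<Rightarrow> real" where
  "multilevel_cov H b r N k l = (\<Sum>m\<in>{1..N}. \<Sum>n\<in>{1..N}.
     r ^ (N - m) * r ^ (N - n) * badic_corr H b m (k mod b ^ m) n (l mod b ^ n))"

context badic_hurst
begin

lemma badic_mean_abs_multilevel_cov_le:
  assumes r: "0 \<le> r"
  shows "badic_mean b N (\<lambda>k. badic_mean b N (\<lambda>l. \<bar>multilevel_cov H b r N k l\<bar>))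
    \<le> 2 * (\<Sum>m\<in>{1..N}. r ^ (N - m) * decay ^ m)\<^sup>2"
proof -
  let ?g = "\<lambda>m n k l. \<bar>badic_corr H b m (k mod b ^ m) n (l mod b ^ n)\<bar>"
  have mean: "badic_mean b N (\<lambda>k. badic_mean b N (\<lambda>l. ?g m n k l)) \<le> 2 * decay ^ m * decay ^ n"
    if "m \<in> {1..N}" "n \<in> {1..N}" for m n
  proof -
    have "badic_mean b N (\<lambda>k. badic_mean b N (\<lambda>l. ?g m n k l))
        = badic_mean b N (\<lambda>k. badic_mean b n (\<lambda>c. \<bar>badic_corr H b m (k mod b ^ m) n c\<bar>))"
      using that by (subst badic_mean_mod) auto
    also have "\<dots> = badic_mean b m (\<lambda>a. badic_mean b n (\<lambda>c. \<bar>badic_corr H b m a n c\<bar>))"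
      using that badic_mean_mod[of m N "\<lambda>a. badic_mean b n (\<lambda>c. \<bar>badic_corr H b m a n c\<bar>)"] by simp
    finally show ?thesis using badic_mean_abs_corr_le by simp
  qed
  have "badic_mean b N (\<lambda>k. badic_mean b N (\<lambda>l. \<bar>multilevel_cov H b r N k l\<bar>))
      \<le> badic_mean b N (\<lambda>k. badic_mean b N
          (\<lambda>l. \<Sum>m\<in>{1..N}. \<Sum>n\<in>{1..N}. r ^ (N - m) * r ^ (N - n) * ?g m n k l))"
    unfolding multilevel_cov_def using r
    by (intro badic_average_mono order_trans[OF sum_abs] sum_mono) (auto simp: abs_mult)
  also have "\<dots> = (\<Sum>m\<in>{1..N}. \<Sum>n\<in>{1..N}. r ^ (N - m) * r ^ (N - n)
      * badic_mean b N (\<lambda>k. badic_mean b N (\<lambda>l. ?g m n k l)))"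
    unfolding badic_average_sum badic_average_cmult ..
  also have "\<dots> \<le> (\<Sum>m\<in>{1..N}. \<Sum>n\<in>{1..N}. r ^ (N - m) * r ^ (N - n) * (2 * decay ^ m * decay ^ n))"
    using r by (intro sum_mono mult_left_mono mean) auto
  also have "\<dots> = 2 * (\<Sum>m\<in>{1..N}. r ^ (N - m) * decay ^ m)\<^sup>2"
    by (simp add: power2_eq_square sum_product sum_distrib_left mult_ac)
  finally show ?thesis .
qed

lemma summable_badic_mean_abs_multilevel_cov:
  assumes r: "0 \<le> r" "r < 1"
  shows "summable (\<lambda>N. badic_mean b N (\<lambda>k. badic_mean b N (\<lambda>l. \<bar>multilevel_cov H b r N k l\<bar>)))"
proof -
  obtain C q where C: "0 \<le> C" "0 < q" "q < 1" "\<And>N. (\<Sum>m\<in>{1..N}. r ^ (N - m) * decay ^ m) \<le> C * q ^ N"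
    using geometric_convolution_bound[OF r, of decay] decay_bounds by auto
  have bound: "badic_mean b N (\<lambda>k. badic_mean b N (\<lambda>l. \<bar>multilevel_cov H b r N k l\<bar>))
      \<le> 2 * C\<^sup>2 * (q\<^sup>2) ^ N" for N
  proof -
    have "(\<Sum>m\<in>{1..N}. r ^ (N - m) * decay ^ m)\<^sup>2 \<le> (C * q ^ N)\<^sup>2"
      using C(4)[of N] r decay_bounds by (intro power_mono sum_nonneg) auto
    also have "\<dots> = C\<^sup>2 * (q\<^sup>2) ^ N"
      by (simp add: power_mult_distrib mult.commute flip: power_mult)
    finally show ?thesis using badic_mean_abs_multilevel_cov_le[OF r(1), of N] by simp
  qed
  show ?thesis
  proof (rule summable_comparison_test')
    show "summable (\<lambda>N. 2 * C\<^sup>2 * (q\<^sup>2) ^ N)"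
      using C by (intro summable_mult summable_geometric)
        (auto simp: power_less_one_iff abs_square_less_1)
    show "norm (badic_mean b N (\<lambda>k. badic_mean b N (\<lambda>l. \<bar>multilevel_cov H b r N k l\<bar>)))
        \<le> 2 * C\<^sup>2 * (q\<^sup>2) ^ N"
      if "0 \<le> N" for N
      unfolding real_norm_def using bound[of N]
      by (subst abs_of_nonneg) (auto intro!: badic_average_nonneg)
  qed
qed

definition level_dependence :: "nat \<Rightarrow> nat \<Rightarrow> nat \<Rightarrow> real" where
  "level_dependence N i j = (if i = j then 0 else
     badic_mean b N (\<lambda>k. \<bar>badic_corr H b (N - i) (k mod b ^ (N - i)) (N - j) (k mod b ^ (N - j))\<bar>))"

lemma level_dependence_commute: "level_dependence N i j = level_dependence N j i"
  by (simp add: level_dependence_def badic_corr_commute[of H b "N - i"])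

lemma level_dependence_tendsto: "(\<lambda>N. level_dependence N i j) \<longlonglongrightarrow> 0"
proof (induction i j rule: linorder_wlog)
  case (le i j)
  show ?case
  proof (cases "i = j")
    case False
    let ?d = "j - i"
    have "(\<lambda>N. badic_mean b (N + ?d) (\<lambda>k. \<bar>badic_corr H b (N + ?d) k N (k mod b ^ N)\<bar>)) \<longlonglongrightarrow> 0"
      using le False by (intro badic_mean_abs_corr_mod_tendsto) auto
    moreover have "level_dependence (N + j) i j
        = badic_mean b (N + ?d) (\<lambda>k. \<bar>badic_corr H b (N + ?d) k N (k mod b ^ N)\<bar>)" for N
    proof -
      have levels: "N + j - i = N + ?d" "N + j - j = N" using le by auto
      have "k mod b ^ (N + ?d) mod b ^ N = k mod b ^ N" for k
        by (simp add: mod_mod_cancel le_imp_power_dvd)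
      then show ?thesis
        unfolding level_dependence_def levels using False le
          badic_mean_mod[of "N + ?d" "N + j" "\<lambda>k. \<bar>badic_corr H b (N + ?d) k N (k mod b ^ N)\<bar>"]
        by simp
    qed
    ultimately have "(\<lambda>N. level_dependence (N + j) i j) \<longlonglongrightarrow> 0" by simp
    then show ?thesis by (rule LIMSEQ_offset)
  qed (simp add: level_dependence_def)
next
  case (sym i j)
  then show ?case by (simp add: level_dependence_commute[of _ i j])
qed

lemma badic_mean_multilevel_variance_deviation_le:
  assumes r: "0 \<le> r"
  shows "badic_mean b N (\<lambda>k. \<bar>multilevel_cov H b r N k k - v\<bar>)
    \<le> \<bar>(\<Sum>i<N. (r\<^sup>2) ^ i) - v\<bar> + (\<Sum>i<N. r ^ i * (\<Sum>j<N. r ^ j * level_dependence N i j))"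
proof -
  let ?g = "\<lambda>i j k. badic_corr H b (N - i) (k mod b ^ (N - i)) (N - j) (k mod b ^ (N - j))"
  let ?off = "\<lambda>i j k. if i = j then 0 else r ^ i * r ^ j * ?g i j k"
  have "\<bar>multilevel_cov H b r N k k - v\<bar> \<le> \<bar>(\<Sum>i<N. (r\<^sup>2) ^ i) - v\<bar> + (\<Sum>i<N. \<Sum>j<N. \<bar>?off i j k\<bar>)"
    for k
  proof -
    have "multilevel_cov H b r N k k = (\<Sum>i<N. \<Sum>j<N. r ^ i * r ^ j * ?g i j k)"
      unfolding multilevel_cov_def sum_atLeast1_atMost_rev by (intro sum.cong refl) auto
    also have "\<dots> = (\<Sum>i<N. \<Sum>j<N. (if i = j then (r\<^sup>2) ^ i else 0) + ?off i j k)"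
      by (intro sum.cong refl) (auto simp: power2_eq_square power_mult_distrib)
    also have "\<dots> = (\<Sum>i<N. (r\<^sup>2) ^ i) + (\<Sum>i<N. \<Sum>j<N. ?off i j k)"
      by (simp add: sum.distrib)
    finally have "\<bar>multilevel_cov H b r N k k - v\<bar>
        \<le> \<bar>(\<Sum>i<N. (r\<^sup>2) ^ i) - v\<bar> + \<bar>\<Sum>i<N. \<Sum>j<N. ?off i j k\<bar>"
      by linarith
    also have "\<bar>\<Sum>i<N. \<Sum>j<N. ?off i j k\<bar> \<le> (\<Sum>i<N. \<Sum>j<N. \<bar>?off i j k\<bar>)"
      by (intro order_trans[OF sum_abs] sum_mono sum_abs)
    finally show ?thesis by simp
  qed
  then have "badic_mean b N (\<lambda>k. \<bar>multilevel_cov H b r N k k - v\<bar>)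
      \<le> badic_mean b N (\<lambda>k. \<bar>(\<Sum>i<N. (r\<^sup>2) ^ i) - v\<bar> + (\<Sum>i<N. \<Sum>j<N. \<bar>?off i j k\<bar>))"
    by (intro badic_average_mono)
  also have "\<dots> = \<bar>(\<Sum>i<N. (r\<^sup>2) ^ i) - v\<bar> + (\<Sum>i<N. \<Sum>j<N. badic_mean b N (\<lambda>k. \<bar>?off i j k\<bar>))"
    by (simp add: badic_average_add badic_average_sum)
  also have "(\<Sum>i<N. \<Sum>j<N. badic_mean b N (\<lambda>k. \<bar>?off i j k\<bar>))
      = (\<Sum>i<N. r ^ i * (\<Sum>j<N. r ^ j * level_dependence N i j))"
    unfolding sum_distrib_left using r
    by (intro sum.cong refl)
      (auto simp: level_dependence_def abs_mult badic_average_cmult mult.assoc)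
  finally show ?thesis .
qed

end

section \<open>Fractional Brownian motion along b-adic partitions\<close>

definition badic_incr :: "(real \<Rightarrow> real) \<Rightarrow> nat \<Rightarrow> nat \<Rightarrow> nat \<Rightarrow> real" where
  "badic_incr f b m j = f (real (j + 1) / real b ^ m) - f (real j / real b ^ m)"

locale fbm = badic_hurst b H + prob_space M for b :: nat and H :: real and M :: "'a measure" +
  fixes W :: "real \<Rightarrow> 'a \<Rightarrow> real"
  assumes is_fbm: "is_fbm M H W"
begin

lemma fbm_measurable: "0 \<le> t \<Longrightarrow> W t \<in> borel_measurable M"
  using is_fbm by (simp add: is_fbm_def)

lemma fbm_family: "gaussian_family M {0..} W (fbm_cov H)"
proof unfold_locales
  show "fbm_cov H s t = fbm_cov H t s" for s t
    by (simp add: fbm_cov_def abs_minus_commute)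
next
  fix n :: nat and t c :: "nat \<Rightarrow> real" assume t: "\<And>k. k < n \<Longrightarrow> t k \<in> {0..}"
  have char: "\<forall>(n::nat) ts c. (\<forall>i<n. ts i \<ge> 0) \<longrightarrow> (\<integral>\<omega>. cis (\<Sum>i<n. c i * W (ts i) \<omega>) \<partial>M)
      = complex_of_real (exp (- (\<Sum>i<n. \<Sum>j<n. c i * c j * fbm_cov H (ts i) (ts j)) / 2))"
    using is_fbm unfolding is_fbm_def by (elim conjE)
  show "centred_gaussian M (\<lambda>\<omega>. \<Sum>k<n. c k * W (t k) \<omega>)
      (\<Sum>k<n. \<Sum>l<n. c k * c l * fbm_cov H (t k) (t l))"
    unfolding centred_gaussian_def
  proof (intro conjI allI)
    show "(\<lambda>\<omega>. \<Sum>k<n. c k * W (t k) \<omega>) \<in> borel_measurable M"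
      using t by (intro borel_measurable_sum borel_measurable_times fbm_measurable) auto
    show "(\<integral>\<omega>. cis (u * (\<Sum>k<n. c k * W (t k) \<omega>)) \<partial>M)
        = complex_of_real
          (exp (- (u\<^sup>2 * (\<Sum>k<n. \<Sum>l<n. c k * c l * fbm_cov H (t k) (t l))) / 2))" for u
      using char[rule_format, of n t "\<lambda>k. u * c k"] t
      by (simp add: sum_distrib_left power2_eq_square mult_ac)
  qed
qed

lemma fbm_increment_family:
  "gaussian_family M {(s, t). 0 \<le> s \<and> 0 \<le> t} (\<lambda>(s, t) \<omega>. W t \<omega> - W s \<omega>)
      (\<lambda>(s, t) (u, v). increment_cov H s t u v)"
proof -
  interpret gaussian_family M "{0..}" W "fbm_cov H" by (rule fbm_family)
  have "gaussian_family M {(s, t). 0 \<le> s \<and> 0 \<le> t}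
      (\<lambda>j \<omega>. \<Sum>e\<in>UNIV. (if e then 1 else - 1) * W (if e then snd j else fst j) \<omega>)
      (\<lambda>i j. \<Sum>e\<in>UNIV. \<Sum>e'\<in>UNIV. (if e then 1 else - 1) * (if e' then 1 else - 1) *
        fbm_cov H (if e then snd i else fst i) (if e' then snd j else fst j))"
    by (intro linear_combinations) auto
  then show ?thesis
    by (simp add: UNIV_bool case_prod_unfold increment_cov_eq algebra_simps)
qed

definition standard_incr :: "nat \<Rightarrow> nat \<Rightarrow> 'a \<Rightarrow> real" where
  "standard_incr m j \<omega> = \<beta> ^ m * badic_incr (\<lambda>t. W t \<omega>) b m j"

lemma standard_incr_family:
  "gaussian_family M UNIV (\<lambda>(m, j). standard_incr m j) (\<lambda>(m, a) (n, c). badic_corr H b m a n c)"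
proof -
  interpret gaussian_family M "{(s, t). 0 \<le> s \<and> 0 \<le> t}"
      "\<lambda>(s, t) \<omega>. W t \<omega> - W s \<omega>" "\<lambda>(s, t) (u, v). increment_cov H s t u v"
    by (rule fbm_increment_family)
  let ?h = "\<lambda>(m, j) _. (real j / real b ^ m, real (j + 1) / real b ^ m)"
  have "gaussian_family M UNIV (\<lambda>x \<omega>. \<Sum>u\<in>{()}. \<beta> ^ fst x * (case ?h x u of (s, t) \<Rightarrow> W t \<omega> - W s \<omega>))
      (\<lambda>x y. \<Sum>u\<in>{()}. \<Sum>u'\<in>{()}. \<beta> ^ fst x * \<beta> ^ fst y *
        (case ?h x u of (s, t) \<Rightarrow> \<lambda>(u, v). increment_cov H s t u v) (?h y u'))"
    using linear_combinations[of "{()}" UNIV ?h "\<lambda>x _. \<beta> ^ fst x"] by (auto simp: case_prod_unfold)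
  moreover have "(\<lambda>x \<omega>. \<Sum>u\<in>{()}. \<beta> ^ fst x * (case ?h x u of (s, t) \<Rightarrow> W t \<omega> - W s \<omega>))
      = (\<lambda>(m, j). standard_incr m j)"
    by (auto simp: fun_eq_iff standard_incr_def badic_incr_def)
  ultimately show ?thesis
    by (simp add: badic_corr_def badic_cov_def case_prod_unfold)
qed

lemma abs_badic_corr_le_1: "\<bar>badic_corr H b m a n c\<bar> \<le> 1"
  using gaussian_family.abs_covariance_le[OF standard_incr_family, of "(m, a)" "(n, c)"] by simp

lemma standard_incr_gaussian: "centred_gaussian M (standard_incr m j) 1"
  using gaussian_family.gaussian_component[OF standard_incr_family, of "(m, j)"] by simp

lemma multilevel_family:
  "gaussian_family M UNIV (\<lambda>k \<omega>. multilevel_sum r b (\<lambda>m j. standard_incr m j \<omega>) N k)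
      (multilevel_cov H b r N)"
proof -
  interpret gaussian_family M UNIV "\<lambda>(m, j). standard_incr m j"
      "\<lambda>(m, a) (n, c). badic_corr H b m a n c"
    by (rule standard_incr_family)
  show ?thesis
    using linear_combinations[of "{1..N}" UNIV "\<lambda>k m. (m, k mod b ^ m)" "\<lambda>k m. r ^ (N - m)"]
    by (simp add: multilevel_sum_def multilevel_cov_def[abs_def])
qed

lemma level_dependence_le_1: "\<bar>level_dependence N i j\<bar> \<le> 1"
proof -
  have "level_dependence N i j \<le> 1"
    unfolding level_dependence_def by (auto intro!: badic_average_le_const abs_badic_corr_le_1)
  moreover have "0 \<le> level_dependence N i j"
    by (simp add: level_dependence_def badic_average_nonneg)
  ultimately show ?thesis by simp
qed

lemma multilevel_variance_tendsto:
  assumes r: "0 \<le> r" "r < 1"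
  shows "(\<lambda>N. badic_mean b N (\<lambda>k. \<bar>multilevel_cov H b r N k k - 1 / (1 - r\<^sup>2)\<bar>)) \<longlonglongrightarrow> 0"
proof (rule tendsto_sandwich[OF _ _ tendsto_const])
  have "(\<lambda>N. \<Sum>i<N. (r\<^sup>2) ^ i) \<longlonglongrightarrow> 1 / (1 - r\<^sup>2)"
    using geometric_sums[of "r\<^sup>2"] r by (simp add: sums_def power_less_one_iff abs_square_less_1)
  then have diagonal: "(\<lambda>N. \<bar>(\<Sum>i<N. (r\<^sup>2) ^ i) - 1 / (1 - r\<^sup>2)\<bar>) \<longlonglongrightarrow> 0"
    by (simp add: LIM_zero_iff tendsto_rabs_zero_iff)
  have offdiagonal: "(\<lambda>N. \<Sum>i<N. r ^ i * (\<Sum>j<N. r ^ j * level_dependence N i j)) \<longlonglongrightarrow> 0"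
  proof (rule geometric_weighted_sum_tendsto_zero[OF r])
    show "(\<lambda>N. \<Sum>j<N. r ^ j * level_dependence N i j) \<longlonglongrightarrow> 0" for i
      by (rule geometric_weighted_sum_tendsto_zero[OF r level_dependence_le_1 level_dependence_tendsto])
    show "\<bar>\<Sum>j<N. r ^ j * level_dependence N i j\<bar> \<le> 1 / (1 - r)" for N i
    proof -
      have "\<bar>\<Sum>j<N. r ^ j * level_dependence N i j\<bar> \<le> (\<Sum>j<N. r ^ j)"
        using r level_dependence_le_1
        by (intro order_trans[OF sum_abs] sum_mono) (simp add: abs_mult mult_left_le)
      also have "\<dots> \<le> 1 / (1 - r)" using r by (intro sum_power_le_geometric) auto
      finally show ?thesis .
    qed
  qed
  show "(\<lambda>N. \<bar>(\<Sum>i<N. (r\<^sup>2) ^ i) - 1 / (1 - r\<^sup>2)\<bar>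
      + (\<Sum>i<N. r ^ i * (\<Sum>j<N. r ^ j * level_dependence N i j))) \<longlonglongrightarrow> 0"
    using tendsto_add[OF diagonal offdiagonal] by simp
qed (auto intro!: always_eventually badic_average_nonneg
    badic_mean_multilevel_variance_deviation_le r)

lemma multilevel_variance_le:
  assumes r: "0 \<le> r" "r < 1"
  shows "multilevel_cov H b r N k k \<le> (1 / (1 - r))\<^sup>2"
proof -
  have "multilevel_cov H b r N k k \<le> (\<Sum>m\<in>{1..N}. \<Sum>n\<in>{1..N}. r ^ (N - m) * r ^ (N - n) * 1)"
    unfolding multilevel_cov_def using r abs_badic_corr_le_1
    by (intro sum_mono mult_left_mono) (auto simp: abs_le_iff)
  also have "\<dots> = (\<Sum>m\<in>{1..N}. r ^ (N - m))\<^sup>2" by (simp add: power2_eq_square sum_product)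
  also have "(\<Sum>m\<in>{1..N}. r ^ (N - m)) = (\<Sum>i<N. r ^ i)"
    unfolding sum_atLeast1_atMost_rev by (intro sum.cong) auto
  also have "(\<Sum>i<N. r ^ i)\<^sup>2 \<le> (1 / (1 - r))\<^sup>2"
    using r by (intro power_mono sum_power_le_geometric sum_nonneg) auto
  finally show ?thesis .
qed

lemma multilevel_gaussian_array:
  assumes r: "0 \<le> r" "r < 1"
  shows "gaussian_array b M (\<lambda>N k \<omega>. multilevel_sum r b (\<lambda>m j. standard_incr m j \<omega>) N k)
      (multilevel_cov H b r)
    (1 / (1 - r\<^sup>2)) ((1 / (1 - r))\<^sup>2)"
proof (intro gaussian_array.intro gaussian_array_axioms.intro badic_axioms prob_space_axioms)
  show "gaussian_family M UNIV (\<lambda>k \<omega>. multilevel_sum r b (\<lambda>m j. standard_incr m j \<omega>) N k)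
      (multilevel_cov H b r N)" for N
    by (rule multilevel_family)
  show "0 \<le> 1 / (1 - r\<^sup>2)"
    using r by (simp add: power_le_one)
qed (intro summable_badic_mean_abs_multilevel_cov
    multilevel_variance_le multilevel_variance_tendsto r)+

lemma AE_cosh_standard_incr_bound:
  "AE \<omega> in M. \<exists>K>0. \<forall>m j. j < b ^ m \<longrightarrow> cosh (standard_incr m j \<omega>) \<le> K * real b ^ (2 * m)"
proof -
  let ?S = "\<lambda>m \<omega>. (\<Sum>j<b ^ m. cosh (standard_incr m j \<omega>)) / real b ^ (2 * m)"
  have moment: "has_bochner_integral M (?S m) (exp (1 / 2) * (1 / real b) ^ m)" for m
  proof -
    have "has_bochner_integral M (?S m) ((\<Sum>j<b ^ m. exp (1 / 2)) / real b ^ (2 * m))"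
      by (intro has_bochner_integral_divide_zero has_bochner_integral_sum
          centred_gaussian_has_cosh_moment standard_incr_gaussian)
    also have "(\<Sum>j<b ^ m. exp (1 / 2)) / real b ^ (2 * m) = exp (1 / 2) * (1 / real b) ^ m"
      by (simp add: mult_2 power_add power_divide)
    finally show ?thesis .
  qed
  have "AE \<omega> in M. (\<lambda>m. ?S m \<omega>) \<longlonglongrightarrow> 0"
  proof (rule AE_tendsto_zero_of_summable_integrals)
    show "summable (\<lambda>m. \<integral>\<omega>. ?S m \<omega> \<partial>M)"
      unfolding has_bochner_integral_integral_eq[OF moment] using base_gt_1
      by (intro summable_mult summable_geometric) auto
    show "integrable M (?S m)" for m using moment by (simp add: has_bochner_integral_iff)
    show "0 \<le> ?S m \<omega>" for m \<omega>
      by (intro divide_nonneg_nonneg sum_nonneg) (auto simp: less_imp_le cosh_real_pos)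
  qed
  then show ?thesis
  proof eventually_elim
    case (elim \<omega>)
    then have "Bseq (\<lambda>m. ?S m \<omega>)" by (intro convergent_imp_Bseq convergentI)
    then obtain K where K: "0 < K" "\<And>m. \<bar>?S m \<omega>\<bar> \<le> K" unfolding Bseq_def real_norm_def by blast
    have "cosh (standard_incr m j \<omega>) \<le> K * real b ^ (2 * m)" if "j < b ^ m" for m j
    proof -
      have "cosh (standard_incr m j \<omega>) \<le> (\<Sum>j<b ^ m. cosh (standard_incr m j \<omega>))"
        using that by (intro member_le_sum) (auto simp: less_imp_le cosh_real_pos)
      also have "\<dots> = ?S m \<omega> * real b ^ (2 * m)" by simp
      also have "\<dots> \<le> K * real b ^ (2 * m)"
        using abs_le_D1[OF K(2)[of m]] by (intro mult_right_mono) auto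
      finally show ?thesis .
    qed
    then show ?case using K(1) by blast
  qed
qed

lemma AE_badic_incr_bound:
  assumes h: "h < H"
  shows "AE \<omega> in M. \<exists>D. \<forall>m j. j < b ^ m
      \<longrightarrow> \<bar>badic_incr (\<lambda>t. W t \<omega>) b m j\<bar> \<le> D * (real b powr - h) ^ m"
  using AE_cosh_standard_incr_bound
proof eventually_elim
  case (elim \<omega>)
  then obtain K where K: "0 < K" "\<And>m j. j < b ^ m
      \<Longrightarrow> cosh (standard_incr m j \<omega>) \<le> K * real b ^ (2 * m)"
    by blast
  define q where "q = 2 / (H - h)"
  have q: "0 < q" using h by (simp add: q_def)
  define C where "C = 2 * q powr q * K"
  have growth: "(real b ^ (2 * m)) powr (1 / q) = (real b powr - h) ^ m * \<beta> ^ m" for m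
  proof -
    have "(real b ^ (2 * m)) powr (1 / q) = real b powr (real (2 * m) * (1 / q))"
      by (simp add: powr_powr flip: powr_realpow)
    also have "real (2 * m) * (1 / q) = real m * (- h + H)" using h by (simp add: q_def field_simps)
    also have "real b powr \<dots> = (real b powr (- h + H)) ^ m"
      by (simp add: powr_powr mult.commute flip: powr_realpow)
    finally show ?thesis by (simp only: powr_add power_mult_distrib)
  qed
  have "\<bar>badic_incr (\<lambda>t. W t \<omega>) b m j\<bar> \<le> C powr (1 / q) * (real b powr - h) ^ m" if j: "j < b ^ m"
    for m j
  proof -
    have "\<bar>standard_incr m j \<omega>\<bar> powr q \<le> 2 * q powr q * (K * real b ^ (2 * m))"
      by (intro order_trans[OF abs_powr_le_cosh[OF q]] mult_left_mono K(2) j) simp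
    then have "(\<bar>standard_incr m j \<omega>\<bar> powr q) powr (1 / q) \<le> (C * real b ^ (2 * m)) powr (1 / q)"
      using q by (intro powr_mono2) (auto simp: C_def mult_ac)
    then have "\<bar>standard_incr m j \<omega>\<bar> \<le> C powr (1 / q) * ((real b powr - h) ^ m * \<beta> ^ m)"
      using q K(1) by (simp add: powr_powr powr_mult C_def growth)
    then show ?thesis
      using base_powr_gt_1 by (simp add: standard_incr_def abs_mult)
  qed
  then show ?case by blast
qed

lemma AE_fbm_zero: "AE \<omega> in M. W 0 \<omega> = 0"
proof -
  interpret gaussian_family M "{0..}" W "fbm_cov H" by (rule fbm_family)
  have "centred_gaussian M (W 0) 0"
    using gaussian_component[of 0] by (simp add: fbm_cov_def)
  then have "has_bochner_integral M (\<lambda>\<omega>. cosh (W 0 \<omega>) - 1) (1 - 1)"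
    by (intro has_bochner_integral_diff)
      (auto dest: centred_gaussian_has_cosh_moment simp: has_bochner_integral_iff prob_space)
  then have "AE \<omega> in M. cosh (W 0 \<omega>) - 1 = 0"
    by (subst integral_nonneg_eq_0_iff_AE[symmetric])
      (auto simp: cosh_real_ge_1 has_bochner_integral_iff)
  then show ?thesis by eventually_elim (simp add: cosh_real_one_iff)
qed

end

section \<open>Weierstrass series at b-adic points\<close>

definition weierstrass :: "real \<Rightarrow> nat \<Rightarrow> (real \<Rightarrow> real) \<Rightarrow> real \<Rightarrow> real" where
  "weierstrass \<alpha> b f t = (\<Sum>n. \<alpha> ^ n * f (frac (real b ^ n * t)))"

lemma pvar_sum_eq: "pvar_sum f b p t N = (\<Sum>k<badic_count b t N. \<bar>badic_incr f b N k\<bar> powr p)"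
  by (simp add: pvar_sum_def badic_count_def badic_incr_def)

lemma frac_of_nat_divide:
  assumes "0 < q"
  shows "frac (real k / real q) = real (k mod q) / real q"
proof -
  have "real k = real (k div q) * real q + real (k mod q)"
    by (metis div_mult_mod_eq of_nat_add of_nat_mult)
  then have "real k / real q - real (k mod q) / real q = real (k div q)"
    using assms by (simp add: field_simps)
  then show ?thesis using assms by (subst frac_unique_iff) auto
qed

context badic
begin

lemma weierstrass_badic:
  assumes "f 0 = 0"
  shows "weierstrass \<alpha> b f (real k / real b ^ N)
      = (\<Sum>m\<in>{1..N}. \<alpha> ^ (N - m) * f (real (k mod b ^ m) / real b ^ m))"
proof -
  have "\<alpha> ^ i * f (frac (real b ^ i * (real k / real b ^ N))) = 0" if "i \<notin> {..<N}" for i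
  proof -
    have "real b ^ i = real b ^ (i - N) * real b ^ N" using that by (simp flip: power_add)
    then have "real b ^ i * (real k / real b ^ N) = real (b ^ (i - N) * k)" by simp
    then have "frac (real b ^ i * (real k / real b ^ N)) = 0"
        by (simp only: frac_eq_0_iff Ints_of_nat)
    then show ?thesis by (simp only: assms mult_zero_right)
  qed
  then have "weierstrass \<alpha> b f (real k / real b ^ N)
      = (\<Sum>i<N. \<alpha> ^ i * f (frac (real b ^ i * (real k / real b ^ N))))"
    unfolding weierstrass_def by (intro suminf_finite) auto
  also have "\<dots> = (\<Sum>i<N. \<alpha> ^ (N - (N - i)) * f (real (k mod b ^ (N - i)) / real b ^ (N - i)))"
  proof (intro sum.cong refl)
    fix i assume i: "i \<in> {..<N}"
    then have "real b ^ N = real b ^ i * real b ^ (N - i)" by (simp flip: power_add)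
    then have "real b ^ i * (real k / real b ^ N) = real k / real (b ^ (N - i))" by simp
    then have "frac (real b ^ i * (real k / real b ^ N))
        = real (k mod b ^ (N - i)) / real b ^ (N - i)"
      using frac_of_nat_divide[of "b ^ (N - i)" k] by simp
    then show "\<alpha> ^ i * f (frac (real b ^ i * (real k / real b ^ N)))
        = \<alpha> ^ (N - (N - i)) * f (real (k mod b ^ (N - i)) / real b ^ (N - i))"
      using i by simp
  qed
  finally show ?thesis unfolding sum_atLeast1_atMost_rev .
qed

lemma badic_incr_weierstrass:
  assumes f: "f 0 = 0" "f 1 = 0"
  shows "badic_incr (weierstrass \<alpha> b f) b N k = multilevel_sum \<alpha> b (badic_incr f b) N k"
proof -
  have "f (real ((k + 1) mod n) / real n) = f (real (k mod n + 1) / real n)" if "0 < n" for n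
    using that f by (cases "k mod n + 1 = n") (auto simp: mod_Suc)
  from this[of "b ^ m" for m]
  have "f (real ((k + 1) mod b ^ m) / real b ^ m) = f (real (k mod b ^ m + 1) / real b ^ m)" for m
    by simp
  then show ?thesis
    unfolding badic_incr_def multilevel_sum_def weierstrass_badic[of f, OF f(1)]
    by (simp only: sum_subtractf right_diff_distrib)
qed

lemma pvar_sum_weierstrass:
  assumes f: "f 0 = 0" "f 1 = 0" and c: "0 < c" "c powr p = real b"
  shows "pvar_sum (weierstrass \<alpha> b f) b p t N
    = badic_average b t N
        (\<lambda>k. \<bar>multilevel_sum (c * \<alpha>) b (\<lambda>m j. c ^ m * badic_incr f b m j) N k\<bar> powr p)"
proof -
  have "(c ^ N) powr p = (c powr p) powr real N"
    using c(1) by (simp add: powr_powr mult.commute flip: powr_realpow)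
  then have "(c ^ N) powr p = real b ^ N"
    by (simp add: c(2) powr_realpow)
  then have "\<bar>multilevel_sum (c * \<alpha>) b (\<lambda>m j. c ^ m * badic_incr f b m j) N k\<bar> powr p
      = real b ^ N * \<bar>multilevel_sum \<alpha> b (badic_incr f b) N k\<bar> powr p" for k
    using c(1) by (simp add: abs_mult powr_mult flip: multilevel_sum_scale)
  then show ?thesis
    unfolding pvar_sum_eq badic_incr_weierstrass[of f, OF f]
    by (simp add: badic_average_cmult) (simp add: badic_average_def)
qed

end

locale summable_levels = badic +
  fixes x :: "nat \<Rightarrow> nat \<Rightarrow> real" and D q :: real
  assumes ratio: "0 \<le> q" "q < 1" and level_bound: "\<And>m j. j < b ^ m \<Longrightarrow> \<bar>x m j\<bar> \<le> D * q ^ m"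
begin

abbreviation Z :: "nat \<Rightarrow> nat \<Rightarrow> real" where
  "Z \<equiv> multilevel_sum 1 b x"

definition tail :: "nat \<Rightarrow> real" where
  "tail M = D / (1 - q) * q ^ M"

lemma tail_tendsto: "tail \<longlonglongrightarrow> 0"
  unfolding tail_def[abs_def] using ratio by (intro tendsto_mult_right_zero LIMSEQ_power_zero) auto

lemma abs_partial_sum_diff_le:
  assumes "M \<le> N"
  shows "\<bar>Z N k - Z M k\<bar> \<le> tail M"
proof -
  have D: "0 \<le> D" using order_trans[OF abs_ge_zero level_bound[of 0 0]] by simp
  have "Z N k = Z M k + (\<Sum>m\<in>{Suc M..N}. x m (k mod b ^ m))"
    using sum.ub_add_nat[of 1 M "\<lambda>m. x m (k mod b ^ m)" "N - M"] assms
    by (simp add: multilevel_sum_def)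
  then have "\<bar>Z N k - Z M k\<bar> \<le> (\<Sum>m\<in>{Suc M..N}. D * q ^ m)"
    using level_bound by (auto intro!: order_trans[OF sum_abs] sum_mono)
  also have "\<dots> = D * (q ^ M * (\<Sum>m\<in>{1..N - M}. q ^ m))"
    unfolding sum_distrib_left power_add[symmetric]
    by (rule sum.reindex_bij_witness[where i = "\<lambda>m. M + m" and j = "\<lambda>m. m - M"]) auto
  also have "\<dots> \<le> D * (q ^ M * (1 / (1 - q)))"
    using D ratio by (intro mult_left_mono sum_power_le_geometric) auto
  finally show ?thesis by (simp add: tail_def)
qed

lemma abs_partial_sum_le: "\<bar>Z N k\<bar> \<le> tail 0"
  using abs_partial_sum_diff_le[of 0 N k] by (simp add: multilevel_sum_def)

lemma average_tendsto:
  assumes F: "continuous_on UNIV F"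
  shows "\<exists>V. \<forall>t\<in>{0..1}. (\<lambda>N. badic_average b t N (\<lambda>k. F (Z N k))) \<longlonglongrightarrow> t * V"
proof (rule badic_average_uniform_limit)
  show "F (Z N (k mod b ^ N)) = F (Z N k)" for N k by (simp add: multilevel_sum_mod)
  fix e :: real assume "0 < e"
  have "uniformly_continuous_on {- tail 0..tail 0} F"
    by (intro compact_uniformly_continuous continuous_on_subset[OF F]) auto
  then obtain d where d: "0 < d" "\<And>y z. y \<in> {- tail 0..tail 0} \<Longrightarrow> z \<in> {- tail 0..tail 0} \<Longrightarrow>
      dist z y < d \<Longrightarrow> dist (F z) (F y) < e"
    using \<open>0 < e\<close> unfolding uniformly_continuous_on_def by metis
  obtain M where M: "tail M < d"
    using order_tendstoD(2)[OF tail_tendsto d(1)] by (auto dest: eventually_happens)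
  have "\<bar>F (Z N k) - F (Z M k)\<bar> \<le> e" if "M \<le> N" for N k
    using d(2)[of "Z M k" "Z N k"] abs_partial_sum_le[of N k] abs_partial_sum_le[of M k]
      abs_partial_sum_diff_le[OF that, of k] M
    by (auto simp: dist_real_def abs_le_iff)
  then show "\<exists>M. \<forall>N\<ge>M. \<forall>k. \<bar>F (Z N k) - F (Z M k)\<bar> \<le> e" by blast
qed

lemma convergent_partial_sums: "convergent (\<lambda>N. Z N k)"
proof (intro Cauchy_convergent metric_CauchyI)
  fix e :: real assume "0 < e"
  then obtain M where M: "tail M < e / 2"
    using order_tendstoD(2)[OF tail_tendsto, of "e / 2"] by (auto dest: eventually_happens)
  have "dist (Z m k) (Z n k) < e" if "M \<le> m" "M \<le> n" for m n
    using abs_partial_sum_diff_le[OF that(1), of k] abs_partial_sum_diff_le[OF that(2), of k] M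
    unfolding dist_real_def by linarith
  then show "\<exists>M. \<forall>m\<ge>M. \<forall>n\<ge>M. dist (Z m k) (Z n k) < e" by blast
qed

(* The partial sums at indices divisible by b^M, which have frequency b^-M, are close to those at index 0. *)
lemma average_limit_pos:
  assumes F: "isCont F z" "\<And>y. 0 \<le> F y" "0 < F z" and z: "(\<lambda>N. Z N 0) \<longlonglongrightarrow> z"
    and V: "(\<lambda>N. badic_mean b N (\<lambda>k. F (Z N k))) \<longlonglongrightarrow> V"
  shows "0 < V"
proof -
  have "\<forall>\<^sub>F y in nhds z. F z / 2 < F y"
    using F(1,3) by (intro order_tendstoD(1)[of F "F z"])
      (simp_all add: isCont_def tendsto_at_iff_tendsto_nhds)
  then obtain d where d: "0 < d" "\<And>y. dist y z < d \<Longrightarrow> F z / 2 < F y"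
    by (auto simp: eventually_nhds_metric)
  have "\<forall>\<^sub>F M in sequentially. tail M < d / 2"
    using d(1) by (intro order_tendstoD(2)[OF tail_tendsto]) simp
  moreover have "\<forall>\<^sub>F M in sequentially. dist (Z M 0) z < d / 2"
    using d(1) by (intro tendstoD[OF z]) simp
  ultimately obtain M where M: "tail M < d / 2" "dist (Z M 0) z < d / 2"
    by (auto dest: eventually_happens[OF eventually_conj])
  let ?\<delta> = "\<lambda>a::nat. if a = 0 then F z / 2 else 0"
  have low: "?\<delta> (k mod b ^ M) \<le> F (Z N k)" if N: "M \<le> N" for N k
  proof (cases "k mod b ^ M = 0")
    case True
    then have "Z M k = Z M 0" using multilevel_sum_mod[of 1 b x M k] by simp
    then have "dist (Z N k) z < d"
      using abs_partial_sum_diff_le[OF N, of k] M unfolding dist_real_def by linarith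
    then show ?thesis using d(2) True by (simp add: less_imp_le)
  qed (simp add: F(2))
  have "badic_mean b M ?\<delta> \<le> V"
  proof (rule tendsto_lowerbound[OF V])
    show "\<forall>\<^sub>F N in sequentially. badic_mean b M ?\<delta> \<le> badic_mean b N (\<lambda>k. F (Z N k))"
      using eventually_ge_at_top[of M]
    proof eventually_elim
      case (elim N)
      then have "badic_mean b M ?\<delta> = badic_mean b N (\<lambda>k. ?\<delta> (k mod b ^ M))"
        using badic_mean_mod[of M N ?\<delta>] by simp
      also have "\<dots> \<le> badic_mean b N (\<lambda>k. F (Z N k))" by (intro badic_average_mono low elim)
      finally show ?case .
    qed
  qed simp
  moreover have "0 < badic_mean b M ?\<delta>" using F(3) by (simp add: badic_average_def)
  ultimately show ?thesis by linarith
qed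

end

lemma (in badic) weierstrass_pvar_rough:
  assumes \<alpha>: "0 < \<alpha>" and f: "f 0 = 0" "f 1 = 0" and p: "0 < p" "\<alpha> powr p = 1 / real b"
    and s: "0 \<le> s" "s < \<alpha>" and incr: "\<And>m j. j < b ^ m \<Longrightarrow> \<bar>badic_incr f b m j\<bar> \<le> D * s ^ m"
    and nonzero: "\<not> (\<lambda>N. \<Sum>m\<in>{1..N}. badic_incr f b m 0 / \<alpha> ^ m) \<longlonglongrightarrow> 0"
  shows "\<exists>V>0. \<forall>t\<in>{0..1}. (\<lambda>N. pvar_sum (weierstrass \<alpha> b f) b p t N) \<longlonglongrightarrow> t * V"
proof -
  let ?x = "\<lambda>m j. (1 / \<alpha>) ^ m * badic_incr f b m j"
  interpret summable_levels b ?x D "s / \<alpha>"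
    using \<alpha> s incr by unfold_locales (auto simp: abs_mult power_divide divide_right_mono)
  have F: "continuous_on UNIV (\<lambda>z::real. \<bar>z\<bar> powr p)"
    using p(1) by (intro continuous_on_powr' continuous_intros) auto
  obtain V where V: "\<forall>t\<in>{0..1}. (\<lambda>N. badic_average b t N (\<lambda>k. \<bar>Z N k\<bar> powr p)) \<longlonglongrightarrow> t * V"
    using average_tendsto[OF F] by blast
  obtain z where z: "(\<lambda>N. Z N 0) \<longlonglongrightarrow> z"
    using convergent_partial_sums convergent_def by blast
  have "Z N 0 = (\<Sum>m\<in>{1..N}. badic_incr f b m 0 / \<alpha> ^ m)" for N
    by (simp add: multilevel_sum_def power_one_over)
  then have "z \<noteq> 0" using z nonzero by auto
  have "0 < V"
  proof (rule average_limit_pos[OF _ _ _ z])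
    show "isCont (\<lambda>z. \<bar>z\<bar> powr p) z" using F by (simp add: continuous_on_eq_continuous_at)
    show "(\<lambda>N. badic_mean b N (\<lambda>k. \<bar>Z N k\<bar> powr p)) \<longlonglongrightarrow> V" using V[rule_format, of 1] by simp
  qed (use \<open>z \<noteq> 0\<close> in auto)
  moreover have "(1 / \<alpha>) powr p = real b"
    using \<alpha> p(2) by (simp add: powr_divide)
  then have "pvar_sum (weierstrass \<alpha> b f) b p t N = badic_average b t N (\<lambda>k. \<bar>Z N k\<bar> powr p)"
    for t N
    by (subst pvar_sum_weierstrass[OF f, of "1 / \<alpha>"]) (use \<alpha> in simp_all)
  ultimately show ?thesis using V by auto
qed

section \<open>Variations with other exponents\<close>

lemma sum_powr_add_le:
  fixes g :: "'i \<Rightarrow> real"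
  assumes "\<And>k. k \<in> A \<Longrightarrow> 0 \<le> g k" "\<And>k. k \<in> A \<Longrightarrow> g k \<le> e" and "0 \<le> d"
  shows "(\<Sum>k\<in>A. g k powr (x + d)) \<le> e powr d * (\<Sum>k\<in>A. g k powr x)"
proof -
  have "g k powr (x + d) \<le> e powr d * g k powr x" if "k \<in> A" for k
    unfolding powr_add mult.commute[of "g k powr x"] using assms that
    by (intro mult_right_mono powr_mono2) auto
  then show ?thesis unfolding sum_distrib_left by (rule sum_mono)
qed

context
  fixes g :: "nat \<Rightarrow> nat \<Rightarrow> real" and L :: "nat \<Rightarrow> nat" and \<epsilon> :: "nat \<Rightarrow> real" and p V :: real
  assumes g: "\<And>N k. k < L N \<Longrightarrow> 0 \<le> g N k" "\<And>N k. k < L N \<Longrightarrow> g N k \<le> \<epsilon> N"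
    and mesh: "\<And>N. 0 \<le> \<epsilon> N" "\<epsilon> \<longlonglongrightarrow> 0"
    and limit: "(\<lambda>N. \<Sum>k<L N. g N k powr p) \<longlonglongrightarrow> V"
begin

lemma powr_mesh_tendsto_zero: "0 < d \<Longrightarrow> (\<lambda>N. \<epsilon> N powr d) \<longlonglongrightarrow> 0"
  using mesh by (intro tendsto_zero_powrI[of _ _ _ d]) auto

lemma sum_powr_tendsto_zero:
  assumes "p < q"
  shows "(\<lambda>N. \<Sum>k<L N. g N k powr q) \<longlonglongrightarrow> 0"
proof (rule Lim_null_comparison)
  show "(\<lambda>N. \<epsilon> N powr (q - p) * (\<Sum>k<L N. g N k powr p)) \<longlonglongrightarrow> 0"
    using tendsto_mult[OF powr_mesh_tendsto_zero limit, of "q - p"] assms by simp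
  show "\<forall>\<^sub>F N in sequentially. norm (\<Sum>k<L N. g N k powr q)
      \<le> \<epsilon> N powr (q - p) * (\<Sum>k<L N. g N k powr p)"
    using sum_powr_add_le[of "{..<L N}" "g N" "\<epsilon> N" "q - p" p for N] g assms
    by (intro always_eventually) (simp add: sum_nonneg)
qed

lemma sum_powr_tendsto_at_top:
  assumes V: "0 < V" and "q < p"
  shows "filterlim (\<lambda>N. \<Sum>k<L N. g N k powr q) at_top sequentially"
  unfolding filterlim_at_top_gt[where c = 0]
proof (intro allI impI)
  fix Z :: real assume Z: "0 < Z"
  have "\<forall>\<^sub>F N in sequentially. \<epsilon> N powr (p - q) < V / (2 * Z)"
    using powr_mesh_tendsto_zero[of "p - q"] assms Z by (intro order_tendstoD) auto
  moreover have "\<forall>\<^sub>F N in sequentially. V / 2 < (\<Sum>k<L N. g N k powr p)"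
    using V limit by (intro order_tendstoD) auto
  ultimately show "\<forall>\<^sub>F N in sequentially. Z \<le> (\<Sum>k<L N. g N k powr q)"
  proof eventually_elim
    case (elim N)
    have "V / 2 < \<epsilon> N powr (p - q) * (\<Sum>k<L N. g N k powr q)"
      using elim sum_powr_add_le[of "{..<L N}" "g N" "\<epsilon> N" "p - q" q] g assms by simp
    also have "\<dots> \<le> V / (2 * Z) * (\<Sum>k<L N. g N k powr q)"
      using elim by (intro mult_right_mono) (auto intro: sum_nonneg)
    finally show ?case using V Z by (simp add: field_simps)
  qed
qed

end

lemma has_pvar_other_exponents:
  assumes incr: "\<And>N k. \<bar>badic_incr f b N k\<bar> \<le> \<epsilon> N" and mesh: "\<epsilon> \<longlonglongrightarrow> 0"
    and V: "0 < V" and limit: "has_pvar f b p t (ereal V)"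
  shows "q < p \<Longrightarrow> has_pvar f b q t \<infinity>" and "p < q \<Longrightarrow> has_pvar f b q t 0"
proof -
  let ?g = "\<lambda>N k. \<bar>badic_incr f b N k\<bar>" and ?L = "badic_count b t"
  have sums: "(\<lambda>N. \<Sum>k<?L N. ?g N k powr p) \<longlonglongrightarrow> V"
    using limit by (simp add: has_pvar_def pvar_sum_eq)
  have nonneg: "0 \<le> \<epsilon> N" for N using order_trans[OF abs_ge_zero incr] .
  show "has_pvar f b q t \<infinity>" if "q < p"
    unfolding has_pvar_def pvar_sum_eq tendsto_PInfty_eq_at_top
    by (rule sum_powr_tendsto_at_top[OF abs_ge_zero incr nonneg mesh sums V that])
  show "has_pvar f b q t 0" if "p < q"
    unfolding has_pvar_def pvar_sum_eq zero_ereal_def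
    by (intro tendsto_ereal sum_powr_tendsto_zero[OF abs_ge_zero incr nonneg mesh sums that])
qed

section \<open>Nondegeneracy of the leading functional\<close>

lemma second_difference_abs_powr_bounds:
  fixes a A :: real
  assumes a: "a \<le> 2" and A: "0 < A"
  obtains C where "\<And>h z. 0 < h \<Longrightarrow> h \<le> A / 2 \<Longrightarrow> A \<le> z
      \<Longrightarrow> \<bar>second_difference (\<lambda>x. \<bar>x\<bar> powr a) h z\<bar> \<le> C * h\<^sup>2"
    and "\<And>h z z'. 0 < h \<Longrightarrow> h \<le> A / 2 \<Longrightarrow> A \<le> z \<Longrightarrow> z \<le> z' \<Longrightarrow>
      \<bar>second_difference (\<lambda>x. \<bar>x\<bar> powr a) h z' - second_difference (\<lambda>x. \<bar>x\<bar> powr a) h z\<bar>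
        \<le> C * h\<^sup>2 * (z' - z)"
proof -
  let ?C1 = "2 * (\<bar>a * (a - 1)\<bar> * (A / 2) powr (a - 2))"
  let ?C2 = "\<bar>a\<bar> * (2 * (\<bar>(a - 1) * (a - 2)\<bar> * (A / 2) powr (a - 3)))"
  let ?C = "max ?C1 ?C2"
  have pos: "second_difference (\<lambda>x. \<bar>x\<bar> powr a) h z = second_difference (\<lambda>x. x powr a) h z"
    if "0 < h" "h \<le> A / 2" "A \<le> z" for h z
    using that by (intro second_difference_abs_powr) auto
  show thesis
  proof (rule that)
    fix h z assume h: "0 < h" "h \<le> A / 2" and z: "A \<le> z"
    have "\<bar>second_difference (\<lambda>x. \<bar>x\<bar> powr a) h z\<bar> \<le> ?C1 * h\<^sup>2"
      unfolding pos[OF h z] using second_difference_powr_le[OF a A z h] by (simp add: mult_ac)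
    also have "\<dots> \<le> ?C * h\<^sup>2" by (intro mult_right_mono) auto
    finally show "\<bar>second_difference (\<lambda>x. \<bar>x\<bar> powr a) h z\<bar> \<le> ?C * h\<^sup>2" .
    fix z' assume z': "z \<le> z'"
    have "\<bar>second_difference (\<lambda>x. \<bar>x\<bar> powr a) h z' - second_difference (\<lambda>x. \<bar>x\<bar> powr a) h z\<bar>
        \<le> ?C2 * h\<^sup>2 * (z' - z)"
      unfolding pos[OF h z] pos[OF h order_trans[OF z z']]
      using second_difference_powr_Lipschitz[of a A z z' h] a A z z' h by (simp add: mult_ac)
    also have "\<dots> \<le> ?C * h\<^sup>2 * (z' - z)" using z' by (intro mult_right_mono) auto
    finally show "\<bar>second_difference (\<lambda>x. \<bar>x\<bar> powr a) h z' - second_difference (\<lambda>x. \<bar>x\<bar> powr a) h z\<bar>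
      \<le> ?C * h\<^sup>2 * (z' - z)" .
  qed
qed

definition cusp_cov :: "real \<Rightarrow> real \<Rightarrow> real \<Rightarrow> real \<Rightarrow> real" where
  "cusp_cov H h y x = (second_difference (\<lambda>z. \<bar>z\<bar> powr (2*H)) h y
     - second_difference (\<lambda>z. \<bar>z\<bar> powr (2*H)) h (x - y)) / 2"

lemma fbm_cov_second_difference:
  assumes "0 < h" "h \<le> y"
  shows "second_difference (fbm_cov H x) h y = cusp_cov H h y x"
proof -
  have "\<bar>y + h - x\<bar> = \<bar>x - y - h\<bar>" "\<bar>y - h - x\<bar> = \<bar>x - y + h\<bar>" "\<bar>y - x\<bar> = \<bar>x - y\<bar>" by linarith+
  then show ?thesis
    using assms by (simp add: second_difference_def cusp_cov_def fbm_cov_def field_simps)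
qed

lemma cusp_cov_zero [simp]: "cusp_cov H h y 0 = 0"
  by (simp add: cusp_cov_def second_difference_uminus)

(* Only the term m = 1 sees the cusp of |z|^(2H) at the origin, which contributes -h^(2H). *)
lemma abs_cusp_cov_power_le:
  fixes H y :: real
  defines "\<Delta> \<equiv> second_difference (\<lambda>z. \<bar>z\<bar> powr (2*H))"
  assumes y: "0 < y" "y \<le> 1 / 2" and h: "0 < h"
    and bound: "\<And>z. y / 2 \<le> z \<Longrightarrow> \<bar>\<Delta> h z\<bar> \<le> B"
    and Lipschitz: "\<And>z z'. y / 2 \<le> z \<Longrightarrow> z \<le> z' \<Longrightarrow> \<bar>\<Delta> h z' - \<Delta> h z\<bar> \<le> B * (z' - z)"
  shows "\<bar>cusp_cov H h y (y ^ m) + of_bool (m = 1) * h powr (2*H)\<bar> \<le> B / y * y ^ m"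
proof -
  have \<Delta>_y: "\<bar>\<Delta> h y\<bar> \<le> B" using y by (intro bound) auto
  have "0 \<le> B" using order_trans[OF abs_ge_zero \<Delta>_y] .
  then have B_le: "B \<le> B / y" using y by (simp add: le_divide_eq mult_left_le)
  consider "m = 0" | "m = 1" | "2 \<le> m" by linarith
  then show ?thesis
  proof cases
    case 1
    have "\<bar>\<Delta> h (1 - y)\<bar> \<le> B" using y by (intro bound) auto
    then have "\<bar>\<Delta> h y - \<Delta> h (1 - y)\<bar> \<le> B + B"
      by (intro order_trans[OF abs_triangle_ineq4] add_mono \<Delta>_y)
    then have "\<bar>cusp_cov H h y (y ^ m)\<bar> \<le> B" using 1 by (simp add: cusp_cov_def \<Delta>_def)
    also note B_le
    finally show ?thesis using 1 by simp
  next
    case 2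
    have "\<Delta> h 0 = 2 * h powr (2*H)" using h by (simp add: \<Delta>_def second_difference_def)
    then have "cusp_cov H h y (y ^ m) + h powr (2*H) = \<Delta> h y / 2"
      using 2 by (simp add: cusp_cov_def diff_divide_distrib flip: \<Delta>_def)
    then show ?thesis using 2 \<Delta>_y y by simp
  next
    case 3
    have "y ^ m \<le> y\<^sup>2" using 3 y by (intro power_decreasing) auto
    also have "\<dots> \<le> y / 2" using y by (simp add: power2_eq_square)
    finally have ym: "y / 2 \<le> y - y ^ m" "y - y ^ m \<le> y" using y by auto
    have "\<Delta> h (y ^ m - y) = \<Delta> h (y - y ^ m)"
      using second_difference_uminus[of "\<lambda>z. \<bar>z\<bar> powr (2*H)" h "y - y ^ m"] by (simp add: \<Delta>_def)
    then have "2 * \<bar>cusp_cov H h y (y ^ m)\<bar> \<le> B * y ^ m"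
      using Lipschitz[OF ym] by (simp add: cusp_cov_def flip: \<Delta>_def)
    also have "\<dots> \<le> B / y * y ^ m" using y by (intro mult_right_mono B_le) simp
    finally show ?thesis using 3 by simp
  qed
qed

lemma cusp_cov_bound:
  fixes H y :: real
  assumes H: "H < 1" and y: "0 < y" "y \<le> 1 / 2"
  obtains C where "\<And>h m. 0 < h \<Longrightarrow> h \<le> y / 4 \<Longrightarrow>
    \<bar>cusp_cov H h y (y ^ m) + of_bool (m = 1) * h powr (2*H)\<bar> \<le> C * h\<^sup>2 * y ^ m"
proof -
  let ?\<Delta> = "second_difference (\<lambda>z. \<bar>z\<bar> powr (2*H))"
  have "2 * H \<le> 2" "0 < y / 2" using H y by simp_all
  then obtain C where C: "\<And>h z. 0 < h \<Longrightarrow> h \<le> y / 4 \<Longrightarrow> y / 2 \<le> z \<Longrightarrow> \<bar>?\<Delta> h z\<bar> \<le> C * h\<^sup>2"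
    "\<And>h z z'. 0 < h \<Longrightarrow> h \<le> y / 4 \<Longrightarrow> y / 2 \<le> z \<Longrightarrow> z \<le> z' \<Longrightarrow>
      \<bar>?\<Delta> h z' - ?\<Delta> h z\<bar> \<le> C * h\<^sup>2 * (z' - z)"
    by (rule second_difference_abs_powr_bounds) auto
  have "\<bar>cusp_cov H h y (y ^ m) + of_bool (m = 1) * h powr (2*H)\<bar> \<le> C / y * h\<^sup>2 * y ^ m"
    if h: "0 < h" "h \<le> y / 4" for h m
    using abs_cusp_cov_power_le[OF y h(1) C[OF h]] by simp
  then show thesis by (rule that)
qed

lemma eventually_square_le_powr:
  fixes a K c :: real
  assumes a: "a < 2" and c: "0 < c"
  shows "\<forall>\<^sub>F h in at_right 0. K * h\<^sup>2 \<le> c * h powr a"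
proof -
  have "((\<lambda>h. K * h powr (2 - a)) \<longlongrightarrow> K * 0) (at_right 0)"
    using a by (intro tendsto_mult tendsto_const tendsto_zero_powrI[of _ _ _ "2 - a"])
      (auto intro: eventually_mono[OF eventually_at_right_less])
  then have "\<forall>\<^sub>F h in at_right 0. K * h powr (2 - a) < c"
    using c by (intro order_tendstoD) auto
  then show ?thesis
    using eventually_at_right_less[of 0]
  proof eventually_elim
    case (elim h)
    have "K * h\<^sup>2 = K * h powr (2 - a) * h powr a"
      using elim(2) by (simp add: mult.assoc flip: powr_add)
    also have "\<dots> \<le> c * h powr a"
      using elim(1) by (intro mult_right_mono) auto
    finally show ?case .
  qed
qed

lemma leading_covariance_deviation_le:
  fixes a :: "nat \<Rightarrow> real"
  assumes \<alpha>: "0 < y" "y < \<alpha>" and a: "\<And>m. \<bar>a m\<bar> \<le> A / \<alpha> ^ m" "a 1 = 1 / \<alpha>" and N: "1 \<le> N"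
    and cusp: "\<And>m. \<bar>cusp_cov H h y (y ^ m) + of_bool (m = 1) * h powr (2*H)\<bar> \<le> C * h\<^sup>2 * y ^ m"
  shows "\<bar>(\<Sum>m\<le>N. a m * cusp_cov H h y (y ^ m)) + h powr (2*H) / \<alpha>\<bar> \<le> A * C / (1 - y / \<alpha>) * h\<^sup>2"
proof -
  have A: "0 \<le> A" "0 \<le> C * h\<^sup>2"
    using order_trans[OF abs_ge_zero a(1)[of 0]] order_trans[OF abs_ge_zero cusp[of 0]] by simp_all
  have "(\<Sum>m\<le>N. a m * (of_bool (m = 1) * h powr (2*H)))
      = (\<Sum>m\<le>N. if m = 1 then h powr (2*H) / \<alpha> else 0)"
    using a(2) by (intro sum.cong) auto
  then have "(\<Sum>m\<le>N. a m * (of_bool (m = 1) * h powr (2*H))) = h powr (2*H) / \<alpha>" using N by simp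
  then have "\<bar>(\<Sum>m\<le>N. a m * cusp_cov H h y (y ^ m)) + h powr (2*H) / \<alpha>\<bar>
      = \<bar>\<Sum>m\<le>N. a m * (cusp_cov H h y (y ^ m) + of_bool (m = 1) * h powr (2*H))\<bar>"
    unfolding distrib_left sum.distrib by simp
  also have "\<dots> \<le> (\<Sum>m\<le>N. \<bar>a m\<bar> * \<bar>cusp_cov H h y (y ^ m) + of_bool (m = 1) * h powr (2*H)\<bar>)"
    unfolding abs_mult[symmetric] by (rule sum_abs)
  also have "\<dots> \<le> (\<Sum>m\<le>N. A / \<alpha> ^ m * (C * h\<^sup>2 * y ^ m))"
    using A \<alpha> by (intro sum_mono mult_mono a(1) cusp) auto
  also have "\<dots> = A * (C * h\<^sup>2) * (\<Sum>m\<le>N. (y / \<alpha>) ^ m)"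
    by (simp add: sum_distrib_left power_divide mult_ac)
  also have "\<dots> \<le> A * (C * h\<^sup>2) * (1 / (1 - y / \<alpha>))"
    using \<alpha> by (intro mult_left_mono[OF sum_power_le_geometric mult_nonneg_nonneg[OF A]]) auto
  finally show ?thesis by (simp add: mult_ac)
qed

lemma leading_covariance_bounded_away:
  fixes a :: "nat \<Rightarrow> nat \<Rightarrow> real"
  assumes H: "H < 1" and y: "0 < y" "y \<le> 1 / 2" and \<alpha>: "y < \<alpha>"
    and a: "\<And>N m. \<bar>a N m\<bar> \<le> A / \<alpha> ^ m" "\<And>N. a N 1 = 1 / \<alpha>"
  obtains h \<delta> where "0 < h" "h \<le> y" "0 < \<delta>"
    and "\<And>N. 1 \<le> N \<Longrightarrow> \<delta> \<le> \<bar>\<Sum>m\<le>N. a N m * cusp_cov H h y (y ^ m)\<bar>"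
proof -
  obtain C where C: "\<And>h m. 0 < h \<Longrightarrow> h \<le> y / 4 \<Longrightarrow>
      \<bar>cusp_cov H h y (y ^ m) + of_bool (m = 1) * h powr (2*H)\<bar> \<le> C * h\<^sup>2 * y ^ m"
    using cusp_cov_bound[OF H y] by blast
  have "\<forall>\<^sub>F h in at_right 0. A * C / (1 - y / \<alpha>) * h\<^sup>2 \<le> 1 / (2 * \<alpha>) * h powr (2*H)"
    using H y \<alpha> by (intro eventually_square_le_powr) auto
  moreover have "\<forall>\<^sub>F h in at_right 0. h \<in> {0<..<y / 4}"
    using y by (intro eventually_at_right_real) simp
  ultimately obtain h where small: "A * C / (1 - y / \<alpha>) * h\<^sup>2 \<le> 1 / (2 * \<alpha>) * h powr (2*H)"
      and h: "0 < h" "h \<le> y / 4"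
    by (auto dest: eventually_happens[OF eventually_conj])
  show thesis
  proof (rule that[of h "1 / (2 * \<alpha>) * h powr (2*H)"])
    show "0 < h" "h \<le> y" "0 < 1 / (2 * \<alpha>) * h powr (2*H)" using h y \<alpha> by auto
    fix N :: nat assume "1 \<le> N"
    then have "\<bar>(\<Sum>m\<le>N. a N m * cusp_cov H h y (y ^ m)) + h powr (2*H) / \<alpha>\<bar>
        \<le> 1 / (2 * \<alpha>) * h powr (2*H)"
      by (rule order_trans[OF leading_covariance_deviation_le[where a = "a N", OF y(1) \<alpha> a _ C[OF h]] small])
    moreover have "h powr (2*H) / \<alpha> = 2 * (1 / (2 * \<alpha>) * h powr (2*H))" by simp
    ultimately show "1 / (2 * \<alpha>) * h powr (2*H) \<le> \<bar>\<Sum>m\<le>N. a N m * cusp_cov H h y (y ^ m)\<bar>"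
      by linarith
  qed
qed

lemma (in gaussian_family) AE_sums_not_tendsto_zero:
  assumes A: "\<And>N. finite (A N)" "\<And>N. A N \<subseteq> I" and j: "j \<in> I" and \<delta>: "0 < \<delta>"
    and cov: "\<And>N. \<delta> \<le> \<bar>\<Sum>i\<in>A N. c N i * \<Gamma> i j\<bar>"
  shows "AE \<omega> in M. \<not> (\<lambda>N::nat. \<Sum>i\<in>A N. c N i * \<xi> i \<omega>) \<longlonglongrightarrow> 0"
proof -
  let ?X = "\<lambda>N \<omega>. \<Sum>i\<in>A N. c N i * \<xi> i \<omega>"
  let ?v = "\<lambda>N. \<Sum>i\<in>A N. \<Sum>k\<in>A N. c N i * c N k * \<Gamma> i k"
  have X: "centred_gaussian M (?X N) (?v N)" for N
    using A by (intro gaussian_sum) auto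
  have correlated: "\<delta>\<^sup>2 \<le> ?v N * \<Gamma> j j" for N
  proof -
    have "\<delta>\<^sup>2 \<le> (\<Sum>i\<in>A N. c N i * \<Gamma> i j)\<^sup>2"
      using cov[of N] \<delta> by (intro abs_le_square_iff[THEN iffD1]) simp
    then show ?thesis using covariance_sum_square_le[OF A(1,2) j, of "c N" N] by (rule order_trans)
  qed
  have "0 < \<delta>\<^sup>2" using \<delta> by simp
  then have "\<Gamma> j j \<noteq> 0" using correlated[of 0] by auto
  then have var_j: "0 < \<Gamma> j j" using variance_nonneg[OF j] by simp
  define w where "w = \<delta>\<^sup>2 / \<Gamma> j j"
  have w: "0 < w" "w \<le> ?v N" for N
    using correlated[of N] var_j \<delta> by (simp_all add: w_def divide_le_eq)
  show ?thesis
  proof (rule AE_not_tendsto_zero)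
    show "?X N \<in> borel_measurable M" for N by (rule centred_gaussianD(1)[OF X])
    fix N and e :: real assume e: "0 < e"
    have "prob {\<omega>\<in>space M. \<bar>?X N \<omega>\<bar> \<le> e} \<le> 2 * e / sqrt (?v N)"
      using less_le_trans[OF w] e by (intro centred_gaussian_small_ball X) auto
    also have "\<dots> \<le> 2 * e / sqrt w"
      using w less_le_trans[OF w] e by (intro divide_left_mono mult_pos_pos real_sqrt_le_mono) auto
    finally show "prob {\<omega>\<in>space M. \<bar>?X N \<omega>\<bar> \<le> e} \<le> 2 / sqrt w * e" by simp
  qed
qed

context fbm
begin

lemma initial_incr_second_difference_family:
  assumes h: "0 < h" "h \<le> y"
  obtains \<Gamma> where "gaussian_family M UNIV (case_option (\<lambda>\<omega>. second_difference (\<lambda>t. W t \<omega>) h y)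
      (\<lambda>m \<omega>. badic_incr (\<lambda>t. W t \<omega>) b m 0)) \<Gamma>"
    and "\<And>m. \<Gamma> (Some m) None = cusp_cov H h y (1 / real b ^ m)"
proof -
  interpret gaussian_family M "{0..}" W "fbm_cov H" by (rule fbm_family)
  define p where "p = case_option (\<lambda>i::nat. [y + h, y - h, y] ! i)
      (\<lambda>m i. [1 / real b ^ m, 0, 0] ! i)"
  define c where "c = case_option (\<lambda>i::nat. [1, 1, - 2] ! i) (\<lambda>m::nat. \<lambda>i. [1, - 1, 0] ! i :: real)"
  let ?\<xi> = "\<lambda>x \<omega>. \<Sum>i<3. c x i * W (p x i) \<omega>"
  let ?\<Gamma> = "\<lambda>x x'. \<Sum>i<3. \<Sum>j<3. c x i * c x' j * fbm_cov H (p x i) (p x' j)"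
  have three: "(\<Sum>i<3. f i) = f 0 + f 1 + f 2" for f :: "nat \<Rightarrow> real"
    by (simp add: eval_nat_numeral)
  have "p x i \<in> {0..}" if "i < 3" for x i
    using that h by (cases x) (auto simp: p_def eval_nat_numeral less_Suc_eq)
  then have "gaussian_family M UNIV ?\<xi> ?\<Gamma>"
    by (intro linear_combinations) auto
  moreover have "?\<xi> = case_option (\<lambda>\<omega>. second_difference (\<lambda>t. W t \<omega>) h y)
      (\<lambda>m \<omega>. badic_incr (\<lambda>t. W t \<omega>) b m 0)"
    by (auto simp: fun_eq_iff three c_def p_def second_difference_def badic_incr_def
      split: option.split)
  moreover have "?\<Gamma> (Some m) None 
      = second_difference (fbm_cov H (1 / real b ^ m)) h y - second_difference (fbm_cov H 0) h y" for m
    by (simp add: three c_def p_def second_difference_def)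
  then have "?\<Gamma> (Some m) None = cusp_cov H h y (1 / real b ^ m)" for m
    by (simp add: fbm_cov_second_difference[OF h])
  ultimately show thesis by (intro that[of ?\<Gamma>]) auto
qed

lemma AE_leading_functional_not_tendsto_zero:
  assumes \<alpha>: "1 / real b < \<alpha>" and a: "\<And>N m. \<bar>a N m\<bar> \<le> A / \<alpha> ^ m" "\<And>N. a N 1 = 1 / \<alpha>"
  shows "AE \<omega> in M. \<not> (\<lambda>N. \<Sum>m\<le>N. a N m * badic_incr (\<lambda>t. W t \<omega>) b m 0) \<longlonglongrightarrow> 0"
proof -
  let ?y = "1 / real b"
  have y: "0 < ?y" "?y \<le> 1 / 2" using base_ge_2 by (auto simp: field_simps)
  obtain h \<delta> where h: "0 < h" "h \<le> ?y" and \<delta>: "0 < \<delta>"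
    and cov: "\<And>N. 1 \<le> N \<Longrightarrow> \<delta> \<le> \<bar>\<Sum>m\<le>N. a N m * cusp_cov H h ?y (?y ^ m)\<bar>"
    using leading_covariance_bounded_away[where a = a, OF hurst_less_1 y \<alpha> a] by blast
  let ?\<xi> = "case_option (\<lambda>\<omega>. second_difference (\<lambda>t. W t \<omega>) h ?y)
      (\<lambda>m \<omega>. badic_incr (\<lambda>t. W t \<omega>) b m 0)"
  obtain \<Gamma> where "gaussian_family M UNIV ?\<xi> \<Gamma>"
      and \<Gamma>: "\<And>m. \<Gamma> (Some m) None = cusp_cov H h ?y (1 / real b ^ m)"
    using initial_incr_second_difference_family[OF h] by blast
  then interpret gaussian_family M UNIV ?\<xi> \<Gamma> by simp
  have "AE \<omega> in M. \<not> (\<lambda>N. \<Sum>x\<in>Some ` {..Suc N}. a (Suc N) (the x) * ?\<xi> x \<omega>) \<longlonglongrightarrow> 0"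
  proof (rule AE_sums_not_tendsto_zero[OF _ _ _ \<delta>, where j = None])
    show "\<delta> \<le> \<bar>\<Sum>x\<in>Some ` {..Suc N}. a (Suc N) (the x) * \<Gamma> x None\<bar>" for N
      using cov[of "Suc N"] by (simp add: sum.reindex \<Gamma> power_one_over)
  qed auto
  then show ?thesis
  proof eventually_elim
    case (elim \<omega>)
    then show ?case using LIMSEQ_Suc by (force simp: sum.reindex)
  qed
qed

end

section \<open>Variation of the Wiener--Weierstrass bridge\<close>

locale wiener_weierstrass_bridge = fbm b H M W
  for b :: nat and H :: real and M :: "'a measure" and W :: "real \<Rightarrow> 'a \<Rightarrow> real" +
  fixes \<alpha> :: real and \<kappa> :: "real \<Rightarrow> real" and \<tau> C :: real
  assumes \<alpha>_bounds: "0 < \<alpha>" "\<alpha> < 1" and \<kappa>_endpoints: "\<kappa> 0 = 0" "\<kappa> 1 = 1" and \<tau>: "H < \<tau>"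
    and holder: "\<forall>s\<in>{0..1}. \<forall>t\<in>{0..1}. \<bar>\<kappa> s - \<kappa> t\<bar> \<le> C * \<bar>s - t\<bar> powr \<tau>"
begin

abbreviation bridge :: "'a \<Rightarrow> real \<Rightarrow> real" where
  "bridge \<omega> \<equiv> \<lambda>t. fbb \<kappa> W t \<omega>"

abbreviation X :: "'a \<Rightarrow> real \<Rightarrow> real" where
  "X \<omega> \<equiv> \<lambda>t. fwwb \<alpha> b \<kappa> W t \<omega>"

abbreviation \<rho> :: real where
  "\<rho> \<equiv> - log (real b) \<alpha>"

lemma base_powr_neg_\<rho>: "real b powr - \<rho> = \<alpha>"
proof -
  have "real b \<noteq> 1" using base_gt_1 by linarith
  then show ?thesis unfolding minus_minus using \<alpha>_bounds by (intro powr_log_cancel) simp_all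
qed

lemma base_powr_less_\<alpha>: "\<rho> < x \<Longrightarrow> real b powr - x < \<alpha>"
  using powr_less_mono[of "- x" "- \<rho>" "real b"] base_gt_1 unfolding base_powr_neg_\<rho> by linarith

lemma \<rho>_pos: "0 < \<rho>"
  using \<alpha>_bounds base_gt_1 by simp

lemma X_eq_weierstrass: "X \<omega> = weierstrass \<alpha> b (bridge \<omega>)"
  by (simp add: fwwb_def weierstrass_def fun_eq_iff)

lemma badic_incr_bridge:
  "badic_incr (bridge \<omega>) b m j = badic_incr (\<lambda>t. W t \<omega>) b m j - badic_incr \<kappa> b m j * W 1 \<omega>"
  by (simp add: badic_incr_def fbb_def algebra_simps)

lemma abs_badic_incr_\<kappa>_le:
  assumes j: "j < b ^ m"
  shows "\<bar>badic_incr \<kappa> b m j\<bar> \<le> \<bar>C\<bar> * (real b powr - \<tau>) ^ m"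
proof -
  have "real i / real b ^ m \<in> {0..1}" if "i \<le> b ^ m" for i
    using that by (simp add: divide_le_eq flip: of_nat_power)
  then have "\<bar>badic_incr \<kappa> b m j\<bar> \<le> C * \<bar>real (j + 1) / real b ^ m - real j / real b ^ m\<bar> powr \<tau>"
    unfolding badic_incr_def using holder j by (metis Suc_eq_plus1 Suc_leI less_imp_le)
  also have "\<bar>real (j + 1) / real b ^ m - real j / real b ^ m\<bar> = real b powr (- real m)"
    by (simp add: powr_minus_divide powr_realpow flip: diff_divide_distrib)
  also have "(real b powr (- real m)) powr \<tau> = (real b powr - \<tau>) ^ m"
    by (simp add: powr_powr mult.commute flip: powr_realpow)
  also have "C * \<dots> \<le> \<bar>C\<bar> * (real b powr - \<tau>) ^ m"
    by (intro mult_right_mono) auto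
  finally show ?thesis .
qed

lemma AE_bridge_endpoints: "AE \<omega> in M. bridge \<omega> 0 = 0 \<and> bridge \<omega> 1 = 0"
  using AE_fbm_zero by eventually_elim (simp add: fbb_def \<kappa>_endpoints)

lemma AE_bridge_incr_bound:
  assumes h: "h < H"
  shows "AE \<omega> in M. \<exists>D. \<forall>m j. j < b ^ m \<longrightarrow> \<bar>badic_incr (bridge \<omega>) b m j\<bar> \<le> D * (real b powr - h) ^ m"
  using AE_badic_incr_bound[OF h]
proof eventually_elim
  case (elim \<omega>)
  then obtain D where D: "\<And>m j. j < b ^ m
      \<Longrightarrow> \<bar>badic_incr (\<lambda>t. W t \<omega>) b m j\<bar> \<le> D * (real b powr - h) ^ m"
    by blast
  have "\<bar>badic_incr (bridge \<omega>) b m j\<bar>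
      \<le> (D + \<bar>C\<bar> * \<bar>W 1 \<omega>\<bar>) * (real b powr - h) ^ m" if j: "j < b ^ m" for m j
  proof -
    have "\<bar>C\<bar> * (real b powr - \<tau>) ^ m \<le> \<bar>C\<bar> * (real b powr - h) ^ m"
      using base_pos h \<tau> by (intro mult_left_mono power_mono powr_mono) (auto simp: Suc_le_eq)
    then have "\<bar>badic_incr \<kappa> b m j\<bar> * \<bar>W 1 \<omega>\<bar> \<le> \<bar>C\<bar> * (real b powr - h) ^ m * \<bar>W 1 \<omega>\<bar>"
      using abs_badic_incr_\<kappa>_le[OF j] by (intro mult_right_mono) auto
    then have "\<bar>badic_incr (bridge \<omega>) b m j\<bar>
        \<le> D * (real b powr - h) ^ m + \<bar>C\<bar> * (real b powr - h) ^ m * \<bar>W 1 \<omega>\<bar>"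
      unfolding badic_incr_bridge using D[OF j]
      by (intro order_trans[OF abs_triangle_ineq4] add_mono) (auto simp: abs_mult)
    then show ?thesis by (simp add: algebra_simps)
  qed
  then show ?case by blast
qed

lemma AE_incr_tendsto_zero:
  "AE \<omega> in M. \<exists>\<epsilon>. \<epsilon> \<longlonglongrightarrow> 0 \<and> (\<forall>N k. \<bar>badic_incr (X \<omega>) b N k\<bar> \<le> \<epsilon> N)"
proof -
  have "H / 2 < H" using hurst_pos by simp
  from AE_bridge_incr_bound[OF this] AE_bridge_endpoints show ?thesis
  proof eventually_elim
    case (elim \<omega>)
    then obtain D where D: "\<And>m j. j < b ^ m
        \<Longrightarrow> \<bar>badic_incr (bridge \<omega>) b m j\<bar> \<le> D * (real b powr - (H / 2)) ^ m"
      by blast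
    have "real b powr - (H / 2) < 1"
      using powr_less_mono[of "- (H / 2)" 0 "real b"] base_gt_1 hurst_pos by simp
    then have "\<exists>\<epsilon>. \<epsilon> \<longlonglongrightarrow> 0 \<and> (\<forall>N k. \<bar>multilevel_sum \<alpha> b (badic_incr (bridge \<omega>) b) N k\<bar> \<le> \<epsilon> N)"
      using \<alpha>_bounds by (intro multilevel_sum_tendsto_zero_uniformly[OF _ _ _ _ D]) auto
    then show ?case
      using elim(2) by (simp add: X_eq_weierstrass badic_incr_weierstrass)
  qed
qed

lemma AE_pvar_other_exponents:
  assumes "AE \<omega> in M. \<exists>V>0. has_pvar (X \<omega>) b p 1 (ereal V)"
  shows "AE \<omega> in M. (\<forall>q. 0 < q \<and> q < p \<longrightarrow> has_pvar (X \<omega>) b q 1 \<infinity>) \<and> (\<forall>q>p. has_pvar (X \<omega>) b q 1 0)"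
  using assms AE_incr_tendsto_zero
proof eventually_elim
  case (elim \<omega>)
  then obtain V \<epsilon> where "0 < V" "has_pvar (X \<omega>) b p 1 (ereal V)" "\<epsilon> \<longlonglongrightarrow> 0"
    "\<And>N k. \<bar>badic_incr (X \<omega>) b N k\<bar> \<le> \<epsilon> N" by blast
  then show ?case using has_pvar_other_exponents[of "X \<omega>" b \<epsilon> V p 1] by blast
qed

lemma leading_sum_\<kappa>_bounded:
  assumes rough: "\<rho> < H"
  shows "\<exists>K. \<forall>N. \<bar>\<Sum>m\<in>{1..N}. badic_incr \<kappa> b m 0 / \<alpha> ^ m\<bar> \<le> K"
proof -
  define q where "q = real b powr - \<tau> / \<alpha>"
  have q: "0 \<le> q" "q < 1"
    using \<tau> rough \<alpha>_bounds base_powr_less_\<alpha>[of \<tau>] by (auto simp: q_def)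
  have "\<bar>\<Sum>m\<in>{1..N}. badic_incr \<kappa> b m 0 / \<alpha> ^ m\<bar> \<le> \<bar>C\<bar> * (1 / (1 - q))" for N
  proof -
    have "\<bar>\<Sum>m\<in>{1..N}. badic_incr \<kappa> b m 0 / \<alpha> ^ m\<bar> \<le> (\<Sum>m\<in>{1..N}. \<bar>C\<bar> * q ^ m)"
      using abs_badic_incr_\<kappa>_le[of 0] \<alpha>_bounds
      by (intro order_trans[OF sum_abs] sum_mono) (simp add: q_def power_divide divide_right_mono)
    also have "\<dots> \<le> \<bar>C\<bar> * (1 / (1 - q))"
      unfolding sum_distrib_left[symmetric] using q
      by (intro mult_left_mono sum_power_le_geometric) auto
    finally show ?thesis .
  qed
  then show ?thesis by blast
qed

lemma AE_leading_sum_not_tendsto_zero: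
  assumes rough: "\<rho> < H"
  shows "AE \<omega> in M. \<not> (\<lambda>N. \<Sum>m\<in>{1..N}. badic_incr (bridge \<omega>) b m 0 / \<alpha> ^ m) \<longlonglongrightarrow> 0"
proof -
  let ?\<kappa> = "\<lambda>N. \<Sum>m\<in>{1..N}. badic_incr \<kappa> b m 0 / \<alpha> ^ m"
  obtain K where K: "\<And>N. \<bar>?\<kappa> N\<bar> \<le> K" using leading_sum_\<kappa>_bounded[OF rough] by blast
  define a where "a N m = (if m = 0 then - ?\<kappa> N else 1 / \<alpha> ^ m)" for N m
  have "AE \<omega> in M. \<not> (\<lambda>N. \<Sum>m\<le>N. a N m * badic_incr (\<lambda>t. W t \<omega>) b m 0) \<longlonglongrightarrow> 0"
  proof (rule AE_leading_functional_not_tendsto_zero)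
    show "1 / real b < \<alpha>"
      using base_powr_less_\<alpha>[of 1] rough hurst_less_1 by (simp add: powr_minus_divide)
    show "\<bar>a N m\<bar> \<le> max 1 K / \<alpha> ^ m" for N m
      using K[of N] \<alpha>_bounds by (auto simp: a_def divide_right_mono le_max_iff_disj)
    show "a N 1 = 1 / \<alpha>" for N by (simp add: a_def)
  qed
  with AE_fbm_zero show ?thesis
  proof eventually_elim
    case (elim \<omega>)
    have "(\<Sum>m\<le>N. a N m * badic_incr (\<lambda>t. W t \<omega>) b m 0)
        = (\<Sum>m\<in>{1..N}. badic_incr (bridge \<omega>) b m 0 / \<alpha> ^ m)" for N
    proof -
      have "{..N} = insert 0 {1..N}" by auto
      then have "(\<Sum>m\<le>N. a N m * badic_incr (\<lambda>t. W t \<omega>) b m 0)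
          = - ?\<kappa> N * W 1 \<omega> + (\<Sum>m\<in>{1..N}. badic_incr (\<lambda>t. W t \<omega>) b m 0 / \<alpha> ^ m)"
        using elim(1) by (simp add: a_def badic_incr_def)
      then show ?thesis
        by (simp add: badic_incr_bridge diff_divide_distrib sum_subtractf sum_distrib_right)
    qed
    then show ?case using elim(2) by simp
  qed
qed

lemma AE_pvar_rough:
  assumes rough: "\<rho> < H"
  shows "AE \<omega> in M. \<exists>V>0. \<forall>t\<in>{0..1}. (\<lambda>N. pvar_sum (X \<omega>) b (1 / \<rho>) t N) \<longlonglongrightarrow> t * V"
proof -
  define h where "h = (H + \<rho>) / 2"
  have h: "h < H" "\<rho> < h" using rough by (auto simp: h_def)
  have "(real b powr - \<rho>) powr (1 / \<rho>) = 1 / real b"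
    unfolding powr_powr using \<rho>_pos by (simp add: powr_minus_divide)
  then have p: "\<alpha> powr (1 / \<rho>) = 1 / real b" unfolding base_powr_neg_\<rho> .
  from AE_bridge_incr_bound[OF h(1)] AE_bridge_endpoints AE_leading_sum_not_tendsto_zero[OF rough]
  show ?thesis
  proof eventually_elim
    case (elim \<omega>)
    then obtain D where "\<And>m j. j < b ^ m \<Longrightarrow> \<bar>badic_incr (bridge \<omega>) b m j\<bar>
        \<le> D * (real b powr - h) ^ m" by blast
    with elim(2,3) \<alpha>_bounds \<rho>_pos p base_powr_less_\<alpha>[OF h(2)] show ?case
      unfolding X_eq_weierstrass by (intro weierstrass_pvar_rough[where s = "real b powr - h"]) auto
  qed
qed

lemma X_measurable: "(\<lambda>\<omega>. X \<omega> t) \<in> borel_measurable M"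
proof -
  have [measurable]: "(\<lambda>\<omega>. fbb \<kappa> W (frac x) \<omega>) \<in> borel_measurable M" for x
    unfolding fbb_def
    by (intro borel_measurable_diff borel_measurable_times fbm_measurable borel_measurable_const)
      (auto simp: frac_ge_0)
  show ?thesis unfolding fwwb_def by measurable
qed

theorem variation_rough:
  assumes rough: "\<rho> < H"
  shows "\<exists>V. V \<in> borel_measurable M \<and> (AE \<omega> in M. 0 < V \<omega>) \<and>
    (AE \<omega> in M. \<forall>t\<in>{0..1}. has_pvar (X \<omega>) b (1 / \<rho>) t (ereal (V \<omega> * t)))"
proof -
  define V where "V \<omega> = lim (\<lambda>N. pvar_sum (X \<omega>) b (1 / \<rho>) 1 N)" for \<omega>
  have "AE \<omega> in M. 0 < V \<omega> \<and> (\<forall>t\<in>{0..1}. has_pvar (X \<omega>) b (1 / \<rho>) t (ereal (V \<omega> * t)))"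
    using AE_pvar_rough[OF rough]
  proof eventually_elim
    case (elim \<omega>)
    then obtain v where v: "0 < v" "\<And>t. t \<in> {0..1} \<Longrightarrow> (\<lambda>N. pvar_sum (X \<omega>) b (1 / \<rho>) t N) \<longlonglongrightarrow> t * v"
      by blast
    have "V \<omega> = v" using v(2)[of 1] unfolding V_def by (intro limI) simp
    then show ?case using v by (auto simp: has_pvar_def mult.commute intro: tendsto_ereal)
  qed
  moreover have "V \<in> borel_measurable M"
    unfolding V_def[abs_def] pvar_sum_def using X_measurable[measurable]
    by (intro borel_measurable_lim_metric) measurable
  ultimately show ?thesis by auto
qed

lemma \<alpha>\<beta>_less_1:
  assumes "H < \<rho>"
  shows "\<alpha> * \<beta> < 1"
proof -
  have "real b powr (- \<rho> + H) < real b powr 0"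
    using assms base_gt_1 by (intro powr_less_mono) auto
  then show ?thesis unfolding powr_add base_powr_neg_\<rho> by simp
qed

lemma multilevel_bridge_close_to_standard:
  assumes "H < \<rho>"
  shows "\<exists>\<epsilon>. \<epsilon> \<longlonglongrightarrow> 0 \<and> (\<forall>N k. \<bar>multilevel_sum (\<alpha> * \<beta>) b
      (\<lambda>m j. \<beta> ^ m * badic_incr (bridge \<omega>) b m j) N k
    - multilevel_sum (\<alpha> * \<beta>) b (\<lambda>m j. standard_incr m j \<omega>) N k\<bar> \<le> \<epsilon> N)"
  unfolding multilevel_sum_diff
proof (rule multilevel_sum_tendsto_zero_uniformly)
  let ?s = "\<beta> * real b powr - \<tau>"
  show "0 \<le> \<alpha> * \<beta>" "\<alpha> * \<beta> < 1" using \<alpha>_bounds \<alpha>\<beta>_less_1[OF assms] by auto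
  show "0 \<le> ?s" "?s < 1"
    using powr_less_mono[of "H - \<tau>" 0 "real b"] \<tau> base_gt_1 by (auto simp flip: powr_add)
  fix m j assume j: "j < b ^ m"
  have "\<beta> ^ m * badic_incr (bridge \<omega>) b m j - standard_incr m j \<omega>
      = - (\<beta> ^ m * badic_incr \<kappa> b m j * W 1 \<omega>)"
    by (simp add: badic_incr_bridge standard_incr_def algebra_simps)
  also have "\<bar>\<dots>\<bar> \<le> \<beta> ^ m * (\<bar>C\<bar> * (real b powr - \<tau>) ^ m) * \<bar>W 1 \<omega>\<bar>"
    unfolding abs_minus_cancel abs_mult using abs_badic_incr_\<kappa>_le[OF j]
    by (intro mult_mono) auto
  finally show "\<bar>\<beta> ^ m * badic_incr (bridge \<omega>) b m j - standard_incr m j \<omega>\<bar>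
      \<le> (\<bar>C\<bar> * \<bar>W 1 \<omega>\<bar>) * ?s ^ m"
    by (simp add: power_mult_distrib mult_ac)
qed

lemma AE_pvar_smooth:
  assumes smooth: "H < \<rho>"
  shows "AE \<omega> in M. \<forall>t\<in>{0..1}. (\<lambda>N. pvar_sum (X \<omega>) b (1 / H) t N)
    \<longlonglongrightarrow> t * ((1 / (1 - (\<alpha> * \<beta>)\<^sup>2)) powr (1 / H / 2) * std_normal_abs_moment (1 / H))"
proof -
  have "0 \<le> \<alpha> * \<beta>" using \<alpha>_bounds by simp
  then interpret gaussian_array b M
      "\<lambda>N k \<omega>. multilevel_sum (\<alpha> * \<beta>) b (\<lambda>m j. standard_incr m j \<omega>) N k"
    "multilevel_cov H b (\<alpha> * \<beta>)" "1 / (1 - (\<alpha> * \<beta>)\<^sup>2)" "(1 / (1 - \<alpha> * \<beta>))\<^sup>2"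
    by (rule multilevel_gaussian_array[OF _ \<alpha>\<beta>_less_1[OF smooth]])
  have "0 < 1 / H" using hurst_pos by simp
  from AE_abs_powr_average_tendsto[OF this] AE_bridge_endpoints show ?thesis
  proof eventually_elim
    case (elim \<omega>)
    let ?y = "multilevel_sum (\<alpha> * \<beta>) b (\<lambda>m j. \<beta> ^ m * badic_incr (bridge \<omega>) b m j)"
    have "\<beta> powr (1 / H) = real b" using hurst_pos by (simp add: powr_powr)
    then have "pvar_sum (X \<omega>) b (1 / H) t N = badic_average b t N (\<lambda>k. \<bar>?y N k\<bar> powr (1 / H))"
      for t N
      unfolding X_eq_weierstrass using elim(2) base_powr_gt_1
      by (subst pvar_sum_weierstrass[where c = \<beta>]) (auto simp: mult.commute)
    moreover obtain \<epsilon> where "\<epsilon> \<longlonglongrightarrow> 0"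
      "\<And>N k. \<bar>?y N k - multilevel_sum (\<alpha> * \<beta>) b (\<lambda>m j. standard_incr m j \<omega>) N k\<bar> \<le> \<epsilon> N"
      using multilevel_bridge_close_to_standard[OF smooth] by blast
    then have "\<forall>t\<in>{0..1}. (\<lambda>N. badic_average b t N (\<lambda>k. \<bar>?y N k\<bar> powr (1 / H)))
        \<longlonglongrightarrow> t * ((1 / (1 - (\<alpha> * \<beta>)\<^sup>2)) powr (1 / H / 2) * std_normal_abs_moment (1 / H))"
      using elim(1) by blast
    ultimately show ?case by simp
  qed
qed

definition smooth_variation_rate :: real where
  "smooth_variation_rate = 2 powr (1 / (2 * H)) * Gamma ((H + 1) / (2 * H))
    / (sqrt pi * (1 - \<alpha>\<^sup>2 * real b powr (2 * H)) powr (1 / (2 * H)))"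

lemma smooth_variation_rate:
  assumes smooth: "H < \<rho>"
  shows "(1 / (1 - (\<alpha> * \<beta>)\<^sup>2)) powr (1 / H / 2) * std_normal_abs_moment (1 / H)
      = smooth_variation_rate"
    and "0 < smooth_variation_rate"
proof -
  have square: "(\<alpha> * \<beta>)\<^sup>2 = \<alpha>\<^sup>2 * real b powr (2 * H)"
    unfolding power_mult_distrib by (simp add: power2_eq_square flip: powr_add)
  have less_1: "(\<alpha> * \<beta>)\<^sup>2 < 1"
    using \<alpha>\<beta>_less_1[OF smooth] \<alpha>_bounds by (simp add: power_less_one_iff abs_square_less_1)
  have exponents: "1 / H / 2 = 1 / (2 * H)" "(1 / H + 1) / 2 = (H + 1) / (2 * H)"
    using hurst_pos by (auto simp: field_simps)
  have "(1 / (1 - (\<alpha> * \<beta>)\<^sup>2)) powr x = 1 / (1 - (\<alpha> * \<beta>)\<^sup>2) powr x" for x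
    using less_1 by (simp add: powr_divide)
  then show "(1 / (1 - (\<alpha> * \<beta>)\<^sup>2)) powr (1 / H / 2) * std_normal_abs_moment (1 / H)
      = smooth_variation_rate"
    unfolding std_normal_abs_moment_def smooth_variation_rate_def exponents square
    by (simp add: mult.commute)
  show "0 < smooth_variation_rate"
    unfolding smooth_variation_rate_def using less_1 hurst_pos
    by (intro divide_pos_pos mult_pos_pos Gamma_real_pos) (auto simp: square)
qed

theorem variation_smooth:
  assumes smooth: "H < \<rho>"
  shows "AE \<omega> in M. \<forall>t\<in>{0..1}. has_pvar (X \<omega>) b (1 / H) t (ereal (smooth_variation_rate * t))"
  using AE_pvar_smooth[OF smooth]
  unfolding smooth_variation_rate(1)[OF smooth]
  by eventually_elim (auto simp: has_pvar_def mult.commute intro: tendsto_ereal)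

theorem pvar_other_exponents:
  assumes "H \<noteq> \<rho>"
  shows "AE \<omega> in M. (\<forall>q. 0 < q \<and> q < 1 / min H \<rho> \<longrightarrow> has_pvar (X \<omega>) b q 1 \<infinity>) \<and>
    (\<forall>q>1 / min H \<rho>. has_pvar (X \<omega>) b q 1 0)"
proof (rule AE_pvar_other_exponents)
  consider "\<rho> < H" | "H < \<rho>" using assms by linarith
  then show "AE \<omega> in M. \<exists>V>0. has_pvar (X \<omega>) b (1 / min H \<rho>) 1 (ereal V)"
  proof cases
    case 1
    have "AE \<omega> in M. \<exists>V>0. has_pvar (X \<omega>) b (1 / \<rho>) 1 (ereal V)"
      using AE_pvar_rough[OF 1]
    proof eventually_elim
      case (elim \<omega>)
      then obtain V where "0 < V" "(\<lambda>N. pvar_sum (X \<omega>) b (1 / \<rho>) 1 N) \<longlonglongrightarrow> 1 * V" by fastforce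
      then show ?case by (auto simp: has_pvar_def intro: tendsto_ereal)
    qed
    then show ?thesis using 1 by (simp add: min_def)
  next
    case 2
    have "AE \<omega> in M. \<exists>V>0. has_pvar (X \<omega>) b (1 / H) 1 (ereal V)"
      using variation_smooth[OF 2]
    proof eventually_elim
      case (elim \<omega>)
      then have "has_pvar (X \<omega>) b (1 / H) 1 (ereal (smooth_variation_rate * 1))" by fastforce
      then show ?case using smooth_variation_rate(2)[OF 2] by auto
    qed
    then show ?thesis using 2 by (simp add: min_def)
  qed
qed

end

theorem theorem2p3:
  fixes M :: "'a measure" and W :: "real \<Rightarrow> 'a \<Rightarrow> real" and \<kappa> :: "real \<Rightarrow> real"
    and H \<alpha> \<tau> C :: real and b :: nat
  assumes H: "0 < H" "H < 1"
    and fbm: "is_fbm M H W"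
    and \<alpha>: "0 < \<alpha>" "\<alpha> < 1"
    and b: "b \<ge> 2"
    and \<kappa>0: "\<kappa> 0 = 0" and \<kappa>1: "\<kappa> 1 = 1"
    and \<kappa>range: "\<forall>t\<in>{0..1}. \<kappa> t \<in> {0..1}"
    and \<tau>: "H < \<tau>" "\<tau> \<le> 1"
    and holder: "\<forall>s\<in>{0..1}. \<forall>t\<in>{0..1}. \<bar>\<kappa> s - \<kappa> t\<bar> \<le> C * \<bar>s - t\<bar> powr \<tau>"
    and HK: "H \<noteq> min 1 (- log (real b) \<alpha>)"
  shows "(AE \<omega> in M.
            (\<forall>q. 0 < q \<and> q < 1 / min H (min 1 (- log (real b) \<alpha>)) \<longrightarrow>
                 has_pvar (\<lambda>t. fwwb \<alpha> b \<kappa> W t \<omega>) b q 1 \<infinity>) \<and>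
            (\<forall>q. q > 1 / min H (min 1 (- log (real b) \<alpha>)) \<longrightarrow>
                 has_pvar (\<lambda>t. fwwb \<alpha> b \<kappa> W t \<omega>) b q 1 0))
       \<and> (H > min 1 (- log (real b) \<alpha>) \<longrightarrow>
            (\<exists>V. V \<in> borel_measurable M \<and> (AE \<omega> in M. 0 < V \<omega>) \<and>
                 (AE \<omega> in M. \<forall>t\<in>{0..1}.
                    has_pvar (\<lambda>s. fwwb \<alpha> b \<kappa> W s \<omega>) b (1 / min 1 (- log (real b) \<alpha>)) t
                      (ereal (V \<omega> * t)))))
       \<and> (H < min 1 (- log (real b) \<alpha>) \<longrightarrow>
            (AE \<omega> in M. \<forall>t\<in>{0..1}.
               has_pvar (\<lambda>s. fwwb \<alpha> b \<kappa> W s \<omega>) b (1 / H) t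
                 (ereal (2 powr (1 / (2 * H)) * Gamma ((H + 1) / (2 * H))
                          / (sqrt pi * (1 - \<alpha>\<^sup>2 * real b powr (2 * H)) powr (1 / (2 * H))) * t))))"
proof -
  interpret prob_space M using fbm unfolding is_fbm_def by (rule conjunct1)
  interpret wiener_weierstrass_bridge b H M W \<alpha> \<kappa> \<tau> C
    by unfold_locales (fact assms)+
  have critical: "min H (min 1 \<rho>) = min H \<rho>" "H \<noteq> \<rho>"
    using H HK by auto
  show ?thesis
  proof (intro conjI impI)
    show "AE \<omega> in M. (\<forall>q. 0 < q \<and> q < 1 / min H (min 1 \<rho>) \<longrightarrow> has_pvar (X \<omega>) b q 1 \<infinity>) \<and>
        (\<forall>q. q > 1 / min H (min 1 \<rho>) \<longrightarrow> has_pvar (X \<omega>) b q 1 0)"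
      unfolding critical(1) by (rule pvar_other_exponents[OF critical(2)])
    assume "min 1 \<rho> < H"
    then have rough: "\<rho> < H" "min 1 \<rho> = \<rho>" using H(2) by linarith+
    show "\<exists>V. V \<in> borel_measurable M \<and> (AE \<omega> in M. 0 < V \<omega>) \<and>
        (AE \<omega> in M. \<forall>t\<in>{0..1}. has_pvar (X \<omega>) b (1 / min 1 \<rho>) t (ereal (V \<omega> * t)))"
      unfolding rough(2) by (rule variation_rough[OF rough(1)])
  next
    assume "H < min 1 \<rho>"
    then have "H < \<rho>" by linarith
    then show "AE \<omega> in M. \<forall>t\<in>{0..1}. has_pvar (X \<omega>) b (1 / H) t
        (ereal (2 powr (1 / (2 * H)) * Gamma ((H + 1) / (2 * H))
          / (sqrt pi * (1 - \<alpha>\<^sup>2 * real b powr (2 * H)) powr (1 / (2 * H))) * t))"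
      by (rule variation_smooth[unfolded smooth_variation_rate_def])
  qed
qed

end
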